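(* Let $\mathcal T\subset\mathbb R^d$, $d\ge2$, be a periodic tiling with period lattice $\Lambda$ identified with $\mathbb Z^d$ after a linear map, and suppose $0\in\mathcal T$. Put $z_i=e^{-2\pi ix_i}$, $1\le i\le d$, let $Q(z)$ be the matrix defined in the context, and let $Q'(z)$, $r_0'(z)$, $c_0'(z)$ be the associated minor, row and column. Then the characteristic function of the first return distribution $\varrho$ to $\Lambda$ is $$\hat\varrho(x)=\sum_{\lambda\in\mathbb Z^d}\varrho(\lambda)e^{-2\pi ix\cdot\lambda}=Q_{0,0}(z)+r_0'(z)\,(I-Q'(z))^{-1}c_0'(z),$$ and the Fourier transform of the Green's function $g_0$ restricted to $\Lambda$ is given by $$(\deg 0)\,\hat g_0(x)=\frac{1}{1-\big(Q_{0,0}(z)+r_0'(z)\,(I-Q'(z))^{-1}c_0'(z)\big)}.$$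
   Context: **Tilings.** A periodic tiling $\mathcal T$ is a connected graph embedded in $\mathbb R^d$ which is periodic under a full-rank lattice $\Lambda$ (here identified with $\mathbb Z^d$), has finitely many vertices in a fundamental domain for $\mathbb R^d/\Lambda$, and has bounded degree. $\mathcal T$ also denotes the vertex set, and $E$ the edge set. **Matrix $Q$.** Split $\mathbb R^d$ into unit cubes by identifying $(y_1,\dots,y_d)$ with $(\lfloor y_1\rfloor,\dots,\lfloor y_d\rfloor)$. Assign each directed edge $e=(u,v)$ of $\mathcal T$ a weight $w_e$, which is the product of all $z_i$ such that the floor of the $i$-th coordinate of $v$ is greater than the floor of the $i$-th coordinate of $u$, divided by the product of all $z_j$ such that the floor of the $j$-th coordinate of $v$ is less than the floor of the $j$-th coordinate of $u$. Choose a system of representatives $0=v_0,v_1,\dots,v_m$ for $\mathcal T/\Lambda$, and let $Q=Q(z)$ be the $(m+1)\times(m+1)$ matrix, indexed by $0\le i,j\le m$, with $$Q(i,j)=\sum_{v\equiv v_j\bmod\Lambda,\ e=(v_i,v)\in E}\frac{w_e}{\deg v_i}.$$ Thus when $z\equiv1$, $Q$ is the transition matrix of simple random walk on $\mathcal T/\Lambda$. Let $c_0$ be the column of $Q$ corresponding to $v_0=0$ and $r_0$ the row corresponding to $0$. $Q'$ is the $m\times m$ minor obtained by deleting $c_0$ and $r_0$; $c_0'$ and $r_0'$ are obtained from $c_0$ and $r_0$ by deleting the $(0,0)$ entry. **Return distribution and Green's function.** Simple random walk on $\mathcal T$ has transition kernel $P(v,w)=\deg(v,w)/\deg(v)$,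 where $\deg(v,w)$ is the number of edges from $v$ to $w$; $P^n$ is the $n$-step kernel. $\varrho$ is the distribution on $\Lambda$ of the walk started at $0$ and stopped at the first positive time at which it is in $\Lambda$. The Green's function started from $0$ is $g_0(x)=\sum_{n\ge0}\big(\frac{P^n(0,x)}{\deg x}-\frac{P^n(0,0)}{\deg0}\big)$ if $d=2$ and $g_0(x)=\sum_{n\ge0}\frac{P^n(0,x)}{\deg x}$ if $d\ge3$. **Fourier transform.** The convention for functions $f$ on $\Lambda$ is $\hat f(x)=\sum_{n\in\Lambda}f(n)e^{-2\pi in\cdot x}$.
   Formalization: The weight w_e takes z_i to the power of the difference of the floors (the literal weight fails for edges jumping over a cube; both agree for adjacent cubes); the transform of g_0 is meant as a distribution on the torus, for d=2 tested on functions vanishing at 0. *)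

theory Defs
  imports
    "HOL-Probability.Probability"
    "Jordan_Normal_Form.Gauss_Jordan_Elimination"
    "Jordan_Normal_Form.Determinant"
begin

no_notation vec_index (infixl "$" 100)
no_notation scalar_prod (infix "\<bullet>" 70)

section \<open>Periodic tilings\<close>

definition integer_vectors :: "(real ^ 'n) set" where
  "integer_vectors = {y. \<forall>i. y $ i \<in> \<int>}"

text \<open>The sets \<open>\<Lambda>\<close> admitting such an \<open>L\<close> are exactly the full-rank lattices; \<open>L\<close> is the linear
  map that identifies \<open>\<Lambda>\<close> with the integer vectors.\<close>

definition identifies_lattice :: "(real ^ 'n) set \<Rightarrow> (real ^ 'n \<Rightarrow> real ^ 'n) \<Rightarrow> bool" where
  "identifies_lattice \<Lambda> L \<longleftrightarrow> linear L \<and> bij L \<and> L ` \<Lambda> = integer_vectors"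

text \<open>A graph embedded in Euclidean space has a set \<open>V\<close> of points as vertices and a set \<open>E\<close> of
  curves as edges.  The end points of an edge \<open>e\<close> are the points of \<open>e \<inter> V\<close>, and different edges
  may only meet in vertices.  Parallel edges are different curves with the same end points;
  a closed curve through exactly one vertex is a loop.\<close>

definition embedded_graph :: "(real ^ 'n) set \<Rightarrow> (real ^ 'n) set set \<Rightarrow> bool" where
  "embedded_graph V E \<longleftrightarrow>
     (\<forall>e\<in>E. \<exists>g. simple_path g \<and> path_image g = e \<and> e \<inter> V = {pathstart g, pathfinish g}) \<and>
     (\<forall>e\<in>E. \<forall>e'\<in>E. e \<noteq> e' \<longrightarrow> e \<inter> e' \<subseteq> V)"

definition edges_between ::
  "(real ^ 'n) set \<Rightarrow> (real ^ 'n) set set \<Rightarrow> real ^ 'n \<Rightarrow> real ^ 'n \<Rightarrow> (real ^ 'n) set set" where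
  "edges_between V E u w = {e \<in> E. e \<inter> V = {u, w}}"

text \<open>A loop contributes one to the degree, so that the degree is the sum of the numbers of
  edges to all vertices and the walk below is stochastic.\<close>

definition vertex_degree :: "(real ^ 'n) set set \<Rightarrow> real ^ 'n \<Rightarrow> nat" where
  "vertex_degree E v = card {e \<in> E. v \<in> e}"

definition connected_graph :: "(real ^ 'n) set \<Rightarrow> (real ^ 'n) set set \<Rightarrow> bool" where
  "connected_graph V E \<longleftrightarrow>
     (\<forall>u\<in>V. \<forall>w\<in>V. (u, w) \<in> {(a, b). edges_between V E a b \<noteq> {}}\<^sup>*)"

definition fundamental_domain :: "(real ^ 'n) set \<Rightarrow> (real ^ 'n) set \<Rightarrow> bool" where
  "fundamental_domain \<Lambda> D \<longleftrightarrow> (\<forall>x. \<exists>!l. l \<in> \<Lambda> \<and> x - l \<in> D)"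

definition periodic_tiling ::
  "(real ^ 'n) set \<Rightarrow> (real ^ 'n) set \<Rightarrow> (real ^ 'n) set set \<Rightarrow> bool" where
  "periodic_tiling \<Lambda> V E \<longleftrightarrow>
     embedded_graph V E \<and> connected_graph V E \<and>
     (\<forall>l\<in>\<Lambda>. (\<lambda>x. l + x) ` V = V \<and> (\<lambda>e. (\<lambda>x. l + x) ` e) ` E = E) \<and>
     (\<exists>D. fundamental_domain \<Lambda> D \<and> finite (V \<inter> D)) \<and>
     (\<exists>B. \<forall>v\<in>V. finite {e \<in> E. v \<in> e} \<and> vertex_degree E v \<le> B)"

section \<open>The matrix of the walk on the quotient\<close>

text \<open>Each coordinate is counted with the number of unit steps between the two cubes.  If the
  cubes agree or are adjacent (possibly diagonally), this is the quotient of products described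
  by the lemma below; for longer edges the multiplicity is needed to record the displacement.\<close>

definition edge_weight ::
  "(real ^ 'n \<Rightarrow> real ^ 'n) \<Rightarrow> ('n \<Rightarrow> complex) \<Rightarrow> real ^ 'n \<Rightarrow> real ^ 'n \<Rightarrow> complex" where
  "edge_weight L z u w = (\<Prod>i\<in>UNIV. z i powi (\<lfloor>L w $ i\<rfloor> - \<lfloor>L u $ i\<rfloor>))"

lemma edge_weight_adjacent_cubes:
  fixes u w :: "real ^ 'n"
  assumes "\<And>i. \<bar>\<lfloor>L w $ i\<rfloor> - \<lfloor>L u $ i\<rfloor>\<bar> \<le> 1"
  shows "edge_weight L z u w =
    (\<Prod>i | \<lfloor>L u $ i\<rfloor> < \<lfloor>L w $ i\<rfloor>. z i) / (\<Prod>j | \<lfloor>L w $ j\<rfloor> < \<lfloor>L u $ j\<rfloor>. z j)"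
proof -
  have "z i powi (\<lfloor>L w $ i\<rfloor> - \<lfloor>L u $ i\<rfloor>) =
      (if \<lfloor>L u $ i\<rfloor> < \<lfloor>L w $ i\<rfloor> then z i else 1) / (if \<lfloor>L w $ i\<rfloor> < \<lfloor>L u $ i\<rfloor> then z i else 1)" for i
  proof -
    consider "\<lfloor>L w $ i\<rfloor> - \<lfloor>L u $ i\<rfloor> = 0" | "\<lfloor>L w $ i\<rfloor> - \<lfloor>L u $ i\<rfloor> = 1" | "\<lfloor>L w $ i\<rfloor> - \<lfloor>L u $ i\<rfloor> = - 1"
      using assms[of i] by linarith
    then show ?thesis
    proof cases
      case 1
      then show ?thesis by simp
    next
      case 2
      then have "\<lfloor>L u $ i\<rfloor> < \<lfloor>L w $ i\<rfloor>" by linarith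
      with 2 show ?thesis by simp
    next
      case 3
      then have "\<lfloor>L w $ i\<rfloor> < \<lfloor>L u $ i\<rfloor>" by linarith
      with 3 show ?thesis by (simp add: power_int_minus inverse_eq_divide)
    qed
  qed
  then show ?thesis
    by (simp add: edge_weight_def prod_dividef prod.If_cases)
qed

definition orbit_representatives ::
  "(real ^ 'n) set \<Rightarrow> (real ^ 'n) set \<Rightarrow> nat \<Rightarrow> (nat \<Rightarrow> real ^ 'n) \<Rightarrow> bool" where
  "orbit_representatives \<Lambda> V m v \<longleftrightarrow>
     v 0 = 0 \<and> (\<forall>i\<le>m. v i \<in> V) \<and> (\<forall>u\<in>V. \<exists>!i. i \<le> m \<and> u - v i \<in> \<Lambda>)"

text \<open>The pairs \<open>(e, w)\<close> below are the directed edges from \<open>v i\<close> to a vertex \<open>w\<close> congruent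
  to \<open>v j\<close>.\<close>

definition quotient_matrix ::
  "(real ^ 'n) set \<Rightarrow> (real ^ 'n \<Rightarrow> real ^ 'n) \<Rightarrow> (real ^ 'n) set \<Rightarrow> (real ^ 'n) set set \<Rightarrow>
   nat \<Rightarrow> (nat \<Rightarrow> real ^ 'n) \<Rightarrow> ('n \<Rightarrow> complex) \<Rightarrow> complex mat" where
  "quotient_matrix \<Lambda> L V E m v z =
     mat (m + 1) (m + 1) (\<lambda>(i, j).
       \<Sum>(e, w) \<in> {(e, w). e \<in> edges_between V E (v i) w \<and> w - v j \<in> \<Lambda>}.
         edge_weight L z (v i) w / of_nat (vertex_degree E (v i)))"

text \<open>\<open>mat_delete Q 0 0\<close> removes row and column 0.\<close>

definition resolvent_base :: "complex mat \<Rightarrow> complex mat" where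
  "resolvent_base Q = 1\<^sub>m (dim_row Q - 1) - mat_delete Q 0 0"

text \<open>\<open>Q\<^sub>0\<^sub>0 + r\<^sub>0' (I - Q')\<^sup>-\<^sup>1 c\<^sub>0'\<close>; \<open>mat_inverse\<close> is only meaningful for an invertible matrix.\<close>

definition return_symbol :: "complex mat \<Rightarrow> complex" where
  "return_symbol Q =
     Q $$ (0, 0) +
     scalar_prod (Matrix.vec (dim_col Q - 1) (\<lambda>j. Q $$ (0, j + 1)))
       (the (mat_inverse (resolvent_base Q)) *\<^sub>v
        Matrix.vec (dim_row Q - 1) (\<lambda>i. Q $$ (i + 1, 0)))"

section \<open>Simple random walk\<close>

definition srw_kernel ::
  "(real ^ 'n) set \<Rightarrow> (real ^ 'n) set set \<Rightarrow> real ^ 'n \<Rightarrow> real ^ 'n \<Rightarrow> real" where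
  "srw_kernel V E u w = real (card (edges_between V E u w)) / real (vertex_degree E u)"

fun srw_power ::
  "(real ^ 'n) set \<Rightarrow> (real ^ 'n) set set \<Rightarrow> nat \<Rightarrow> real ^ 'n \<Rightarrow> real ^ 'n \<Rightarrow> real" where
  "srw_power V E 0 u w = (if u = w then 1 else 0)"
| "srw_power V E (Suc n) u w =
     (\<Sum>x \<in> {x \<in> V. edges_between V E u x \<noteq> {}}. srw_kernel V E u x * srw_power V E n x w)"

text \<open>\<open>X\<close> is a simple random walk started at \<open>a\<close>: its finite-dimensional distributions are those
  of the Markov chain with kernel \<open>srw_kernel\<close>.\<close>

definition simple_random_walk ::
  "(real ^ 'n) set \<Rightarrow> (real ^ 'n) set set \<Rightarrow> real ^ 'n \<Rightarrow> 'w measure \<Rightarrow>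
   (nat \<Rightarrow> 'w \<Rightarrow> real ^ 'n) \<Rightarrow> bool" where
  "simple_random_walk V E a M X \<longleftrightarrow>
     prob_space M \<and> (\<forall>n. X n \<in> borel_measurable M) \<and>
     (\<forall>n x. measure M {\<omega> \<in> space M. \<forall>k\<le>n. X k \<omega> = x k} =
        (if x 0 = a then \<Prod>k<n. srw_kernel V E (x k) (x (Suc k)) else 0))"

text \<open>The distribution of \<open>X\<^sub>\<tau>\<close>, where \<open>\<tau>\<close> is the first positive time with \<open>X\<^sub>\<tau> \<in> \<Lambda>\<close>.\<close>

definition first_return_dist ::
  "(real ^ 'n) set \<Rightarrow> 'w measure \<Rightarrow> (nat \<Rightarrow> 'w \<Rightarrow> real ^ 'n) \<Rightarrow> real ^ 'n \<Rightarrow> real" where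
  "first_return_dist \<Lambda> M X l =
     measure M {\<omega> \<in> space M. \<exists>n>0. X n \<omega> \<in> \<Lambda> \<and> (\<forall>k. 0 < k \<and> k < n \<longrightarrow> X k \<omega> \<notin> \<Lambda>) \<and> X n \<omega> = l}"

text \<open>The Green's function started from the origin.  In dimension two the series converges only
  conditionally, in the given order.\<close>

definition green_function ::
  "(real ^ 'n) set \<Rightarrow> (real ^ 'n) set set \<Rightarrow> real ^ 'n \<Rightarrow> real" where
  "green_function V E x =
     (if CARD('n) = 2
      then (\<Sum>n. srw_power V E n 0 x / real (vertex_degree E x)
                - srw_power V E n 0 0 / real (vertex_degree E 0))
      else (\<Sum>n. srw_power V E n 0 x / real (vertex_degree E x)))"

section \<open>Fourier transform on the lattice\<close>

definition lattice_character ::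
  "(real ^ 'n \<Rightarrow> real ^ 'n) \<Rightarrow> real ^ 'n \<Rightarrow> real ^ 'n \<Rightarrow> complex" where
  "lattice_character L x l = exp (- (2 * of_real pi * \<i> * of_real (x \<bullet> L l)))"

definition unit_phases :: "real ^ 'n \<Rightarrow> 'n \<Rightarrow> complex" where
  "unit_phases x i = exp (- (2 * of_real pi * \<i> * of_real (x $ i)))"

text \<open>Iterated partial derivatives of all orders exist and are continuous; \<open>D is\<close> is the
  derivative along the list of directions \<open>is\<close>.\<close>

definition smooth_function :: "(real ^ 'n \<Rightarrow> complex) \<Rightarrow> bool" where
  "smooth_function \<phi> \<longleftrightarrow>
     (\<exists>D :: 'n list \<Rightarrow> real ^ 'n \<Rightarrow> complex. D [] = \<phi> \<and>
        (\<forall>is. continuous_on UNIV (D is) \<and>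
          (\<forall>i x. ((\<lambda>t. D is (x + t *\<^sub>R axis i 1)) has_vector_derivative D (i # is) x) (at 0))))"

definition torus_test_function :: "(real ^ 'n \<Rightarrow> complex) \<Rightarrow> bool" where
  "torus_test_function \<phi> \<longleftrightarrow>
     smooth_function \<phi> \<and> (\<forall>k\<in>integer_vectors. \<forall>x. \<phi> (x + k) = \<phi> x)"

text \<open>The series \<open>\<Sum>\<^sub>l f(l) exp (-2\<pi>i x\<cdot>L l)\<close> need not converge pointwise for functions \<open>f\<close> that are
  not summable (such as the Green's function), so its sum \<open>F\<close> is taken in the sense of
  distributions on the torus, tested on the smooth periodic functions vanishing on \<open>Z\<close>.
  For empty \<open>Z\<close> these are all test functions; for \<open>Z = {0}\<close> the transform is determined up to a
  point mass at the origin, and in particular as a distribution on the punctured torus.\<close>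

definition has_fourier_transform_off ::
  "(real ^ 'n) set \<Rightarrow> (real ^ 'n) set \<Rightarrow> (real ^ 'n \<Rightarrow> real ^ 'n) \<Rightarrow>
   (real ^ 'n \<Rightarrow> complex) \<Rightarrow> (real ^ 'n \<Rightarrow> complex) \<Rightarrow> bool" where
  "has_fourier_transform_off Z \<Lambda> L f F \<longleftrightarrow>
     (\<forall>\<phi>. torus_test_function \<phi> \<and> (\<forall>y\<in>Z. \<phi> y = 0) \<longrightarrow>
        set_integrable lborel (cbox 0 1) (\<lambda>y. F y * \<phi> y) \<and>
        ((\<lambda>l. f l * (LINT y:cbox 0 1|lborel. lattice_character L y l * \<phi> y))
           has_sum (LINT y:cbox 0 1|lborel. F y * \<phi> y)) \<Lambda>)"

end

theory Submission
  imports Defs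
begin

text \<open>The walk commutes with the translations in \<open>\<Lambda>\<close>.  For a frequency \<open>x\<close> let \<open>\<chi>(l)\<close> denote the
character \<open>exp (- 2\<pi>i x \<bullet> L l)\<close>, and call a function \<open>f\<close> on the vertices quasi-periodic if
\<open>f(u + l) = \<chi>(l) f(u)\<close>.  Such a function is determined by its values at the representatives, and
after division by the phase of the cube containing \<open>u\<close> the transition operator acts on these values
by the matrix \<open>Q(z)\<close>: the weight of an edge is the quotient of the phases at its end points.

Let \<open>W(u)\<close> be the expectation of \<open>\<chi>\<close> at the first point of \<open>\<Lambda>\<close> visited by the walk from \<open>u\<close>.  Off
the lattice \<open>W\<close> is reproduced by averaging over one step, so its values at the representatives solve
the linear system with matrix \<open>I - Q'\<close> and right hand side \<open>c\<^sub>0'\<close>.  Averaging \<open>W\<close> over one step from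
the origin gives the characteristic function \<open>\<rho>\<close> of the first return on the one hand and
\<open>Q\<^sub>0\<^sub>0 + r\<^sub>0' (I - Q')\<^sup>-\<^sup>1 c\<^sub>0'\<close> on the other (\<open>return_symbol_eq_rhohat\<close>).  The matrix is invertible
because the walk killed on \<open>\<Lambda>\<close> loses a fixed proportion of its mass within a bounded time.

For the Green function, one step multiplies \<open>W\<close> on the lattice by \<open>\<rho>\<close> and changes nothing elsewhere.
Iterating this \<open>N\<close> times yields \<open>(1 - \<rho>) S\<^sub>N = 1 - (P\<^sup>N W)(0)\<close>, where \<open>S\<^sub>N\<close> is the transform of the
Green function truncated to \<open>N\<close> steps (\<open>renewal\<close>).  As \<open>\<bar>W\<bar> \<le> 1\<close>, the \<open>S\<^sub>N\<close> are dominated by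
\<open>2 / \<bar>1 - \<rho>\<bar>\<close>.  They converge to \<open>1 / (1 - \<rho>)\<close> unless \<open>2x\<close> is an integer vector: otherwise
walks of equal length that end at \<open>0\<close> and at some \<open>2l\<close> interfere, and \<open>P\<^sup>N\<close> contracts quasi-periodic
functions to zero (\<open>free_walk_decay\<close>).  The exceptional frequencies form a null set.

The tiling is connected, so the possible returns generate \<open>\<Lambda>\<close>, and \<open>\<bar>1 - \<rho>(x)\<bar>\<close> is bounded below by a
multiple of the squared distance of \<open>x\<close> to the integer points (\<open>return_symbol_lower_bound\<close>).  In
particular \<open>\<rho>(x) \<noteq> 1\<close> off the integer points, and in dimension at least three the dominating function
is integrable over the unit cube.  In dimension two one power of the singularity is cancelled, by the
subtraction of the value at the origin when the Green function itself is computed and by the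
vanishing of the test function when its transform is.  Dominated convergence therefore identifies
the values of the Green function as limits of Fourier coefficients of \<open>S\<^sub>N\<close>, with at most polynomial
growth.  The coefficients of a smooth periodic function decay fast enough to pass to the limit in the
sum over \<open>\<Lambda>\<close> as well (\<open>green_fourier_transform\<close>).  In dimension two the subtracted constant is
multiplied by the sum of all Fourier coefficients of the test function, which is zero because the
test function vanishes at the origin; this instance of Fourier inversion is obtained with the
Fejer kernel (\<open>infsum_fourier_coeff_eq_0\<close>).\<close>

section \<open>Characters and periodic functions on the unit cube\<close>

definition integer_periodic :: "(real ^ 'n \<Rightarrow> 'a) \<Rightarrow> bool" where
  "integer_periodic h \<longleftrightarrow> (\<forall>k\<in>integer_vectors. \<forall>x. h (x + k) = h x)"

definition torus_char :: "real ^ 'n \<Rightarrow> real ^ 'n \<Rightarrow> complex" where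
  "torus_char k y = exp (- (2 * of_real pi * \<i> * of_real (y \<bullet> k)))"

definition fourier_coeff :: "(real ^ 'n \<Rightarrow> complex) \<Rightarrow> real ^ 'n \<Rightarrow> complex" where
  "fourier_coeff \<phi> k = (LINT y:cbox 0 1|lborel. torus_char k y * \<phi> y)"

lemma lattice_character_eq: "lattice_character L x l = torus_char (L l) x"
  by (simp add: lattice_character_def torus_char_def)

lemma torus_char_cis: "torus_char k y = cis (- (2 * pi * (y \<bullet> k)))"
  by (simp add: torus_char_def cis_conv_exp mult_ac)

lemma norm_torus_char [simp]: "norm (torus_char k y) = 1"
  by (simp add: torus_char_cis)

lemma torus_char_prod:
  "torus_char k y = (\<Prod>i\<in>UNIV. cis (2 * pi * (y $ i * - (k $ i))))"
proof -
  have "torus_char k y = exp (\<Sum>i\<in>UNIV. - (2 * of_real pi * \<i> * of_real (y $ i * k $ i)))"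
    by (simp add: torus_char_def inner_vec_def sum_negf sum_distrib_left)
  also have "\<dots> = (\<Prod>i\<in>UNIV. exp (- (2 * of_real pi * \<i> * of_real (y $ i * k $ i))))"
    by (simp add: exp_sum)
  also have "\<dots> = (\<Prod>i\<in>UNIV. cis (2 * pi * (y $ i * - (k $ i))))"
    by (simp add: cis_conv_exp mult_ac)
  finally show ?thesis .
qed

lemma torus_char_zero [simp]: "torus_char 0 y = 1" "torus_char k 0 = 1"
  by (simp_all add: torus_char_cis)

lemma torus_char_add: "torus_char (k + l) y = torus_char k y * torus_char l y"
  by (simp add: torus_char_cis cis_mult inner_add_right ring_distribs)

lemma torus_char_add_point: "torus_char k (x + y) = torus_char k x * torus_char k y"
  by (simp add: torus_char_cis cis_mult inner_add_left ring_distribs)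

lemma torus_char_minus: "torus_char (- k) y = cnj (torus_char k y)"
  by (simp add: torus_char_cis cis_cnj)

lemma torus_char_diff: "torus_char (k - l) y = torus_char k y * cnj (torus_char l y)"
  using torus_char_add[of k "- l" y] by (simp add: torus_char_minus)

lemma continuous_on_torus_char [continuous_intros]: "continuous_on S (torus_char k)"
  unfolding torus_char_def by (intro continuous_intros)

lemma integer_vectors_simps [simp]:
  "0 \<in> integer_vectors" "axis i 1 \<in> integer_vectors"
  by (auto simp: integer_vectors_def axis_def)

lemma integer_vectors_add: "k \<in> integer_vectors \<Longrightarrow> l \<in> integer_vectors \<Longrightarrow> k + l \<in> integer_vectors"
  and integer_vectors_diff: "k \<in> integer_vectors \<Longrightarrow> l \<in> integer_vectors \<Longrightarrow> k - l \<in> integer_vectors"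
  and integer_vectors_minus: "k \<in> integer_vectors \<Longrightarrow> - k \<in> integer_vectors"
  by (auto simp: integer_vectors_def)

lemma inner_integer_vectors:
  assumes "k \<in> integer_vectors" "l \<in> integer_vectors"
  shows "k \<bullet> l \<in> \<int>"
  using assms by (auto simp: integer_vectors_def inner_vec_def intro!: Ints_sum)

lemma torus_char_integer: 
  assumes "k \<in> integer_vectors" "y \<in> integer_vectors"
  shows "torus_char k y = 1"
proof -
  obtain n where "y \<bullet> k = of_int n"
    using inner_integer_vectors[OF assms(2,1)] by (auto elim: Ints_cases)
  then have "torus_char k y = cis (2 * pi * of_int (- n))"
    by (simp add: torus_char_cis)
  then show ?thesis by (simp only: cis_multiple_2pi Ints_of_int)
qed

lemma integer_periodic_torus_char: "k \<in> integer_vectors \<Longrightarrow> integer_periodic (torus_char k)"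
  by (simp add: integer_periodic_def torus_char_add_point torus_char_integer)

lemma integer_periodic_mult:
  "integer_periodic f \<Longrightarrow> integer_periodic g \<Longrightarrow> integer_periodic (\<lambda>x. f x * g x)"
  by (simp add: integer_periodic_def)

lemma set_integrable_continuous_cube:
  fixes h :: "real ^ 'n \<Rightarrow> 'b::euclidean_space"
  assumes "continuous_on UNIV h"
  shows "set_integrable lborel (cbox 0 1) h"
  unfolding set_integrable_def
  by (rule borel_integrable_compact) (auto intro: continuous_on_subset[OF assms])

lemma cube_integral_eq_HK:
  fixes h :: "real ^ 'n \<Rightarrow> complex"
  assumes "continuous_on UNIV h"
  shows "(LINT y:cbox 0 1|lborel. h y) = integral (cbox 0 1) h"
  using set_borel_integral_eq_integral(2)[OF set_integrable_continuous_cube[OF assms]] .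

text \<open>The part of the translated cube that sticks out of the unit cube is the translate by a period
  of the part of the unit cube that has been left.\<close>

lemma integral_periodic_translate:
  fixes h :: "real ^ 'n \<Rightarrow> complex"
  assumes cont: "continuous_on UNIV h" and per: "integer_periodic h" and t: "0 \<le> t" "t \<le> 1"
  shows "integral (cbox 0 1) (\<lambda>x. h (x + t *\<^sub>R axis i 1)) = integral (cbox 0 1) h"
proof -
  define e :: "real ^ 'n" where "e = axis i 1"
  have e: "e \<in> Basis" by (simp add: e_def)
  have inn: "x \<bullet> e = x $ i" for x by (simp add: e_def inner_axis)
  have e_nth: "e $ j = (if j = i then 1 else 0)" for j by (simp add: e_def axis_def)
  have int: "h integrable_on cbox a b" for a b
    by (intro integrable_continuous continuous_on_subset[OF cont]) auto
  have has: "(h has_integral integral (cbox a b) h) (cbox a b)" for a b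
    using int by (simp add: integrable_integral)
  let ?A = "cbox 0 (1 - (1 - t) *\<^sub>R e)" and ?B = "cbox (t *\<^sub>R e) 1"
  let ?A' = "cbox (0 + e) ((1 - (1 - t) *\<^sub>R e) + e)"
  have box: "x \<in> cbox a b \<longleftrightarrow>
      (a $ i \<le> x $ i \<and> x $ i \<le> b $ i) \<and> (\<forall>j. j \<noteq> i \<longrightarrow> a $ j \<le> x $ j \<and> x $ j \<le> b $ j)"
    for a b x :: "real ^ 'n"
    unfolding mem_box_cart by metis
  have memA: "?A = cbox 0 1 \<inter> {x. x \<bullet> e \<le> t}"
    and memB: "?B = cbox 0 1 \<inter> {x. x \<bullet> e \<ge> t}"
    and memB': "?B = cbox (t *\<^sub>R e) (1 + t *\<^sub>R e) \<inter> {x. x \<bullet> e \<le> 1}"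
    and memA': "?A' = cbox (t *\<^sub>R e) (1 + t *\<^sub>R e) \<inter> {x. x \<bullet> e \<ge> 1}"
    unfolding set_eq_iff Int_iff mem_Collect_eq box inn using t by (auto simp: e_nth)
  have "(h has_integral (integral ?A h + integral ?B h)) (cbox 0 1)"
    by (intro has_integral_split[OF _ _ e, where c = t]) (simp_all only: memA[symmetric] memB[symmetric] has)
  then have 1: "integral (cbox 0 1) h = integral ?A h + integral ?B h"
    by (rule integral_unique)
  have "(h has_integral (integral ?B h + integral ?A' h)) (cbox (t *\<^sub>R e) (1 + t *\<^sub>R e))"
    by (intro has_integral_split[OF _ _ e, where c = 1]) (simp_all only: memA'[symmetric] memB'[symmetric] has)
  then have 2: "integral (cbox (t *\<^sub>R e) (1 + t *\<^sub>R e)) h = integral ?B h + integral ?A' h"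
    by (rule integral_unique)
  have "integral ?A' h = integral ?A (h \<circ> (+) e)"
    by (rule integral_shift_cbox_plus[symmetric])
  also have "h \<circ> (+) e = h"
    using per by (auto simp: integer_periodic_def e_def fun_eq_iff add.commute[of "axis i 1"])
  finally have 3: "integral ?A' h = integral ?A h" .
  have "integral (cbox 0 1) (\<lambda>x. h (x + t *\<^sub>R e)) = integral (cbox 0 1) (h \<circ> (+) (t *\<^sub>R e))"
    by (simp add: o_def add.commute)
  also have "\<dots> = integral (cbox (t *\<^sub>R e) (1 + t *\<^sub>R e)) h"
    using integral_shift_cbox_plus[of 0 1 h "t *\<^sub>R e"] by simp
  finally show ?thesis using 1 2 3 by (simp add: e_def)
qed

lemma measure_unit_cube [simp]: "measure lborel (cbox 0 (1 :: real ^ 'n)) = 1"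
proof -
  have "0 \<in> cbox 0 (1 :: real ^ 'n)" by (simp add: mem_box_cart)
  then show ?thesis by (subst content_cbox_cart) auto
qed

text \<open>Translation by half a period along a coordinate in which the frequency does not vanish reverses
  the sign of the character but preserves its integral.\<close>

lemma integral_torus_char:
  fixes k :: "real ^ 'n"
  assumes k: "k \<in> integer_vectors"
  shows "integral (cbox 0 1) (torus_char k) = (if k = 0 then 1 else 0)"
proof (cases "k = 0")
  case True
  show ?thesis using True by (simp add: torus_char_zero[abs_def])
next
  case False
  then obtain i where i: "k $ i \<noteq> 0" by (auto simp: Finite_Cartesian_Product.vec_eq_iff)
  then have i1: "\<bar>k $ i\<bar> \<ge> 1" using k by (auto simp: integer_vectors_def intro: Ints_nonzero_abs_ge1)
  define t where "t = 1 / (2 * \<bar>k $ i\<bar>)"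
  have t: "0 \<le> t" "t \<le> 1" using i1 by (auto simp: t_def field_simps)
  have "(t *\<^sub>R axis i 1) \<bullet> k = t * k $ i" by (simp add: inner_axis inner_commute)
  also have "\<dots> = sgn (k $ i) / 2" using i by (auto simp: t_def sgn_if)
  finally have tk: "(t *\<^sub>R axis i 1) \<bullet> k = sgn (k $ i) / 2" .
  have "torus_char k (t *\<^sub>R axis i 1) = cis (- (2 * pi * (sgn (k $ i) / 2)))"
    by (simp only: torus_char_cis tk)
  also have "\<dots> = -1"
    using i by (cases "k $ i > 0") (auto simp: complex_eq_iff)
  finally have "torus_char k (t *\<^sub>R axis i 1) = -1" .
  then have "integral (cbox 0 1) (\<lambda>x. torus_char k (x + t *\<^sub>R axis i 1)) =
      - integral (cbox 0 1) (torus_char k)"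
    by (simp add: torus_char_add_point)
  moreover have "integral (cbox 0 1) (\<lambda>x. torus_char k (x + t *\<^sub>R axis i 1)) =
      integral (cbox 0 1) (torus_char k)"
    by (rule integral_periodic_translate[OF _ integer_periodic_torus_char[OF k] t])
      (intro continuous_intros)
  ultimately show ?thesis using False by simp
qed

lemma has_vector_derivative_along_axis:
  fixes h :: "real ^ 'n \<Rightarrow> complex"
  assumes "\<And>x. ((\<lambda>t. h (x + t *\<^sub>R axis i 1)) has_vector_derivative h' x) (at 0)"
  shows "((\<lambda>t. h (x + t *\<^sub>R axis i 1)) has_vector_derivative h' (x + s *\<^sub>R axis i 1)) (at s)"
proof -
  have "((\<lambda>t. h ((x + s *\<^sub>R axis i 1) + t *\<^sub>R axis i 1)) has_vector_derivative
      h' (x + s *\<^sub>R axis i 1)) (at (s - s))"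
    using assms by simp
  moreover have "((\<lambda>t. t - s) has_vector_derivative 1) (at s)"
    by (auto intro!: derivative_eq_intros)
  ultimately have "((\<lambda>t. h ((x + s *\<^sub>R axis i 1) + t *\<^sub>R axis i 1)) \<circ> (\<lambda>t. t - s) has_vector_derivative
      1 *\<^sub>R h' (x + s *\<^sub>R axis i 1)) (at s)"
    by (intro vector_diff_chain_at)
  then show ?thesis by (simp add: o_def algebra_simps)
qed

lemma continuous_integer_periodic_bounded:
  fixes h :: "real ^ 'n \<Rightarrow> complex"
  assumes cont: "continuous_on UNIV h" and per: "integer_periodic h"
  obtains B where "B > 0" "\<And>x. norm (h x) \<le> B"
proof -
  have "compact (h ` cbox 0 1)"
    by (intro compact_continuous_image continuous_on_subset[OF cont]) auto
  then obtain B where B: "B > 0" "\<And>x. x \<in> cbox 0 1 \<Longrightarrow> norm (h x) \<le> B"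
    using compact_imp_bounded bounded_pos by (metis imageI)
  have "norm (h x) \<le> B" for x
  proof -
    define k :: "real ^ 'n" where "k = (\<chi> i. of_int \<lfloor>x $ i\<rfloor>)"
    have "k \<in> integer_vectors" by (simp add: k_def integer_vectors_def)
    then have "h x = h (x - k)"
      using per by (metis diff_add_cancel integer_periodic_def)
    moreover have "x - k \<in> cbox 0 1"
    proof -
      have "0 \<le> x $ i - of_int \<lfloor>x $ i\<rfloor> \<and> x $ i - of_int \<lfloor>x $ i\<rfloor> \<le> 1" for i
        using floor_correct[of "x $ i"] by linarith
      then show ?thesis by (auto simp: mem_box_cart k_def)
    qed
    ultimately show ?thesis using B(2) by metis
  qed
  then show ?thesis using B(1) that by blast
qed

lemma axis_lipschitz:
  fixes h :: "real ^ 'n \<Rightarrow> complex"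
  assumes der: "\<And>x. ((\<lambda>t. h (x + t *\<^sub>R axis i 1)) has_vector_derivative h' x) (at 0)"
    and B: "\<And>x. norm (h' x) \<le> B"
  shows "norm (h (x + t *\<^sub>R axis i 1) - h x) \<le> B * \<bar>t\<bar>"
proof -
  have "norm ((\<lambda>t. h (x + t *\<^sub>R axis i 1)) t - (\<lambda>t. h (x + t *\<^sub>R axis i 1)) 0) \<le> B * norm (t - 0)"
  proof (rule differentiable_bound[where f' = "\<lambda>s u. u *\<^sub>R h' (x + s *\<^sub>R axis i 1)" and S = UNIV])
    fix s show "((\<lambda>t. h (x + t *\<^sub>R axis i 1)) has_derivative (\<lambda>u. u *\<^sub>R h' (x + s *\<^sub>R axis i 1))) (at s within UNIV)"
      using has_vector_derivative_along_axis[OF der] by (simp add: has_vector_derivative_def)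
    show "onorm (\<lambda>u. u *\<^sub>R h' (x + s *\<^sub>R axis i 1)) \<le> B"
    proof (rule onorm_bound)
      show "norm (u *\<^sub>R h' (x + s *\<^sub>R axis i 1)) \<le> B * norm u" for u
        using mult_left_mono[OF B, of "\<bar>u\<bar>"] by (simp add: mult.commute)
    qed (use order_trans[OF norm_ge_zero B] in simp)
  qed auto
  then show ?thesis by simp
qed

text \<open>The integral of \<open>h (x + t e) - h x\<close> vanishes for all \<open>t\<close>; divide by \<open>t\<close> and let \<open>t\<close> tend to zero.\<close>

lemma integral_axis_derivative_periodic:
  fixes h :: "real ^ 'n \<Rightarrow> complex"
  assumes cont: "continuous_on UNIV h" and per: "integer_periodic h"
    and B: "\<And>x. norm (h' x) \<le> B"
    and der: "\<And>x. ((\<lambda>t. h (x + t *\<^sub>R axis i 1)) has_vector_derivative h' x) (at 0)"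
  shows "integral (cbox 0 1) h' = 0"
proof -
  define g where "g = (\<lambda>n x. (h (x + (1 / real (Suc n)) *\<^sub>R axis i 1) - h x) /\<^sub>R (1 / real (Suc n)))"
  have cont': "continuous_on S (\<lambda>x. h (x + u))" for S u
    by (rule continuous_on_compose2[OF cont]) (auto intro!: continuous_intros)
  have gint: "g n integrable_on cbox 0 1" for n
    unfolding g_def
    by (intro integrable_continuous continuous_intros cont' continuous_on_subset[OF cont]) auto
  have int0: "integral (cbox 0 1) (g n) = 0" for n
  proof -
    have "integral (cbox 0 1) (\<lambda>x. h (x + (1 / real (Suc n)) *\<^sub>R axis i 1) - h x) =
       integral (cbox 0 1) (\<lambda>x. h (x + (1 / real (Suc n)) *\<^sub>R axis i 1)) - integral (cbox 0 1) h"
      by (rule integral_diff) (auto intro!: integrable_continuous cont' continuous_on_subset[OF cont])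
    also have "\<dots> = 0"
      by (subst integral_periodic_translate[OF cont per]) (auto simp: field_simps)
    finally show ?thesis by (simp add: g_def)
  qed
  have "(\<lambda>n. integral (cbox 0 1) (g n)) \<longlonglongrightarrow> integral (cbox 0 1) h'"
  proof (rule dominated_convergence(2)[OF gint, where h = "\<lambda>x. B"])
    show "(\<lambda>x. B) integrable_on cbox 0 (1 :: real ^ 'n)" by auto
    fix n x
    have "norm (g n x) = norm (h (x + (1 / real (Suc n)) *\<^sub>R axis i 1) - h x) * real (Suc n)"
      by (simp add: g_def)
    also have "\<dots> \<le> (B * \<bar>1 / real (Suc n)\<bar>) * real (Suc n)"
      by (intro mult_right_mono axis_lipschitz[OF der B]) auto
    finally show "norm (g n x) \<le> B" by simp
  next
    fix x
    let ?q = "\<lambda>y. (h (x + y *\<^sub>R axis i 1) - h x) /\<^sub>R y"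
    have "((\<lambda>y. norm (h (x + y *\<^sub>R axis i 1) - h x - y *\<^sub>R h' x) / norm y) \<longlongrightarrow> 0) (at 0)"
      using der[of x] by (simp add: has_vector_derivative_def has_derivative_at)
    moreover have "\<forall>\<^sub>F y in at 0. norm (h (x + y *\<^sub>R axis i 1) - h x - y *\<^sub>R h' x) / norm y =
          norm (?q y - h' x)"
    proof -
      have "norm (h (x + y *\<^sub>R axis i 1) - h x - y *\<^sub>R h' x) / norm y = norm (?q y - h' x)"
        if "y \<noteq> 0" for y
      proof -
        have "?q y - h' x = (h (x + y *\<^sub>R axis i 1) - h x - y *\<^sub>R h' x) /\<^sub>R y"
          using that by (simp add: scaleR_diff_right)
        then show ?thesis by (simp add: divide_inverse mult.commute)
      qed
      then show ?thesis
        unfolding eventually_at_filter by (intro always_eventually) blast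
    qed
    ultimately have "((\<lambda>y. norm (?q y - h' x)) \<longlongrightarrow> 0) (at 0)"
      by (rule Lim_transform_eventually)
    then have "((\<lambda>y. ?q y - h' x) \<longlongrightarrow> 0) (at 0)"
      by (rule tendsto_norm_zero_cancel)
    then have "(?q \<longlongrightarrow> h' x) (at 0)"
      by (rule LIM_zero_cancel)
    moreover have "filterlim (\<lambda>n. 1 / real (Suc n)) (at 0) sequentially"
    proof -
      have "(\<lambda>n. 1 / real (Suc n)) \<longlonglongrightarrow> 0"
        using LIMSEQ_inverse_real_of_nat by (simp only: inverse_eq_divide)
      then show ?thesis
        unfolding filterlim_at by (intro conjI always_eventually allI) (simp_all del: of_nat_Suc)
    qed
    ultimately show "(\<lambda>n. g n x) \<longlonglongrightarrow> h' x"
      unfolding g_def by (rule filterlim_compose)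
  qed
  then show ?thesis by (simp add: int0 LIMSEQ_const_iff)
qed

section \<open>Decay of the Fourier coefficients of test functions\<close>

lemma fourier_coeff_eq_HK:
  assumes "continuous_on UNIV \<phi>"
  shows "fourier_coeff \<phi> k = integral (cbox 0 1) (\<lambda>y. torus_char k y * \<phi> y)"
  unfolding fourier_coeff_def
  by (intro cube_integral_eq_HK continuous_intros assms)

lemma norm_fourier_coeff_le:
  assumes "continuous_on UNIV \<phi>" and B: "\<And>x. norm (\<phi> x) \<le> B"
  shows "norm (fourier_coeff \<phi> k) \<le> B"
proof -
  have "norm (integral (cbox 0 1) (\<lambda>y. torus_char k y * \<phi> y)) \<le> B * measure lborel (cbox 0 (1 :: real ^ 'a))"
  proof (rule has_integral_bound)
    show "((\<lambda>y. torus_char k y * \<phi> y) has_integral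
        integral (cbox 0 1) (\<lambda>y. torus_char k y * \<phi> y)) (cbox 0 1)"
      by (intro integrable_integral integrable_continuous continuous_intros
          continuous_on_subset[OF assms(1)]) auto
  qed (use B order_trans[OF norm_ge_zero B] in \<open>auto simp: norm_mult\<close>)
  then show ?thesis by (simp add: fourier_coeff_eq_HK[OF assms(1)])
qed

lemma has_vector_derivative_torus_char:
  "((\<lambda>t. torus_char k (x + t *\<^sub>R axis i 1)) has_vector_derivative
     - (2 * of_real pi * \<i> * of_real (k $ i)) * torus_char k x) (at 0)"
proof -
  have "((\<lambda>t. exp (t *\<^sub>R (- (2 * of_real pi * \<i> * of_real (k $ i))))) has_vector_derivative
      (- (2 * of_real pi * \<i> * of_real (k $ i))) *
      exp (0 *\<^sub>R (- (2 * of_real pi * \<i> * of_real (k $ i))))) (at 0)"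
    by (rule exp_scaleR_has_vector_derivative_left)
  then have "((\<lambda>t. torus_char k x * exp (t *\<^sub>R (- (2 * of_real pi * \<i> * of_real (k $ i))))) has_vector_derivative
      torus_char k x * (- (2 * of_real pi * \<i> * of_real (k $ i)))) (at 0)"
    by (intro has_vector_derivative_mult_right) simp
  moreover have "torus_char k (x + t *\<^sub>R axis i 1) =
      torus_char k x * exp (t *\<^sub>R (- (2 * of_real pi * \<i> * of_real (k $ i))))" for t
  proof -
    have "(t *\<^sub>R axis i 1) \<bullet> k = t * k $ i" by (simp add: inner_axis')
    then show ?thesis
      unfolding torus_char_add_point
      by (simp only: torus_char_def) (simp add: scaleR_conv_of_real[where 'a = complex] mult_ac del: inner_scaleR_left)
  qed
  ultimately show ?thesis by (simp add: mult_ac)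
qed

text \<open>The product of the function and the character is periodic, so integration by parts leaves no
  boundary terms.\<close>

lemma fourier_coeff_axis_derivative:
  assumes cont: "continuous_on UNIV \<phi>" "continuous_on UNIV \<phi>'"
    and per: "integer_periodic \<phi>" "integer_periodic \<phi>'"
    and der: "\<And>x. ((\<lambda>t. \<phi> (x + t *\<^sub>R axis i 1)) has_vector_derivative \<phi>' x) (at 0)"
    and k: "k \<in> integer_vectors"
  shows "fourier_coeff \<phi>' k = 2 * of_real pi * \<i> * of_real (k $ i) * fourier_coeff \<phi> k"
proof -
  define c where "c = 2 * of_real pi * \<i> * complex_of_real (k $ i)"
  define h' where "h' = (\<lambda>x. torus_char k x * \<phi>' x - c * (torus_char k x * \<phi> x))"
  have per_h': "integer_periodic h'"
    using per integer_periodic_torus_char[OF k] by (simp add: integer_periodic_def h'_def)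
  have cont_h': "continuous_on UNIV h'"
    unfolding h'_def by (intro continuous_intros cont)
  obtain B where B: "\<And>x. norm (h' x) \<le> B"
    using continuous_integer_periodic_bounded[OF cont_h' per_h'] by blast
  have "integral (cbox 0 1) h' = 0"
  proof (rule integral_axis_derivative_periodic[OF _ _ B])
    show "continuous_on UNIV (\<lambda>x. torus_char k x * \<phi> x)" by (intro continuous_intros cont)
    show "integer_periodic (\<lambda>x. torus_char k x * \<phi> x)"
      by (intro integer_periodic_mult integer_periodic_torus_char k per)
    fix x
    have "((\<lambda>t. torus_char k (x + t *\<^sub>R axis i 1) * \<phi> (x + t *\<^sub>R axis i 1)) has_vector_derivative
        torus_char k (x + 0 *\<^sub>R axis i 1) * \<phi>' x + (- c * torus_char k x) * \<phi> (x + 0 *\<^sub>R axis i 1)) (at 0)"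
      unfolding c_def by (intro has_vector_derivative_mult has_vector_derivative_torus_char der)
    then show "((\<lambda>t. torus_char k (x + t *\<^sub>R axis i 1) * \<phi> (x + t *\<^sub>R axis i 1)) has_vector_derivative h' x) (at 0)"
      by (simp add: h'_def algebra_simps)
  qed
  moreover have "integral (cbox 0 1) h' = fourier_coeff \<phi>' k - c * fourier_coeff \<phi> k"
  proof -
    have "integral (cbox 0 1) h' = integral (cbox 0 1) (\<lambda>x. torus_char k x * \<phi>' x) -
        integral (cbox 0 1) (\<lambda>x. c * (torus_char k x * \<phi> x))"
      unfolding h'_def
      by (intro integral_diff integrable_continuous continuous_intros
          continuous_on_subset[OF cont(1)] continuous_on_subset[OF cont(2)]) auto
    then show ?thesis by (simp add: fourier_coeff_eq_HK cont)
  qed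
  ultimately show ?thesis by (simp add: c_def)
qed

text \<open>The product, rather than the norm, of the frequency is used as a weight because sums of
  products over the lattice factor.\<close>

definition lattice_weight :: "real ^ 'n \<Rightarrow> real" where
  "lattice_weight k = (\<Prod>i\<in>UNIV. max 1 \<bar>k $ i\<bar>)"

lemma lattice_weight_ge_1: "1 \<le> lattice_weight k"
  unfolding lattice_weight_def by (intro prod_ge_1) auto

lemma abs_nth_le_lattice_weight: "\<bar>k $ i\<bar> \<le> lattice_weight k"
proof -
  have "\<bar>k $ i\<bar> * 1 \<le> max 1 \<bar>k $ i\<bar> * (\<Prod>j\<in>UNIV - {i}. max 1 \<bar>k $ j\<bar>)"
    by (intro mult_mono prod_ge_1) auto
  also have "\<dots> = lattice_weight k"
    unfolding lattice_weight_def by (subst prod.remove[of UNIV i]) auto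
  finally show ?thesis by simp
qed

lemma periodic_axis_derivative:
  fixes \<phi> :: "real ^ 'n \<Rightarrow> complex"
  assumes "integer_periodic \<phi>"
    and der: "\<And>x. ((\<lambda>t. \<phi> (x + t *\<^sub>R axis i 1)) has_vector_derivative \<phi>' x) (at 0)"
  shows "integer_periodic \<phi>'"
  unfolding integer_periodic_def
proof (intro ballI allI)
  fix k x :: "real ^ 'n" assume k: "k \<in> integer_vectors"
  have "\<phi> (x + k + t *\<^sub>R axis i 1) = \<phi> (x + t *\<^sub>R axis i 1)" for t
  proof -
    have "x + k + t *\<^sub>R axis i 1 = (x + t *\<^sub>R axis i 1) + k" by simp
    then show ?thesis using assms(1) k by (simp only: integer_periodic_def)
  qed
  then have "((\<lambda>t. \<phi> (x + t *\<^sub>R axis i 1)) has_vector_derivative \<phi>' (x + k)) (at 0)"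
    using der[of "x + k"] by simp
  then show "\<phi>' (x + k) = \<phi>' x"
    using der vector_derivative_unique_at by blast
qed

lemma torus_test_function_derivatives:
  assumes "torus_test_function \<phi>"
  obtains D :: "'n list \<Rightarrow> real ^ 'n \<Rightarrow> complex" where "D [] = \<phi>"
    "\<And>is. continuous_on UNIV (D is)" "\<And>is. integer_periodic (D is)"
    "\<And>is i x. ((\<lambda>t. D is (x + t *\<^sub>R axis i 1)) has_vector_derivative D (i # is) x) (at 0)"
proof -
  obtain D :: "'n list \<Rightarrow> real ^ 'n \<Rightarrow> complex" where D: "D [] = \<phi>"
    "\<And>is. continuous_on UNIV (D is)"
    "\<And>is i x. ((\<lambda>t. D is (x + t *\<^sub>R axis i 1)) has_vector_derivative D (i # is) x) (at 0)"
    using assms unfolding torus_test_function_def smooth_function_def by metis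
  have "integer_periodic (D is)" for "is"
  proof (induction "is")
    case Nil
    then show ?case using assms D(1) by (simp add: torus_test_function_def integer_periodic_def)
  next
    case (Cons i "is")
    then show ?case using D(3) by (rule periodic_axis_derivative)
  qed
  then show ?thesis using D that by blast
qed

text \<open>Integrate by parts three times in exactly those coordinates in which the frequency does not vanish.
  Only finitely many sets of coordinates occur, so one constant serves all frequencies.\<close>

lemma fourier_coeff_decay:
  fixes \<phi> :: "real ^ 'n \<Rightarrow> complex"
  assumes "torus_test_function \<phi>"
  obtains C where "C \<ge> 0"
    "\<And>k. k \<in> integer_vectors \<Longrightarrow> norm (fourier_coeff \<phi> k) * lattice_weight k ^ 3 \<le> C"
proof -
  obtain D :: "'n list \<Rightarrow> real ^ 'n \<Rightarrow> complex" where D: "D [] = \<phi>"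
    "\<And>is. continuous_on UNIV (D is)" "\<And>is. integer_periodic (D is)"
    "\<And>is i x. ((\<lambda>t. D is (x + t *\<^sub>R axis i 1)) has_vector_derivative D (i # is) x) (at 0)"
    using torus_test_function_derivatives[OF assms] by blast
  have "\<forall>is. \<exists>B. B > 0 \<and> (\<forall>x. norm (D is x) \<le> B)"
    using continuous_integer_periodic_bounded[OF D(2,3)] by metis
  then obtain B where B: "\<And>is. B is > 0" "\<And>is x. norm (D is x) \<le> B is" by metis
  have fc: "fourier_coeff (D is) k =
      prod_list (map (\<lambda>i. 2 * of_real pi * \<i> * of_real (k $ i)) is) * fourier_coeff \<phi> k"
    if "k \<in> integer_vectors" for k "is"
  proof (induction "is")
    case (Cons i "is")
    then show ?case
      using fourier_coeff_axis_derivative[OF D(2,2,3,3) D(4) that, of i "is"] by (simp add: mult_ac)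
  qed (simp add: D(1))
  define xs where "xs = (\<lambda>S. SOME xs :: 'n list. set xs = S \<and> distinct xs)"
  have xs: "set (xs S) = S" "distinct (xs S)" for S
    using someI_ex[OF finite_distinct_list[of S]] by (auto simp: xs_def)
  define C where "C = (\<Sum>S\<in>UNIV. B (xs S @ xs S @ xs S))"
  have "C \<ge> 0" unfolding C_def using B(1) by (intro sum_nonneg) (auto intro: less_imp_le)
  moreover have "norm (fourier_coeff \<phi> k) * lattice_weight k ^ 3 \<le> C" if k: "k \<in> integer_vectors" for k
  proof -
    define S where "S = {i. k $ i \<noteq> 0}"
    have "lattice_weight k = (\<Prod>i\<in>S. max 1 \<bar>k $ i\<bar>)"
      unfolding lattice_weight_def by (rule prod.mono_neutral_right) (auto simp: S_def)
    also have "\<dots> \<le> (\<Prod>i\<in>S. norm (2 * of_real pi * \<i> * complex_of_real (k $ i)))"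
    proof (rule prod_mono)
      fix i assume "i \<in> S"
      then have "1 \<le> \<bar>k $ i\<bar>"
        using k by (auto simp: S_def integer_vectors_def intro: Ints_nonzero_abs_ge1)
      moreover have "1 * \<bar>k $ i\<bar> \<le> (2 * pi) * \<bar>k $ i\<bar>"
        using pi_ge_two by (intro mult_right_mono) auto
      ultimately show "0 \<le> max 1 \<bar>k $ i\<bar> \<and>
          max 1 \<bar>k $ i\<bar> \<le> norm (2 * of_real pi * \<i> * complex_of_real (k $ i))"
        by (simp add: norm_mult)
    qed
    also have "\<dots> = norm (\<Prod>i\<leftarrow>xs S. 2 * of_real pi * \<i> * complex_of_real (k $ i))"
      using xs[of S] by (simp add: prod.distinct_set_conv_list[symmetric] prod_norm)
    finally have w: "lattice_weight k \<le> norm (\<Prod>i\<leftarrow>xs S. 2 * of_real pi * \<i> * complex_of_real (k $ i))" .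
    have "norm (fourier_coeff \<phi> k) * lattice_weight k ^ 3 \<le> norm (fourier_coeff \<phi> k) *
        norm (\<Prod>i\<leftarrow>xs S. 2 * of_real pi * \<i> * complex_of_real (k $ i)) ^ 3"
      using w lattice_weight_ge_1[of k] by (intro mult_left_mono power_mono) auto
    also have "\<dots> = norm (fourier_coeff (D (xs S @ xs S @ xs S)) k)"
      unfolding fc[OF k] by (simp add: norm_mult power3_eq_cube)
    also have "\<dots> \<le> B (xs S @ xs S @ xs S)"
      by (rule norm_fourier_coeff_le[OF D(2) B(2)])
    also have "\<dots> \<le> C"
      unfolding C_def using B(1) by (intro member_le_sum) (auto intro: less_imp_le)
    finally show ?thesis .
  qed
  ultimately show ?thesis using that by blast
qed

text \<open>The sum over a box of frequencies is a product of one-dimensional sums.\<close>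

lemma lattice_weight_summable:
  "(\<lambda>k :: real ^ 'n. 1 / lattice_weight k ^ 2) summable_on integer_vectors"
proof -
  define g where "g = (\<lambda>j :: int. 1 / (max 1 \<bar>real_of_int j\<bar>) ^ 2)"
  have g_nonneg: "g j \<ge> 0" for j by (simp add: g_def)
  have sm: "summable (\<lambda>n. g (int n))"
  proof (rule summable_comparison_test_ev)
    show "summable (\<lambda>n. 1 / real n ^ 2)"
      using inverse_power_summable[of 2, where 'a = real] by (simp add: inverse_eq_divide)
    show "\<forall>\<^sub>F n in sequentially. norm (g (int n)) \<le> 1 / real n ^ 2"
      using eventually_gt_at_top[of 0] by eventually_elim (auto simp: g_def max_def)
  qed
  define B where "B = 2 * (\<Sum>n. g (int n))"
  have gB: "(\<Sum>j\<in>{- int M..int M}. g j) \<le> B" for M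
  proof -
    have "(\<Sum>j\<in>{- int M..int M}. g j) \<le> (\<Sum>j\<in>int ` {..M} \<union> (\<lambda>n. - int n) ` {..M}. g j)"
    proof (rule sum_mono2)
      show "{- int M..int M} \<subseteq> int ` {..M} \<union> (\<lambda>n. - int n) ` {..M}"
      proof
        fix j assume "j \<in> {- int M..int M}"
        then show "j \<in> int ` {..M} \<union> (\<lambda>n. - int n) ` {..M}"
          by (cases j rule: int_cases2) auto
      qed
    qed (auto simp: g_nonneg)
    also have "\<dots> \<le> (\<Sum>j\<in>int ` {..M}. g j) + (\<Sum>j\<in>(\<lambda>n. - int n) ` {..M}. g j)"
      by (subst sum_Un) (auto intro!: sum_nonneg simp: g_nonneg)
    also have "\<dots> = (\<Sum>n\<le>M. g (int n)) + (\<Sum>n\<le>M. g (- int n))"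
      by (simp add: sum.reindex inj_on_def)
    also have "\<dots> = 2 * (\<Sum>n\<le>M. g (int n))" by (simp add: g_def)
    also have "\<dots> \<le> B"
      unfolding B_def using sum_le_suminf[OF sm, of "{..M}"] by (simp add: g_nonneg)
    finally show ?thesis .
  qed
  show ?thesis
  proof (rule nonneg_bdd_above_summable_on)
    show "0 \<le> 1 / (lattice_weight k)\<^sup>2" for k :: "real ^ 'n" by simp
    show "bdd_above (sum (\<lambda>k :: real ^ 'n. 1 / lattice_weight k ^ 2) ` {F. F \<subseteq> integer_vectors \<and> finite F})"
    proof (rule bdd_aboveI2)
      fix F :: "(real ^ 'n) set" assume "F \<in> {F. F \<subseteq> integer_vectors \<and> finite F}"
      then have F: "F \<subseteq> integer_vectors" "finite F" by auto
      define \<iota> where "\<iota> = (\<lambda>k :: real ^ 'n. \<lambda>i. \<lfloor>k $ i\<rfloor>)"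
      have \<iota>: "real_of_int (\<iota> k i) = k $ i" if "k \<in> F" for k i
      proof -
      have "k $ i \<in> \<int>" using that F by (auto simp: integer_vectors_def)
      then show ?thesis by (auto simp: \<iota>_def elim!: Ints_cases)
    qed
      have inj: "inj_on \<iota> F"
        by (rule inj_onI) (metis Finite_Cartesian_Product.vec_eq_iff \<iota>)
      define M where "M = (\<Sum>k\<in>F. \<Sum>i\<in>UNIV. nat \<bar>\<iota> k i\<bar>)"
      have le_M: "nat \<bar>\<iota> k i\<bar> \<le> M" if "k \<in> F" for k i
      proof -
        have "nat \<bar>\<iota> k i\<bar> \<le> (\<Sum>i\<in>UNIV. nat \<bar>\<iota> k i\<bar>)" by (rule member_le_sum) auto
        also have "\<dots> \<le> M" unfolding M_def using that F by (intro member_le_sum) auto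
        finally show ?thesis .
      qed
      have "- int M \<le> \<iota> k i \<and> \<iota> k i \<le> int M" if "k \<in> F" for k i
        using le_M[OF that, of i] by linarith
      then have sub: "\<iota> ` F \<subseteq> PiE UNIV (\<lambda>_. {- int M..int M})"
        by (auto simp: PiE_iff)
      have "(\<Sum>k\<in>F. 1 / lattice_weight k ^ 2) = (\<Sum>k\<in>F. \<Prod>i\<in>UNIV. g (\<iota> k i))"
        by (intro sum.cong refl)
          (simp add: g_def lattice_weight_def \<iota> prod_dividef prod_power_distrib[symmetric])
      also have "\<dots> = (\<Sum>f\<in>\<iota> ` F. \<Prod>i\<in>UNIV. g (f i))"
        using inj by (simp add: sum.reindex)
      also have "\<dots> \<le> (\<Sum>f\<in>PiE (UNIV :: 'n set) (\<lambda>_. {- int M..int M}). \<Prod>i\<in>UNIV. g (f i))"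
        by (rule sum_mono2) (use sub in \<open>auto intro!: prod_nonneg g_nonneg finite_PiE\<close>)
      also have "\<dots> = (\<Prod>i\<in>(UNIV :: 'n set). \<Sum>j\<in>{- int M..int M}. g j)"
        by (rule prod_sum_PiE[symmetric]) auto
      also have "\<dots> \<le> B ^ CARD('n)"
        using gB[of M] by (auto intro!: power_mono sum_nonneg simp: g_nonneg)
      finally show "(\<Sum>k\<in>F. 1 / lattice_weight k ^ 2) \<le> B ^ CARD('n)" .
    qed
  qed
qed

text \<open>Of the three powers of the weight gained by integration by parts two are spent on summability; the
  third absorbs the growth of the normalised Green function.\<close>

lemma weighted_fourier_coeff_summable:
  fixes \<phi> :: "real ^ 'n \<Rightarrow> complex"
  assumes "torus_test_function \<phi>"
  shows "(\<lambda>k. lattice_weight k * norm (fourier_coeff \<phi> k)) summable_on integer_vectors"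
proof -
  obtain C where C: "C \<ge> 0"
    "\<And>k. k \<in> integer_vectors \<Longrightarrow> norm (fourier_coeff \<phi> k) * lattice_weight k ^ 3 \<le> C"
    using fourier_coeff_decay[OF assms] by blast
  have "(\<lambda>k :: real ^ 'n. C * (1 / lattice_weight k ^ 2)) summable_on integer_vectors"
    by (intro summable_on_cmult_right lattice_weight_summable)
  then show ?thesis
  proof (rule summable_on_comparison_test)
    fix k :: "real ^ 'n" assume k: "k \<in> integer_vectors"
    have w: "lattice_weight k > 0" using lattice_weight_ge_1[of k] by linarith
    then have "(lattice_weight k * norm (fourier_coeff \<phi> k)) * lattice_weight k ^ 2 \<le> C"
      using C(2)[OF k] by (simp add: power2_eq_square power3_eq_cube mult_ac)
    then show "lattice_weight k * norm (fourier_coeff \<phi> k) \<le> C * (1 / lattice_weight k ^ 2)"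
      using w by (simp add: field_simps)
    show "0 \<le> lattice_weight k * norm (fourier_coeff \<phi> k)" using w by simp
  qed
qed

section \<open>The distance to the integer points\<close>

text \<open>Comparable to the distance to the nearest integer point, but continuous, periodic and directly
  related to \<open>torus_char k y - 1\<close>.\<close>

definition torus_norm :: "real ^ 'n \<Rightarrow> real" where
  "torus_norm y = (\<Sum>i\<in>UNIV. \<bar>sin (pi * y $ i)\<bar>)"

lemma torus_norm_nonneg [simp]: "0 \<le> torus_norm y"
  by (simp add: torus_norm_def sum_nonneg)

lemma abs_sin_le_torus_norm: "\<bar>sin (pi * y $ i)\<bar> \<le> torus_norm y"
  unfolding torus_norm_def by (rule member_le_sum) auto

lemma continuous_on_torus_norm [continuous_intros]: "continuous_on S torus_norm"
  unfolding torus_norm_def by (intro continuous_intros)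

lemma sin_pi_ge:
  fixes t :: real
  assumes "0 \<le> t" "t \<le> 1 / 2"
  shows "t \<le> sin (pi * t)"
proof -
  define x where "x = pi * t"
  have pi: "3 < pi" "pi < 4" using pi_approx by auto
  have x: "0 \<le> x" "x \<le> 2" 
    using assms pi mult_mono[of pi 4 t "1 / 2"] by (auto simp: x_def)
  have "\<bar>sin x - (\<Sum>m<3. sin_coeff m * x ^ m)\<bar> \<le> inverse (fact 3) * \<bar>x\<bar> ^ 3"
    by (rule Maclaurin_sin_bound)
  then have "\<bar>sin x - x\<bar> \<le> x ^ 3 / 6"
    using x by (simp add: sin_coeff_def eval_nat_numeral)
  then have "sin x \<ge> x - x ^ 3 / 6" by linarith
  moreover have "x ^ 3 \<le> 4 * x"
    using x mult_mono[of "x * x" "2 * 2" x x] mult_mono[of x 2 x 2] by (simp add: power3_eq_cube)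
  ultimately have "sin x \<ge> x / 3" by simp
  moreover have "x / 3 \<ge> t" using pi assms mult_right_mono[of 3 pi t] by (simp add: x_def)
  ultimately show ?thesis by (simp add: x_def)
qed

lemma abs_sin_pi_ge:
  fixes t :: real
  assumes "0 \<le> t" "t \<le> 1"
  shows "min t (1 - t) \<le> \<bar>sin (pi * t)\<bar>"
proof (cases "t \<le> 1 / 2")
  case True
  then show ?thesis using sin_pi_ge[of t] assms by auto
next
  case False
  have "sin (pi * t) = sin (pi * (1 - t))"
    by (simp add: right_diff_distrib)
  then show ?thesis using False sin_pi_ge[of "1 - t"] assms by auto
qed

lemma norm_cis_minus_1: "norm (cis (2 * a) - 1) = 2 * \<bar>sin a\<bar>"
proof -
  have "(norm (cis (2 * a) - 1))\<^sup>2 = (cos (2 * a) - 1)\<^sup>2 + (sin (2 * a))\<^sup>2"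
    by (simp add: cmod_power2)
  also have "\<dots> = 2 - 2 * cos (2 * a)"
    using sin_cos_squared_add[of "2 * a"] by (simp add: power2_eq_square algebra_simps)
  also have "\<dots> = (2 * \<bar>sin a\<bar>)\<^sup>2"
    by (simp add: cos_double_sin power2_eq_square)
  finally show ?thesis by (rule power2_eq_imp_eq) auto
qed

lemma norm_cis_int_minus_1:
  "norm (cis (2 * pi * (t * of_int n)) - 1) \<le> \<bar>of_int n\<bar> * (2 * \<bar>sin (pi * t)\<bar>)"
proof -
  define s :: real where "s = (if n \<ge> 0 then 1 else -1)"
  have "cis (2 * pi * (t * of_int n)) = cis (2 * (pi * (s * t))) ^ nat \<bar>n\<bar>"
    unfolding Complex.DeMoivre by (auto simp: s_def algebra_simps)
  moreover have "norm (cis (2 * (pi * (s * t))) ^ nat \<bar>n\<bar> - 1 ^ nat \<bar>n\<bar>) \<le>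
      real (nat \<bar>n\<bar>) * norm (cis (2 * (pi * (s * t))) - 1)"
    by (rule norm_power_diff) auto
  ultimately have "norm (cis (2 * pi * (t * of_int n)) - 1) \<le>
      real (nat \<bar>n\<bar>) * (2 * \<bar>sin (pi * (s * t))\<bar>)"
    unfolding norm_cis_minus_1 by simp
  then show ?thesis by (auto simp: s_def split: if_splits)
qed

lemma norm_torus_char_minus_1:
  assumes k: "k \<in> integer_vectors"
  shows "norm (torus_char k y - 1) \<le> (\<Sum>i\<in>UNIV. \<bar>k $ i\<bar> * (2 * \<bar>sin (pi * y $ i)\<bar>))"
proof -
  have "norm (torus_char k y - 1) =
      norm ((\<Prod>i\<in>UNIV. cis (2 * pi * (y $ i * - (k $ i)))) - (\<Prod>i\<in>(UNIV :: 'a set). 1))"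
    by (simp add: torus_char_prod)
  also have "\<dots> \<le> (\<Sum>i\<in>UNIV. norm (cis (2 * pi * (y $ i * - (k $ i))) - 1))"
    by (rule norm_prod_diff) auto
  also have "\<dots> \<le> (\<Sum>i\<in>UNIV. \<bar>k $ i\<bar> * (2 * \<bar>sin (pi * y $ i)\<bar>))"
  proof (rule sum_mono)
    fix i
    obtain n where n: "k $ i = of_int n" using k by (auto simp: integer_vectors_def elim: Ints_cases)
    show "norm (cis (2 * pi * (y $ i * - (k $ i))) - 1) \<le> \<bar>k $ i\<bar> * (2 * \<bar>sin (pi * y $ i)\<bar>)"
      using norm_cis_int_minus_1[of "y $ i" "- n"] by (simp add: n)
  qed
  finally show ?thesis .
qed

lemma norm_torus_char_axis_minus_1: "norm (torus_char (axis i 1) y - 1) = 2 * \<bar>sin (pi * y $ i)\<bar>"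
  using norm_cis_minus_1[of "- (pi * y $ i)"] by (simp add: torus_char_cis inner_axis mult.assoc)

text \<open>Changing one coordinate at a time gives a Lipschitz bound in the sum norm.  By periodicity the
  function vanishes at every vertex of the cube, and the bound is applied to the nearest one.\<close>

lemma test_function_vanishing_at_0_bound:
  fixes \<phi> :: "real ^ 'n \<Rightarrow> complex"
  assumes per: "integer_periodic \<phi>" and "\<phi> 0 = 0"
    and der: "\<And>i x. ((\<lambda>t. \<phi> (x + t *\<^sub>R axis i 1)) has_vector_derivative \<phi>' i x) (at 0)"
    and B: "\<And>i x. norm (\<phi>' i x) \<le> B"
    and y: "y \<in> cbox 0 1"
  shows "norm (\<phi> y) \<le> B * torus_norm y"
proof -
  have B0: "B \<ge> 0" using B order_trans[OF norm_ge_zero] by blast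
  have lip: "norm (\<phi> x - \<phi> y) \<le> (\<Sum>i\<in>S. B * \<bar>x $ i - y $ i\<bar>)"
    if "finite S" "\<And>i. i \<notin> S \<Longrightarrow> x $ i = y $ i" for S x y
    using that
  proof (induction S arbitrary: x rule: finite_induct)
    case empty
    then have "x = y" by (simp add: Finite_Cartesian_Product.vec_eq_iff)
    then show ?case by simp
  next
    case (insert j S)
    define z where "z = x + (y $ j - x $ j) *\<^sub>R axis j 1"
    have z: "z $ i = (if i = j then y $ j else x $ i)" for i by (simp add: z_def axis_def)
    have "norm (\<phi> z - \<phi> x) \<le> B * \<bar>y $ j - x $ j\<bar>"
      unfolding z_def by (rule axis_lipschitz[OF der B])
    moreover have "norm (\<phi> z - \<phi> y) \<le> (\<Sum>i\<in>S. B * \<bar>z $ i - y $ i\<bar>)"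
      by (rule insert.IH) (use insert.prems z in auto)
    moreover have "(\<Sum>i\<in>S. B * \<bar>z $ i - y $ i\<bar>) = (\<Sum>i\<in>S. B * \<bar>x $ i - y $ i\<bar>)"
      using insert.hyps by (intro sum.cong) (auto simp: z)
    moreover have "norm (\<phi> x - \<phi> y) \<le> norm (\<phi> z - \<phi> y) + norm (\<phi> z - \<phi> x)"
      using norm_triangle_ineq4[of "\<phi> z - \<phi> y" "\<phi> z - \<phi> x"] by simp
    ultimately show ?case using insert.hyps by (simp add: abs_minus_commute)
  qed
  \<comment> \<open>the vertex of the cube next to \<open>y\<close>\<close>
  define k :: "real ^ 'n" where "k = (\<chi> i. if y $ i \<le> 1 / 2 then 0 else 1)"
  have "k \<in> integer_vectors" by (auto simp: k_def integer_vectors_def)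
  then have "\<phi> k = 0" using per assms(2) unfolding integer_periodic_def by (metis add_0)
  then have "norm (\<phi> y) \<le> (\<Sum>i\<in>UNIV. B * \<bar>y $ i - k $ i\<bar>)"
    using lip[of UNIV y k] by simp
  also have "\<dots> \<le> (\<Sum>i\<in>UNIV. B * \<bar>sin (pi * y $ i)\<bar>)"
  proof (intro sum_mono mult_left_mono B0)
    fix i
    have "0 \<le> y $ i" "y $ i \<le> 1" using y by (auto simp: mem_box_cart)
    then show "\<bar>y $ i - k $ i\<bar> \<le> \<bar>sin (pi * y $ i)\<bar>"
      using abs_sin_pi_ge[of "y $ i"] by (auto simp: k_def)
  qed
  also have "\<dots> = B * torus_norm y" by (simp add: torus_norm_def sum_distrib_left)
  finally show ?thesis .
qed

text \<open>The points where \<open>torus_norm\<close> is of size \<open>2\<^sup>-\<^sup>j\<close> lie in \<open>2\<^sup>d\<close> boxes of that size around the vertices, so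
  a decomposition into dyadic shells bounds the integral by a geometric series.\<close>

lemma torus_norm_power_integrable:
  assumes p: "0 < p" "p < CARD('n)"
  shows "set_integrable lborel (cbox 0 1) (\<lambda>y :: real ^ 'n. 1 / torus_norm y ^ p)"
proof -
  let ?d = "CARD('n)"
  define S where "S = (\<lambda>j. {y \<in> cbox 0 (1 :: real ^ 'n). \<forall>i. \<bar>sin (pi * y $ i)\<bar> \<le> (1 / 2) ^ j})"
  have meas_S [measurable]: "S j \<in> sets borel" for j
    unfolding S_def by measurable
  define c where "c = (\<lambda>T :: 'n set. \<chi> i. if i \<in> T then 1 else (0 :: real))"
  define b where "b = (\<lambda>j T. cbox (\<chi> i. c T $ i - (1 / 2) ^ j) (\<chi> i. c T $ i + (1 / 2 :: real) ^ j))"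
  have S_sub: "S j \<subseteq> (\<Union>T. b j T)" for j
  proof
    fix y assume y: "y \<in> S j"
    have "\<bar>y $ i - c {i. y $ i > 1 / 2} $ i\<bar> \<le> (1 / 2) ^ j" for i
    proof -
      have "0 \<le> y $ i" "y $ i \<le> 1" "\<bar>sin (pi * y $ i)\<bar> \<le> (1 / 2) ^ j"
        using y by (auto simp: S_def mem_box_cart)
      then show ?thesis using abs_sin_pi_ge[of "y $ i"] by (auto simp: c_def)
    qed
    then have "y \<in> b j {i. y $ i > 1 / 2}"
      by (auto simp: b_def mem_box_cart abs_le_iff algebra_simps)
    then show "y \<in> (\<Union>T. b j T)" by blast
  qed
  have emeasure_b: "emeasure lborel (b j T) = ennreal ((2 * (1 / 2) ^ j) ^ ?d)" for j T
  proof -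
    have ne: "c T \<in> b j T" by (simp add: b_def mem_box_cart)
    then have "measure lborel (b j T) = (2 * (1 / 2) ^ j) ^ ?d"
      unfolding b_def by (subst content_cbox_cart) auto
    moreover have "emeasure lborel (b j T) < \<infinity>" unfolding b_def by (rule emeasure_lborel_cbox_finite)
    ultimately show ?thesis by (simp add: emeasure_eq_ennreal_measure less_top)
  qed
  have emeasure_S: "emeasure lborel (S j) \<le> ennreal (4 ^ ?d * ((1 / 2) ^ j) ^ ?d)" for j
  proof -
    have "emeasure lborel (S j) \<le> emeasure lborel (\<Union>T\<in>UNIV. b j T)"
      by (rule emeasure_mono[OF S_sub]) (auto simp: b_def)
    also have "\<dots> \<le> (\<Sum>T\<in>UNIV. emeasure lborel (b j T))"
      by (rule emeasure_subadditive_finite) (auto simp: b_def)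
    also have "\<dots> = of_nat (2 ^ ?d) * ennreal ((2 * (1 / 2) ^ j) ^ ?d)"
      by (simp only: emeasure_b sum_constant Cardinality.card_set)
    also have "\<dots> = ennreal (real (2 ^ ?d) * (2 * (1 / 2) ^ j) ^ ?d)"
      by (simp only: ennreal_of_nat_eq_real_of_nat) (rule ennreal_mult[symmetric]; simp)
    also have "real (2 ^ ?d) * (2 * (1 / 2) ^ j) ^ ?d = 4 ^ ?d * ((1 / 2 :: real) ^ j) ^ ?d"
    proof -
      have "(4 :: real) ^ ?d = 2 ^ ?d * 2 ^ ?d" by (simp flip: power_mult_distrib)
      then show ?thesis by (simp only: power_mult_distrib of_nat_power of_nat_numeral mult.assoc)
    qed
    finally show ?thesis .
  qed
  let ?f = "\<lambda>j. ennreal (2 ^ (p * (j + 1)))"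
  have term_le: "f j \<le> suminf f" for f :: "nat \<Rightarrow> ennreal" and j
    using sum_le_suminf[of f "{j}"] by simp
  have pt: "ennreal (indicator (cbox 0 1) y * (1 / torus_norm y ^ p)) \<le>
      (\<Sum>j. ?f j * indicator (S j) y)" for y :: "real ^ 'n"
  proof (cases "y \<in> cbox 0 1 \<and> torus_norm y \<noteq> 0")
    case True
    define \<mu> where "\<mu> = Max ((\<lambda>i. \<bar>sin (pi * y $ i)\<bar>) ` UNIV)"
    have \<mu>_ge: "\<bar>sin (pi * y $ i)\<bar> \<le> \<mu>" for i unfolding \<mu>_def by (rule Max_ge) auto
    have "\<mu> \<in> (\<lambda>i. \<bar>sin (pi * y $ i)\<bar>) ` UNIV" unfolding \<mu>_def by (rule Max_in) auto
    then obtain i where i: "\<mu> = \<bar>sin (pi * y $ i)\<bar>" by auto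
    have \<mu>1: "\<mu> \<le> 1" by (simp add: i)
    have \<mu>_le: "\<mu> \<le> torus_norm y" unfolding i by (rule abs_sin_le_torus_norm)
    have \<mu>0: "\<mu> > 0"
    proof (rule ccontr)
      assume "\<not> \<mu> > 0"
      then have "\<bar>sin (pi * y $ i)\<bar> = 0" for i using \<mu>_ge[of i] by linarith
      then have "torus_norm y = 0" by (simp add: torus_norm_def)
      then show False using True by simp
    qed
    obtain n where "(1 / 2) ^ n < \<mu>" using real_arch_pow_inv[OF \<mu>0, of "1 / 2"] by auto
    \<comment> \<open>the dyadic shell that contains \<open>y\<close>\<close>
    define n where "n = (LEAST n. (1 / 2) ^ n < \<mu>)"
    have n: "(1 / 2) ^ n < \<mu>" unfolding n_def by (rule LeastI) fact
    have "n \<noteq> 0" using n \<mu>1 by (cases n) auto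
    then obtain j where j: "n = Suc j" by (cases n) auto
    have "\<not> (1 / 2) ^ j < \<mu>" using not_less_Least[of j "\<lambda>n. (1 / 2) ^ n < \<mu>"] j by (simp add: n_def)
    then have "\<mu> \<le> (1 / 2) ^ j" by simp
    then have yS: "y \<in> S j"
      unfolding S_def using True order_trans[OF \<mu>_ge] by blast
    have "1 / torus_norm y ^ p \<le> 1 / ((1 / 2) ^ (j + 1)) ^ p"
      using n j \<mu>_le \<mu>0 by (intro divide_left_mono power_mono mult_pos_pos zero_less_power) auto
    also have "\<dots> = 2 ^ (p * (j + 1))"
      by (simp add: power_divide power_mult[symmetric] power_add mult.commute)
    finally have "ennreal (indicator (cbox 0 1) y * (1 / torus_norm y ^ p)) \<le>
        ?f j * indicator (S j) y"
      using True yS by (simp add: ennreal_leI)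
    also have "\<dots> \<le> (\<Sum>j. ?f j * indicator (S j) y)"
      by (rule term_le)
    finally show ?thesis .
  next
    case False
    then have "indicator (cbox 0 1) y * (1 / torus_norm y ^ p) = 0" using p by auto
    then show ?thesis by (simp only: ennreal_0 zero_le)
  qed
  have "(\<integral>\<^sup>+ (y :: real ^ 'n). ennreal (indicator (cbox 0 1) y * (1 / torus_norm y ^ p)) \<partial>lborel) \<le>
      (\<integral>\<^sup>+ y. (\<Sum>j. ?f j * indicator (S j) y) \<partial>lborel)"
    by (rule nn_integral_mono) (rule pt)
  also have "\<dots> = (\<Sum>j. \<integral>\<^sup>+ y. ?f j * indicator (S j) y \<partial>lborel)"
    by (rule nn_integral_suminf) measurable
  also have "\<dots> = (\<Sum>j. ?f j * emeasure lborel (S j))"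
    by (subst nn_integral_cmult_indicator) auto
  also have "\<dots> \<le> (\<Sum>j. ennreal (2 ^ p * 4 ^ ?d * (1 / 2) ^ j))"
  proof (rule suminf_le)
    fix j
    have "?f j * emeasure lborel (S j) \<le>
        ennreal (2 ^ (p * (j + 1))) * ennreal (4 ^ ?d * ((1 / 2) ^ j) ^ ?d)"
      by (intro mult_left_mono emeasure_S) auto
    also have "\<dots> = ennreal (2 ^ (p * (j + 1)) * (4 ^ ?d * ((1 / 2) ^ j) ^ ?d))"
      by (simp add: ennreal_mult)
    also have "2 ^ (p * (j + 1)) * (4 ^ ?d * ((1 / 2 :: real) ^ j) ^ ?d) \<le> 2 ^ p * 4 ^ ?d * (1 / 2) ^ j"
    proof -
      have "((1 / 2 :: real) ^ j) ^ ?d \<le> ((1 / 2) ^ j) ^ (p + 1)"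
        using p by (intro power_decreasing) (auto simp: power_le_one)
      also have "\<dots> = (1 / 2) ^ j * (1 / 2) ^ (p * j)"
        by (simp add: power_mult[symmetric] power_add mult.commute)
      finally have "2 ^ (p * j) * ((1 / 2 :: real) ^ j) ^ ?d \<le> 2 ^ (p * j) * ((1 / 2) ^ j * (1 / 2) ^ (p * j))"
        by (intro mult_left_mono) auto
      also have "\<dots> = (1 / 2) ^ j" by (simp add: power_divide)
      finally have "2 ^ p * 4 ^ ?d * (2 ^ (p * j) * ((1 / 2 :: real) ^ j) ^ ?d) \<le> 2 ^ p * 4 ^ ?d * (1 / 2) ^ j"
        by (intro mult_left_mono) auto
      then show ?thesis by (simp add: power_add mult_ac)
    qed
    finally show "?f j * emeasure lborel (S j) \<le> ennreal (2 ^ p * 4 ^ ?d * (1 / 2) ^ j)"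
      by (simp add: ennreal_leI)
  qed auto
  also have "\<dots> = ennreal (\<Sum>j. 2 ^ p * 4 ^ ?d * (1 / 2) ^ j)"
    by (rule suminf_ennreal2) (auto intro!: summable_mult summable_geometric)
  also have "\<dots> < \<infinity>" by simp
  finally have "(\<integral>\<^sup>+ (y :: real ^ 'n). ennreal (indicator (cbox 0 1) y * (1 / torus_norm y ^ p)) \<partial>lborel) < \<infinity>" .
  moreover have "(\<lambda>y :: real ^ 'n. indicator (cbox 0 1) y * (1 / torus_norm y ^ p)) \<in> borel_measurable lborel"
    using borel_measurable_continuous_onI[OF continuous_on_torus_norm] by measurable
  ultimately show ?thesis
    unfolding set_integrable_def
    by (intro integrableI_bounded) (auto simp: abs_mult)
qed

section \<open>Summation of Fourier coefficients by the Fejer kernel\<close>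

text \<open>Tannery's theorem, which is dominated convergence for the counting measure.\<close>

lemma tannery_infsum:
  fixes a :: "nat \<Rightarrow> 'a \<Rightarrow> complex" and g :: "'a \<Rightarrow> real"
  assumes g: "g summable_on A" and bd: "\<And>n x. x \<in> A \<Longrightarrow> norm (a n x) \<le> g x"
    and lim: "\<And>x. x \<in> A \<Longrightarrow> (\<lambda>n. a n x) \<longlonglongrightarrow> b x"
  shows "(b has_sum infsum b A) A" "(\<lambda>n. infsum (a n) A) \<longlonglongrightarrow> infsum b A"
proof -
  have bdb: "norm (b x) \<le> g x" if "x \<in> A" for x
    by (rule LIMSEQ_le_const2[OF tendsto_norm[OF lim[OF that]]]) (use bd that in blast)
  have "(\<lambda>x. norm (a n x)) summable_on A" for n
    by (rule summable_on_comparison_test[OF g]) (use bd in auto)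
  then have an: "Infinite_Set_Sum.abs_summable_on (a n) A" for n by (simp add: abs_summable_equivalent)
  have nb: "(\<lambda>x. norm (b x)) summable_on A"
    by (rule summable_on_comparison_test[OF g]) (use bdb in auto)
  then have b: "Infinite_Set_Sum.abs_summable_on b A" by (simp add: abs_summable_equivalent)
  show "(b has_sum infsum b A) A"
    by (rule has_sum_infsum[OF abs_summable_summable[OF nb]])
  have "(\<lambda>x. norm (g x)) summable_on A"
    by (rule summable_on_comparison_test[OF g]) (use bd order_trans[OF norm_ge_zero bd] in auto)
  then have "Infinite_Set_Sum.abs_summable_on g A" using abs_summable_equivalent by blast
  then have gi: "integrable (count_space A) g" by (simp only: Infinite_Set_Sum.abs_summable_on_def)
  have "(\<lambda>n. integral\<^sup>L (count_space A) (a n)) \<longlonglongrightarrow> integral\<^sup>L (count_space A) b"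
    by (rule integral_dominated_convergence[OF _ _ gi])
      (use lim bd in \<open>auto simp: AE_count_space\<close>)
  then show "(\<lambda>n. infsum (a n) A) \<longlonglongrightarrow> infsum b A"
    using an b by (simp add: infsetsum_infsum[symmetric] infsetsum_def)
qed

lemma floor_integer_vector: "k \<in> integer_vectors \<Longrightarrow> real_of_int \<lfloor>k $ i\<rfloor> = k $ i"
  unfolding integer_vectors_def by (metis (mono_tags, lifting) Ints_cases floor_of_int mem_Collect_eq)

lemma integer_box:
  fixes a b :: "'n::finite \<Rightarrow> int"
  defines "K \<equiv> {k :: real ^ 'n. k \<in> integer_vectors \<and> (\<forall>i. of_int (a i) \<le> k $ i \<and> k $ i < of_int (b i))}"
  shows "finite K" "card K = (\<Prod>i\<in>UNIV. nat (b i - a i))"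
proof -
  define h where "h = (\<lambda>f :: 'n \<Rightarrow> int. \<chi> i. real_of_int (f i))"
  have inj: "inj_on h S" for S
    by (rule inj_onI) (auto simp: h_def Finite_Cartesian_Product.vec_eq_iff fun_eq_iff)
  have K: "K = h ` PiE UNIV (\<lambda>i. {a i..<b i})"
  proof (intro equalityI subsetI)
    fix k assume k: "k \<in> K"
    then have fl: "real_of_int \<lfloor>k $ i\<rfloor> = k $ i" for i
      by (simp add: K_def floor_integer_vector)
    then have "k = h (\<lambda>i. \<lfloor>k $ i\<rfloor>)"
      unfolding h_def Finite_Cartesian_Product.vec_eq_iff vec_lambda_beta by (auto simp only: fl)
    moreover have "(\<lambda>i. \<lfloor>k $ i\<rfloor>) \<in> PiE UNIV (\<lambda>i. {a i..<b i})"
    proof (simp add: PiE_iff, intro allI conjI)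
      fix i
      have "of_int (a i) \<le> k $ i" "k $ i < of_int (b i)" using k by (auto simp: K_def)
      then show "a i \<le> \<lfloor>k $ i\<rfloor>" "\<lfloor>k $ i\<rfloor> < b i" using fl[of i] by linarith+
    qed
    ultimately show "k \<in> h ` PiE UNIV (\<lambda>i. {a i..<b i})" by blast
  next
    fix k assume "k \<in> h ` PiE UNIV (\<lambda>i. {a i..<b i})"
    then show "k \<in> K" by (auto simp: K_def h_def integer_vectors_def PiE_iff)
  qed
  show "finite K" unfolding K by (intro finite_imageI finite_PiE) auto
  show "card K = (\<Prod>i\<in>UNIV. nat (b i - a i))"
    unfolding K by (subst card_image[OF inj]) (simp add: card_PiE)
qed

definition fejer_box :: "nat \<Rightarrow> (real ^ 'n) set" where
  "fejer_box N = {k \<in> integer_vectors. \<forall>i. 0 \<le> k $ i \<and> k $ i < real N}"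

text \<open>The Fourier coefficient of the Fejer kernel at \<open>l\<close>: the proportion of the box of frequencies that a
  shift by \<open>l\<close> leaves in the box.\<close>

definition fejer_weight :: "nat \<Rightarrow> real ^ 'n \<Rightarrow> real" where
  "fejer_weight N l = real (card {k \<in> fejer_box N. k - l \<in> fejer_box N}) / real (card (fejer_box N :: (real ^ 'n) set))"

lemma finite_fejer_box [simp]: "finite (fejer_box N :: (real ^ 'n) set)"
  and card_fejer_box: "card (fejer_box N :: (real ^ 'n) set) = N ^ CARD('n)"
  using integer_box[of "\<lambda>_. 0" "\<lambda>_ :: 'n. int N"] by (simp_all add: fejer_box_def)

lemma fejer_weight_bounds: "0 \<le> fejer_weight N l" "fejer_weight N l \<le> 1"
proof -
  have "card {k \<in> fejer_box N. k - l \<in> fejer_box N} \<le> card (fejer_box N :: (real ^ 'a) set)"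
    by (rule card_mono) auto
  then show "fejer_weight N l \<le> 1" by (auto simp: fejer_weight_def divide_le_eq_1)
qed (simp add: fejer_weight_def)

lemma fejer_weight_tendsto_1:
  fixes l :: "real ^ 'n"
  assumes l: "l \<in> integer_vectors"
  shows "(\<lambda>N. fejer_weight (Suc N) l) \<longlonglongrightarrow> 1"
proof -
  define n where "n = (\<lambda>i. \<lfloor>l $ i\<rfloor>)"
  have n: "l $ i = real_of_int (n i)" for i using l by (simp add: n_def floor_integer_vector)
  have set: "{k \<in> fejer_box N. k - l \<in> fejer_box N} = {k :: real ^ 'n. k \<in> integer_vectors \<and>
      (\<forall>i. of_int (max 0 (n i)) \<le> k $ i \<and> k $ i < of_int (min (int N) (int N + n i)))}" for N
  proof -
    have "k - l \<in> integer_vectors" if "k \<in> integer_vectors" for k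
      using that l by (rule integer_vectors_diff)
    then have "k \<in> fejer_box N \<and> k - l \<in> fejer_box N \<longleftrightarrow> k \<in> integer_vectors \<and>
        (\<forall>i. (0 \<le> k $ i \<and> k $ i < real N) \<and> (0 \<le> k $ i - l $ i \<and> k $ i - l $ i < real N))" for k
      by (auto simp: fejer_box_def)
    moreover have "(0 \<le> x \<and> x < real N) \<and> (0 \<le> x - l $ i \<and> x - l $ i < real N) \<longleftrightarrow>
        of_int (max 0 (n i)) \<le> x \<and> x < of_int (min (int N) (int N + n i))" for i x
      unfolding n[of i] of_int_max of_int_min by auto
    ultimately show ?thesis by (simp only:)
  qed
  have w: "fejer_weight (Suc N) l = (\<Prod>i\<in>UNIV. real (nat (min (int (Suc N)) (int (Suc N) + n i) - max 0 (n i))) / real (Suc N))" for N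
    unfolding fejer_weight_def set integer_box(2) card_fejer_box
    by (simp add: prod_dividef)
  have "(\<lambda>N. \<Prod>i\<in>(UNIV :: 'n set). real (nat (min (int (Suc N)) (int (Suc N) + n i) - max 0 (n i))) / real (Suc N))
      \<longlonglongrightarrow> (\<Prod>i\<in>(UNIV :: 'n set). 1)"
  proof (rule tendsto_prod)
    fix i
    have "(\<lambda>N. 1 - \<bar>real_of_int (n i)\<bar> * (1 / real (Suc N))) \<longlonglongrightarrow> 1 - \<bar>real_of_int (n i)\<bar> * 0"
      using LIMSEQ_inverse_real_of_nat
      by (intro tendsto_diff tendsto_mult tendsto_const) (simp only: inverse_eq_divide)
    then have lim: "(\<lambda>N. 1 - \<bar>real_of_int (n i)\<bar> * (1 / real (Suc N))) \<longlonglongrightarrow> 1" by simp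
    have "\<forall>\<^sub>F N in sequentially. 1 - \<bar>real_of_int (n i)\<bar> * (1 / real (Suc N)) =
        real (nat (min (int (Suc N)) (int (Suc N) + n i) - max 0 (n i))) / real (Suc N)"
      using eventually_ge_at_top[of "nat \<bar>n i\<bar>"]
    proof eventually_elim
      case (elim N)
      then have "min (int (Suc N)) (int (Suc N) + n i) - max 0 (n i) = int (Suc N) - \<bar>n i\<bar>"
        "int (Suc N) - \<bar>n i\<bar> \<ge> 0" by auto
      then have "real (nat (min (int (Suc N)) (int (Suc N) + n i) - max 0 (n i))) =
          real_of_int (int (Suc N) - \<bar>n i\<bar>)" by simp
      then show ?case by (simp add: field_simps)
    qed
    then show "(\<lambda>N. real (nat (min (int (Suc N)) (int (Suc N) + n i) - max 0 (n i))) / real (Suc N)) \<longlonglongrightarrow> 1"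
      by (rule Lim_transform_eventually[OF lim])
  qed
  then show ?thesis by (simp add: w)
qed

definition fejer_kernel :: "nat \<Rightarrow> real ^ 'n \<Rightarrow> real" where
  "fejer_kernel N y = (norm (\<Sum>k\<in>fejer_box N. torus_char k y))\<^sup>2 / real (card (fejer_box N :: (real ^ 'n) set))"

lemma fejer_kernel_nonneg: "0 \<le> fejer_kernel N y"
  by (simp add: fejer_kernel_def)

lemma continuous_on_fejer_kernel [continuous_intros]: "continuous_on S (fejer_kernel N)"
  unfolding fejer_kernel_def divide_inverse by (intro continuous_intros)

text \<open>Expand the squared modulus and collect the pairs of frequencies with the same difference.\<close>

lemma fejer_kernel_integral:
  fixes \<psi> :: "real ^ 'n \<Rightarrow> complex"
  assumes cont: "continuous_on UNIV \<psi>"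
  defines "D \<equiv> \<lambda>N. (\<lambda>(k, k'). k - k') ` (fejer_box N \<times> fejer_box N) :: (real ^ 'n) set"
  shows "integral (cbox 0 1) (\<lambda>y. of_real (fejer_kernel N y) * \<psi> y) =
    (\<Sum>l\<in>D N. of_real (fejer_weight N l) * fourier_coeff \<psi> l)"
proof -
  let ?X = "fejer_box N :: (real ^ 'n) set"
  let ?c = "complex_of_real (real (card ?X))"
  have K: "of_real (fejer_kernel N y) * \<psi> y =
      (\<Sum>(k, k')\<in>?X \<times> ?X. torus_char (k - k') y * \<psi> y) / ?c" for y
  proof -
    have "complex_of_real ((norm (\<Sum>k\<in>?X. torus_char k y))\<^sup>2) =
        (\<Sum>k\<in>?X. torus_char k y) * cnj (\<Sum>k\<in>?X. torus_char k y)"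
      by (rule complex_norm_square)
    also have "\<dots> = (\<Sum>k\<in>?X. \<Sum>k'\<in>?X. torus_char (k - k') y)"
      by (simp add: torus_char_diff sum_product)
    also have "\<dots> = (\<Sum>(k, k')\<in>?X \<times> ?X. torus_char (k - k') y)"
      by (simp add: sum.cartesian_product)
    finally show ?thesis
      by (simp add: fejer_kernel_def sum_distrib_right case_prod_unfold)
  qed
  have "integral (cbox 0 1) (\<lambda>y. of_real (fejer_kernel N y) * \<psi> y) =
      integral (cbox 0 1) (\<lambda>y. \<Sum>(k, k')\<in>?X \<times> ?X. torus_char (k - k') y * \<psi> y) / ?c"
    unfolding K by simp
  also have "integral (cbox 0 1) (\<lambda>y. \<Sum>(k, k')\<in>?X \<times> ?X. torus_char (k - k') y * \<psi> y) =
      (\<Sum>(k, k')\<in>?X \<times> ?X. fourier_coeff \<psi> (k - k'))"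
    unfolding case_prod_unfold
    by (subst integral_sum) (auto simp: fourier_coeff_eq_HK[OF cont]
        intro!: integrable_continuous continuous_intros continuous_on_subset[OF cont])
  also have "\<dots> = (\<Sum>p\<in>?X \<times> ?X. fourier_coeff \<psi> (fst p - snd p))"
    by (simp add: case_prod_unfold)
  also have "\<dots> = (\<Sum>l\<in>D N. \<Sum>p\<in>{p \<in> ?X \<times> ?X. fst p - snd p = l}. fourier_coeff \<psi> (fst p - snd p))"
    by (rule sum.group[symmetric]) (auto simp: D_def case_prod_unfold)
  also have "\<dots> = (\<Sum>l\<in>D N. of_nat (card {k \<in> ?X. k - l \<in> ?X}) * fourier_coeff \<psi> l)"
  proof (rule sum.cong[OF refl])
    fix l
    have "card {k \<in> ?X. k - l \<in> ?X} = card {p \<in> ?X \<times> ?X. fst p - snd p = l}"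
      by (rule bij_betw_same_card[of "\<lambda>k. (k, k - l)"])
        (auto intro!: bij_betwI[where g = fst])
    then show "(\<Sum>p\<in>{p \<in> ?X \<times> ?X. fst p - snd p = l}. fourier_coeff \<psi> (fst p - snd p)) =
        of_nat (card {k \<in> ?X. k - l \<in> ?X}) * fourier_coeff \<psi> l" by simp
  qed
  finally show ?thesis
    by (simp add: sum_divide_distrib fejer_weight_def)
qed

lemma fourier_coeff_torus_char:
  assumes "l \<in> integer_vectors" "k \<in> integer_vectors"
  shows "fourier_coeff (torus_char l) k = (if k = - l then 1 else 0)"
proof -
  have "fourier_coeff (torus_char l) k = integral (cbox 0 1) (torus_char (k + l))"
    by (simp add: fourier_coeff_eq_HK continuous_on_torus_char torus_char_add[abs_def])
  then show ?thesis
    using integral_torus_char[OF integer_vectors_add[OF assms(2,1)]] by (simp add: add_eq_0_iff2)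
qed

lemma fejer_box_diff:
  "(\<lambda>(k, k'). k - k') ` (fejer_box N \<times> fejer_box N) \<subseteq> integer_vectors"
  by (auto simp: fejer_box_def integer_vectors_diff)

lemma fejer_weight_eq_0:
  assumes "l \<notin> (\<lambda>(k, k'). k - k') ` (fejer_box N \<times> fejer_box N)"
  shows "fejer_weight N l = 0"
proof -
  have "k - l \<notin> fejer_box N" if "k \<in> fejer_box N" for k
    using assms that by (force simp: image_iff)
  then have "{k \<in> fejer_box N. k - l \<in> fejer_box N} = {}" by blast
  then show ?thesis by (simp only: fejer_weight_def) simp
qed

lemma fejer_kernel_char_integral:
  fixes l :: "real ^ 'n"
  assumes l: "l \<in> integer_vectors"
  shows "integral (cbox 0 1) (\<lambda>y. of_real (fejer_kernel N y) * torus_char l y) = of_real (fejer_weight N (- l))"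
proof -
  let ?D = "(\<lambda>(k, k'). k - k') ` (fejer_box N \<times> fejer_box N) :: (real ^ 'n) set"
  have "integral (cbox 0 1) (\<lambda>y. of_real (fejer_kernel N y) * torus_char l y) =
      (\<Sum>k\<in>?D. complex_of_real (fejer_weight N k) * fourier_coeff (torus_char l) k)"
    by (rule fejer_kernel_integral) (rule continuous_on_torus_char)
  also have "\<dots> = (\<Sum>k\<in>?D. if k = - l then of_real (fejer_weight N k) else 0)"
  proof (rule sum.cong[OF refl])
    fix k assume "k \<in> ?D"
    then have "k \<in> integer_vectors" using fejer_box_diff[of N] by blast
    then show "complex_of_real (fejer_weight N k) * fourier_coeff (torus_char l) k =
        (if k = - l then of_real (fejer_weight N k) else 0)"
      by (simp add: fourier_coeff_torus_char[OF l])
  qed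
  also have "\<dots> = of_real (fejer_weight N (- l))"
    using fejer_weight_eq_0[of "- l" N] by (auto simp: sum.delta)
  finally show ?thesis .
qed

lemma fejer_kernel_Re_integral:
  assumes l: "l \<in> integer_vectors"
  shows "((\<lambda>y. fejer_kernel N y * Re (torus_char l y)) has_integral fejer_weight N (- l)) (cbox 0 1)"
proof -
  have "((\<lambda>y. of_real (fejer_kernel N y) * torus_char l y) has_integral of_real (fejer_weight N (- l))) (cbox 0 1)"
    unfolding fejer_kernel_char_integral[OF l, symmetric]
    by (intro integrable_integral integrable_continuous continuous_intros)
  from has_integral_linear[OF this bounded_linear_Re] show ?thesis by (simp add: o_def)
qed

text \<open>Fourier inversion at a zero of the function.  Integrated against the Fejer kernel, the function
  gives the sum of its coefficients with weights that tend to one.  On the other hand the kernel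
  concentrates at the integer points: its integral against \<open>1 - cos (2\<pi>y\<^sub>i)\<close>, which is twice the
  square of \<open>sin (\<pi>y\<^sub>i)\<close>, is read off from its coefficients at the unit vectors and tends to zero.
  The inequality \<open>s \<le> \<delta> + s\<^sup>2 / \<delta>\<close> passes from this to functions that vanish to first order.\<close>

lemma infsum_fourier_coeff_eq_0:
  fixes \<phi> :: "real ^ 'n \<Rightarrow> complex"
  assumes cont: "continuous_on UNIV \<phi>" and B: "B \<ge> 0"
    and bd: "\<And>y. y \<in> cbox 0 1 \<Longrightarrow> norm (\<phi> y) \<le> B * torus_norm y"
    and sm: "(\<lambda>k. norm (fourier_coeff \<phi> k)) summable_on integer_vectors"
  shows "infsum (fourier_coeff \<phi>) integer_vectors = 0"
proof -
  define J where "J = (\<lambda>N. integral (cbox 0 1) (\<lambda>y. of_real (fejer_kernel (Suc N) y) * \<phi> y))"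
  define D where "D = (\<lambda>N. (\<lambda>(k, k'). k - k') ` (fejer_box N \<times> fejer_box N) :: (real ^ 'n) set)"
  have "J N = infsum (\<lambda>l. of_real (fejer_weight (Suc N) l) * fourier_coeff \<phi> l) integer_vectors" for N
  proof -
    have "J N = (\<Sum>l\<in>D (Suc N). of_real (fejer_weight (Suc N) l) * fourier_coeff \<phi> l)"
      unfolding J_def D_def by (rule fejer_kernel_integral[OF cont])
    also have "\<dots> = infsum (\<lambda>l. of_real (fejer_weight (Suc N) l) * fourier_coeff \<phi> l) (D (Suc N))"
      by (rule infsum_finite[symmetric]) (simp add: D_def)
    also have "\<dots> = infsum (\<lambda>l. of_real (fejer_weight (Suc N) l) * fourier_coeff \<phi> l) integer_vectors"
      using fejer_box_diff[of "Suc N"] fejer_weight_eq_0[where N = "Suc N"]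
      by (intro infsum_cong_neutral) (auto simp: D_def)
    finally show ?thesis .
  qed
  moreover have "(\<lambda>N. infsum (\<lambda>l. of_real (fejer_weight (Suc N) l) * fourier_coeff \<phi> l) integer_vectors) \<longlonglongrightarrow>
      infsum (fourier_coeff \<phi>) integer_vectors"
  proof (rule tannery_infsum(2)[OF sm])
    fix N and l :: "real ^ 'n"
    show "norm (of_real (fejer_weight (Suc N) l) * fourier_coeff \<phi> l) \<le> norm (fourier_coeff \<phi> l)"
      using fejer_weight_bounds[of "Suc N" l] by (simp add: norm_mult mult_left_le_one_le)
  next
    fix l :: "real ^ 'n" assume "l \<in> integer_vectors"
    from tendsto_mult[OF tendsto_of_real[OF fejer_weight_tendsto_1[OF this]] tendsto_const]
    show "(\<lambda>N. of_real (fejer_weight (Suc N) l) * fourier_coeff \<phi> l) \<longlonglongrightarrow> fourier_coeff \<phi> l"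
      by force
  qed
  ultimately have lim: "J \<longlonglongrightarrow> infsum (fourier_coeff \<phi>) integer_vectors" by presburger
  have "norm (infsum (fourier_coeff \<phi>) integer_vectors) \<le> B * (\<Sum>i\<in>(UNIV :: 'n set). \<delta>)" if \<delta>: "\<delta> > 0" for \<delta>
  proof (rule LIMSEQ_le[OF tendsto_norm[OF lim]])
    let ?a = "\<lambda>N i. fejer_weight (Suc N) (- axis i 1 :: real ^ 'n)"
    have a: "(\<lambda>N. ?a N i) \<longlonglongrightarrow> 1" for i
      by (rule fejer_weight_tendsto_1) (simp add: integer_vectors_minus)
    have "(\<lambda>N. B * (\<Sum>i\<in>UNIV. (\<delta> + 1 / (2 * \<delta>)) - 1 / (2 * \<delta>) * ?a N i)) \<longlonglongrightarrow>
        B * (\<Sum>i\<in>(UNIV :: 'n set). (\<delta> + 1 / (2 * \<delta>)) - 1 / (2 * \<delta>) * 1)"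
      by (intro tendsto_intros a)
    then show "(\<lambda>N. B * (\<Sum>i\<in>UNIV. (\<delta> + 1 / (2 * \<delta>)) - 1 / (2 * \<delta>) * ?a N i)) \<longlonglongrightarrow> B * (\<Sum>i\<in>(UNIV :: 'n set). \<delta>)"
      by simp
    have "norm (J N) \<le> B * (\<Sum>i\<in>UNIV. (\<delta> + 1 / (2 * \<delta>)) - 1 / (2 * \<delta>) * ?a N i)" for N
    proof -
      let ?K = "fejer_kernel (Suc N) :: real ^ 'n \<Rightarrow> real"
      let ?G = "\<lambda>y. B * (\<Sum>i\<in>UNIV. (\<delta> + 1 / (2 * \<delta>)) * (?K y * Re (torus_char 0 y)) -
          1 / (2 * \<delta>) * (?K y * Re (torus_char (axis i 1) y)))"
      have "fejer_weight (Suc N) (0 :: real ^ 'n) = 1"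
        by (simp add: fejer_weight_def card_fejer_box)
      then have G: "(?G has_integral B * (\<Sum>i\<in>UNIV. (\<delta> + 1 / (2 * \<delta>)) * 1 - 1 / (2 * \<delta>) * ?a N i)) (cbox 0 1)"
        using fejer_kernel_Re_integral[of "0 :: real ^ 'n" "Suc N"]
        by (intro has_integral_mult_right has_integral_sum has_integral_diff fejer_kernel_Re_integral) auto
      have "norm (J N) \<le> integral (cbox 0 1) ?G"
        unfolding J_def
      proof (rule integral_norm_bound_integral)
        show "(\<lambda>y. of_real (?K y) * \<phi> y) integrable_on cbox 0 1"
          by (intro integrable_continuous continuous_intros continuous_on_subset[OF cont]) auto
        show "?G integrable_on cbox 0 1" using G by (rule has_integral_integrable)
        fix y :: "real ^ 'n" assume y: "y \<in> cbox 0 1"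
        have "\<bar>sin (pi * y $ i)\<bar> \<le> (\<delta> + 1 / (2 * \<delta>)) - 1 / (2 * \<delta>) * Re (torus_char (axis i 1) y)" for i
        proof -
          define s where "s = \<bar>sin (pi * y $ i)\<bar>"
          have "Re (torus_char (axis i 1) y) = cos (2 * (pi * y $ i))"
            by (simp add: torus_char_cis inner_axis mult.assoc)
          also have "\<dots> = 1 - 2 * s\<^sup>2" by (simp only: s_def cos_double_sin power2_abs)
          finally have Re: "Re (torus_char (axis i 1) y) = 1 - 2 * s\<^sup>2" .
          have "(\<delta> + 1 / (2 * \<delta>)) - 1 / (2 * \<delta>) * Re (torus_char (axis i 1) y) = \<delta> + s\<^sup>2 / \<delta>"
            unfolding Re using \<delta> by (simp add: field_simps)
          moreover have "s \<le> \<delta> + s\<^sup>2 / \<delta>"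
          proof -
            have "0 \<le> (s - \<delta>)\<^sup>2 + s * \<delta>" using \<delta> by (simp add: s_def)
            then have "s * \<delta> \<le> (\<delta> + s\<^sup>2 / \<delta>) * \<delta>" using \<delta> by (simp add: power2_eq_square algebra_simps)
            then show ?thesis using \<delta> by (simp only: mult_le_cancel_right)
          qed
          ultimately show ?thesis by (simp add: s_def)
        qed
        then have "torus_norm y \<le> (\<Sum>i\<in>UNIV. (\<delta> + 1 / (2 * \<delta>)) - 1 / (2 * \<delta>) * Re (torus_char (axis i 1) y))"
          unfolding torus_norm_def by (rule sum_mono)
        then have "?K y * (B * torus_norm y) \<le>
            ?K y * (B * (\<Sum>i\<in>UNIV. (\<delta> + 1 / (2 * \<delta>)) - 1 / (2 * \<delta>) * Re (torus_char (axis i 1) y)))"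
          by (intro mult_left_mono B fejer_kernel_nonneg)
        moreover have "norm (of_real (?K y) * \<phi> y) \<le> ?K y * (B * torus_norm y)"
          using mult_left_mono[OF bd[OF y] fejer_kernel_nonneg] fejer_kernel_nonneg[of "Suc N" y]
          by (simp add: norm_mult)
        moreover have "?K y * (B * (\<Sum>i\<in>UNIV. (\<delta> + 1 / (2 * \<delta>)) - 1 / (2 * \<delta>) * Re (torus_char (axis i 1) y))) = ?G y"
          unfolding mult.left_commute[of "?K y" B] sum_distrib_left[of "?K y"]
          by (intro arg_cong[where f = "(*) B"] sum.cong) (simp_all add: algebra_simps)
        ultimately show "norm (of_real (?K y) * \<phi> y) \<le> ?G y" by linarith
      qed
      then show ?thesis unfolding integral_unique[OF G] by simp
    qed
    then show "\<exists>N. \<forall>n\<ge>N. norm (J n) \<le> B * (\<Sum>i\<in>UNIV. (\<delta> + 1 / (2 * \<delta>)) - 1 / (2 * \<delta>) * ?a n i)"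
      by blast
  qed
  then have le: "norm (infsum (fourier_coeff \<phi>) integer_vectors) \<le> (B * CARD('n)) * \<delta>" if "\<delta> > 0" for \<delta>
    using that by (simp add: mult.assoc)
  have "norm (infsum (fourier_coeff \<phi>) integer_vectors) \<le> 0"
  proof (rule field_le_epsilon)
    fix e :: real assume "e > 0"
    define b where "b = B * CARD('n) + 1"
    have "b > 0" using B by (simp add: b_def add_nonneg_pos)
    then have "norm (infsum (fourier_coeff \<phi>) integer_vectors) \<le> (B * CARD('n)) * (e / b)"
      using le[of "e / b"] \<open>e > 0\<close> by simp
    also have "\<dots> \<le> b * (e / b)"
      using \<open>e > 0\<close> \<open>b > 0\<close> by (intro mult_right_mono) (auto simp: b_def)
    finally show "norm (infsum (fourier_coeff \<phi>) integer_vectors) \<le> 0 + e" using \<open>b > 0\<close> by simp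
  qed
  then show ?thesis by simp
qed

section \<open>Solving the block system\<close>

lemma resolvent_base_carrier:
  assumes "Q \<in> carrier_mat (m + 1) (m + 1)"
  shows "resolvent_base Q \<in> carrier_mat m m"
  using assms by (auto simp: resolvent_base_def mat_delete_def)

lemma resolvent_base_index:
  assumes "Q \<in> carrier_mat (m + 1) (m + 1)" "i < m" "j < m"
  shows "resolvent_base Q $$ (i, j) = (if i = j then 1 else 0) - Q $$ (Suc i, Suc j)"
  using assms by (auto simp: resolvent_base_def mat_delete_def)

lemma sum_shift_1: "(\<Sum>j<m. f (Suc j)) = (\<Sum>j\<in>{1..m}. f j)" for f :: "nat \<Rightarrow> complex"
  using sum.shift_bounds_Suc_ivl[of f 0 m] by (simp add: atLeast0LessThan atLeastLessThanSuc_atLeastAtMost)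

text \<open>Uniqueness for the homogeneous system makes the matrix invertible, and then any known solution of
  the inhomogeneous system evaluates the symbol without computing the inverse.\<close>

lemma return_symbol_eq_solution:
  fixes Q :: "complex mat" and w :: "nat \<Rightarrow> complex"
  assumes Q: "Q \<in> carrier_mat (m + 1) (m + 1)"
    and inj: "\<And>f :: nat \<Rightarrow> complex. (\<And>i. i \<in> {1..m} \<Longrightarrow> f i = (\<Sum>j\<in>{1..m}. Q $$ (i, j) * f j)) \<Longrightarrow>
        (\<And>i. i \<in> {1..m} \<Longrightarrow> f i = 0)"
    and sol: "\<And>i. i \<in> {1..m} \<Longrightarrow> w i = Q $$ (i, 0) + (\<Sum>j\<in>{1..m}. Q $$ (i, j) * w j)"
  shows "invertible_mat (resolvent_base Q)"
    and "return_symbol Q = Q $$ (0, 0) + (\<Sum>j\<in>{1..m}. Q $$ (0, j) * w j)"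
proof -
  let ?B = "resolvent_base Q"
  have B: "?B \<in> carrier_mat m m" by (rule resolvent_base_carrier[OF Q])
  have B_mult: "vec_index (?B *\<^sub>v u) i = vec_index u i - (\<Sum>j<m. Q $$ (Suc i, Suc j) * vec_index u j)"
    if "u \<in> carrier_vec m" "i < m" for u i
  proof -
    have "vec_index (?B *\<^sub>v u) i = (\<Sum>j<m. ?B $$ (i, j) * vec_index u j)"
      using that B by (simp add: scalar_prod_def atLeast0LessThan)
    also have "\<dots> = (\<Sum>j<m. (if i = j then vec_index u j else 0) - Q $$ (Suc i, Suc j) * vec_index u j)"
      using that by (intro sum.cong) (auto simp: resolvent_base_index[OF Q] left_diff_distrib)
    also have "\<dots> = vec_index u i - (\<Sum>j<m. Q $$ (Suc i, Suc j) * vec_index u j)"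
      using that by (simp add: sum_subtractf)
    finally show ?thesis .
  qed
  have "det ?B \<noteq> 0"
  proof
    assume "det ?B = 0"
    then obtain u where u: "u \<in> carrier_vec m" "u \<noteq> 0\<^sub>v m" "?B *\<^sub>v u = 0\<^sub>v m"
      using det_0_iff_vec_prod_zero_field[OF B] by blast
    define f where "f = (\<lambda>i. vec_index u (i - 1))"
    have "f i = (\<Sum>j\<in>{1..m}. Q $$ (i, j) * f j)" if "i \<in> {1..m}" for i
    proof -
      have "vec_index (?B *\<^sub>v u) (i - 1) = 0" using that u(3) by auto
      then have "f i = (\<Sum>j<m. Q $$ (i, Suc j) * f (Suc j))"
        using B_mult[OF u(1), of "i - 1"] that by (auto simp: f_def)
      then show ?thesis using sum_shift_1[of "\<lambda>j. Q $$ (i, j) * f j" m] by simp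
    qed
    then have f0: "f i = 0" if "i \<in> {1..m}" for i using inj that by blast
    have "u = 0\<^sub>v m"
    proof (rule eq_vecI)
      fix i assume "i < dim_vec (0\<^sub>v m :: complex Matrix.vec)"
      then show "vec_index u i = vec_index (0\<^sub>v m) i" using f0[of "Suc i"] by (simp add: f_def)
    qed (use u(1) in auto)
    then show False using u(2) by blast
  qed
  then have unit: "?B \<in> Units (ring_mat TYPE(complex) m ())"
    by (rule det_non_zero_imp_unit[OF B])
  then obtain C where C: "mat_inverse ?B = Some C"
    using mat_inverse(1)[OF B, where b = "()"] by (cases "mat_inverse ?B") auto
  have inv: "?B * C = 1\<^sub>m m" "C * ?B = 1\<^sub>m m" "C \<in> carrier_mat m m"
    using mat_inverse(2)[OF B C] by auto
  show "invertible_mat ?B"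
    using B inv unfolding invertible_mat_def inverts_mat_def by auto
  let ?w = "Matrix.vec m (\<lambda>i. w (Suc i))" and ?c = "Matrix.vec m (\<lambda>i. Q $$ (Suc i, 0))"
  have "?B *\<^sub>v ?w = ?c"
  proof (rule eq_vecI)
    fix i assume "i < dim_vec ?c"
    then have i: "i < m" by simp
    then have "vec_index (?B *\<^sub>v ?w) i = w (Suc i) - (\<Sum>j<m. Q $$ (Suc i, Suc j) * w (Suc j))"
      by (subst B_mult) auto
    also have "\<dots> = Q $$ (Suc i, 0)"
      using sol[of "Suc i"] i sum_shift_1[of "\<lambda>j. Q $$ (Suc i, j) * w j" m] by simp
    finally show "vec_index (?B *\<^sub>v ?w) i = vec_index ?c i" using i by simp
  qed (use B in auto)
  then have "C *\<^sub>v ?c = (C * ?B) *\<^sub>v ?w"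
    using assoc_mult_mat_vec[OF inv(3) B, of ?w] by simp
  then have Cc: "C *\<^sub>v ?c = ?w" by (simp add: inv(2))
  have "return_symbol Q = Q $$ (0, 0) + scalar_prod (Matrix.vec m (\<lambda>j. Q $$ (0, Suc j))) (C *\<^sub>v ?c)"
    using Q by (simp add: return_symbol_def C)
  also have "\<dots> = Q $$ (0, 0) + (\<Sum>j<m. Q $$ (0, Suc j) * w (Suc j))"
    unfolding Cc by (simp add: scalar_prod_def atLeast0LessThan)
  finally show "return_symbol Q = Q $$ (0, 0) + (\<Sum>j\<in>{1..m}. Q $$ (0, j) * w j)"
    using sum_shift_1[of "\<lambda>j. Q $$ (0, j) * w j" m] by simp
qed

section \<open>The walk and its lattice symmetry\<close>

locale periodic_walk =
  fixes \<Lambda> V :: "(real ^ 'n) set" and E :: "(real ^ 'n) set set"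
    and L :: "real ^ 'n \<Rightarrow> real ^ 'n" and m :: nat and v :: "nat \<Rightarrow> real ^ 'n"
  assumes lattice: "identifies_lattice \<Lambda> L" and tiling: "periodic_tiling \<Lambda> V E"
    and origin: "0 \<in> V" and reps: "orbit_representatives \<Lambda> V m v"
begin

abbreviation "P \<equiv> srw_kernel V E"

definition nbrs :: "real ^ 'n \<Rightarrow> (real ^ 'n) set" where
  "nbrs u = {w \<in> V. edges_between V E u w \<noteq> {}}"

lemma L_linear: "linear L" and L_bij: "bij L" and L_image: "L ` \<Lambda> = integer_vectors"
  using lattice by (auto simp: identifies_lattice_def)

lemma lattice_mem_iff: "l \<in> \<Lambda> \<longleftrightarrow> L l \<in> integer_vectors"
  using inj_image_mem_iff[OF bij_is_inj[OF L_bij]] L_image by metis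

lemma L_add: "L (u + w) = L u + L w" and L_diff: "L (u - w) = L u - L w"
  and L_minus: "L (- u) = - L u" and L_zero [simp]: "L 0 = 0"
  using L_linear by (simp_all add: linear_add linear_diff linear_neg linear_0)

lemma zero_lattice [simp]: "0 \<in> \<Lambda>"
  by (simp add: lattice_mem_iff)

lemma lattice_add: "k \<in> \<Lambda> \<Longrightarrow> l \<in> \<Lambda> \<Longrightarrow> k + l \<in> \<Lambda>"
  and lattice_diff: "k \<in> \<Lambda> \<Longrightarrow> l \<in> \<Lambda> \<Longrightarrow> k - l \<in> \<Lambda>"
  and lattice_minus: "l \<in> \<Lambda> \<Longrightarrow> - l \<in> \<Lambda>"
  by (simp_all add: lattice_mem_iff L_add L_diff L_minus integer_vectors_add
      integer_vectors_diff integer_vectors_minus)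

lemma lattice_add_iff: "l \<in> \<Lambda> \<Longrightarrow> u + l \<in> \<Lambda> \<longleftrightarrow> u \<in> \<Lambda>"
  using lattice_add[of u l] lattice_diff[of "u + l" l] by auto

lemma lattice_bij: "bij_betw L \<Lambda> integer_vectors"
  using inj_on_subset[OF bij_is_inj[OF L_bij]] L_image by (simp add: bij_betw_def)

lemma translate: "l \<in> \<Lambda> \<Longrightarrow> (\<lambda>x. l + x) ` V = V" "l \<in> \<Lambda> \<Longrightarrow> (\<lambda>e. (\<lambda>x. l + x) ` e) ` E = E"
  using tiling unfolding periodic_tiling_def by blast+

lemma V_add: "u \<in> V \<Longrightarrow> l \<in> \<Lambda> \<Longrightarrow> u + l \<in> V"
  using translate(1)[of l] by (metis add.commute imageI)

lemma V_add_iff: "l \<in> \<Lambda> \<Longrightarrow> u + l \<in> V \<longleftrightarrow> u \<in> V"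
  using V_add[of "u + l" "- l"] V_add[of u l] lattice_minus[of l] by (metis add_diff_cancel_right' diff_conv_add_uminus)

lemma lattice_sub: "\<Lambda> \<subseteq> V"
  using V_add[OF origin] by auto

lemma edge_meets:
  assumes "e \<in> E" shows "\<exists>a b. e \<inter> V = {a, b}"
proof -
  have "\<exists>g. simple_path g \<and> path_image g = e \<and> e \<inter> V = {pathstart g, pathfinish g}"
    using tiling assms by (simp only: periodic_tiling_def embedded_graph_def)
  then obtain g where "e \<inter> V = {pathstart g, pathfinish g}" by (elim exE conjE)
  then show ?thesis by (intro exI)
qed

lemma edges_between_sym: "edges_between V E u w = edges_between V E w u"
  by (simp add: edges_between_def insert_commute)

lemma edges_between_mem:
  assumes "e \<in> edges_between V E u w" shows "u \<in> V" "w \<in> V" "u \<in> e" "w \<in> e" "e \<in> E"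
  using assms by (auto simp: edges_between_def)

lemma edges_between_unique:
  "e \<in> edges_between V E u w \<Longrightarrow> e \<in> edges_between V E u w' \<Longrightarrow> w = w'"
  by (auto simp: edges_between_def doubleton_eq_iff)

lemma nbrs_iff: "w \<in> nbrs u \<longleftrightarrow> edges_between V E u w \<noteq> {}"
  unfolding nbrs_def using edges_between_mem(2) by blast

lemma nbrs_sym: "w \<in> nbrs u \<Longrightarrow> u \<in> nbrs w"
  by (simp add: nbrs_iff edges_between_sym[of u w])

lemma nbrs_sub: "w \<in> nbrs u \<Longrightarrow> w \<in> V" by (simp add: nbrs_def)

lemma edges_translate_sub:
  assumes l: "l \<in> \<Lambda>" and e: "e \<in> edges_between V E u w"
  shows "(\<lambda>x. l + x) ` e \<in> edges_between V E (u + l) (w + l)"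
proof -
  have "(\<lambda>x. l + x) ` e \<inter> V = (\<lambda>x. l + x) ` e \<inter> (\<lambda>x. l + x) ` V"
    by (simp only: translate(1)[OF l])
  also have "\<dots> = (\<lambda>x. l + x) ` (e \<inter> V)" by auto
  also have "\<dots> = {u + l, w + l}"
    using e by (auto simp: edges_between_def add.commute)
  finally show ?thesis using translate(2)[OF l] e by (auto simp: edges_between_def)
qed

lemma image_add_inj: "inj_on (\<lambda>e. (\<lambda>x. (l :: real ^ 'n) + x) ` e) S"
  by (rule inj_onI) (simp add: inj_image_eq_iff)

lemma card_edges_translate:
  assumes l: "l \<in> \<Lambda>"
  shows "card (edges_between V E (u + l) (w + l)) = card (edges_between V E u w)"
proof -
  have "edges_between V E (u + l) (w + l) = (\<lambda>e. (\<lambda>x. l + x) ` e) ` edges_between V E u w"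
  proof (intro equalityI subsetI)
    fix e assume "e \<in> edges_between V E (u + l) (w + l)"
    then have "(\<lambda>x. - l + x) ` e \<in> edges_between V E u w"
      using edges_translate_sub[OF lattice_minus[OF l], of e "u + l" "w + l"] by simp
    moreover have "e = (\<lambda>x. l + x) ` (\<lambda>x. - l + x) ` e" by (simp add: image_image)
    ultimately show "e \<in> (\<lambda>e. (\<lambda>x. l + x) ` e) ` edges_between V E u w" by blast
  qed (use edges_translate_sub[OF l] in auto)
  then show ?thesis by (simp add: card_image image_add_inj)
qed

lemma edges_nonempty_translate:
  assumes l: "l \<in> \<Lambda>"
  shows "edges_between V E (u + l) (w + l) \<noteq> {} \<longleftrightarrow> edges_between V E u w \<noteq> {}"
  using edges_translate_sub[OF l, of _ u w] edges_translate_sub[OF lattice_minus[OF l], of _ "u + l" "w + l"]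
  by fastforce

lemma finite_edges_at: "u \<in> V \<Longrightarrow> finite {e \<in> E. u \<in> e}"
  using tiling unfolding periodic_tiling_def by blast

lemma finite_edges_between: "finite (edges_between V E u w)"
proof (cases "u \<in> V")
  case True
  show ?thesis
    by (rule finite_subset[OF _ finite_edges_at[OF True]]) (auto simp: edges_between_def)
next
  case False
  then have "edges_between V E u w = {}" using edges_between_mem(1) by blast
  then show ?thesis by simp
qed

lemma finite_nbrs [simp]:
  assumes "u \<in> V" shows "finite (nbrs u)"
proof -
  have "nbrs u \<subseteq> (\<lambda>e. THE w. e \<in> edges_between V E u w) ` {e \<in> E. u \<in> e}"
  proof
    fix w assume "w \<in> nbrs u"
    then obtain e where e: "e \<in> edges_between V E u w" by (auto simp: nbrs_def)
    then have "(THE w. e \<in> edges_between V E u w) = w"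
      using edges_between_unique by blast
    then show "w \<in> (\<lambda>e. THE w. e \<in> edges_between V E u w) ` {e \<in> E. u \<in> e}"
      using edges_between_mem[OF e] by (auto intro!: image_eqI[of w _ e])
  qed
  then show ?thesis using finite_edges_at[OF assms] by (rule finite_surj[rotated])
qed

lemma degree_eq_sum:
  assumes "u \<in> V"
  shows "vertex_degree E u = (\<Sum>w\<in>nbrs u. card (edges_between V E u w))"
proof -
  have "{e \<in> E. u \<in> e} = (\<Union>w\<in>nbrs u. edges_between V E u w)"
  proof (intro equalityI subsetI)
    fix e assume e: "e \<in> {e \<in> E. u \<in> e}"
    then obtain a b where ab: "e \<inter> V = {a, b}" using edge_meets by blast
    then have "u = a \<or> u = b" using e assms by blast
    then have "\<exists>w. e \<inter> V = {u, w}" using ab by (auto simp: insert_commute)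
    then obtain w where "e \<in> edges_between V E u w" using e by (auto simp: edges_between_def)
    then show "e \<in> (\<Union>w\<in>nbrs u. edges_between V E u w)"
      using nbrs_iff by blast
  qed (auto simp: edges_between_def)
  moreover have "card (\<Union>w\<in>nbrs u. edges_between V E u w) = (\<Sum>w\<in>nbrs u. card (edges_between V E u w))"
    using edges_between_unique
    by (intro card_UN_disjoint) (auto simp: assms finite_edges_between)
  ultimately show ?thesis by (simp add: vertex_degree_def)
qed

lemma lattice_nontrivial: "\<exists>l\<in>\<Lambda>. l \<noteq> 0"
proof -
  obtain l where "l \<in> \<Lambda>" "L l = axis undefined 1"
    using L_image integer_vectors_simps(2)[of undefined] by (metis imageE)
  moreover from this have "l \<noteq> 0" by (auto simp: axis_eq_0_iff)
  ultimately show ?thesis by blast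
qed

lemma nbrs_nonempty:
  assumes "u \<in> V" shows "nbrs u \<noteq> {}"
proof -
  obtain l where l: "l \<in> \<Lambda>" "l \<noteq> 0" using lattice_nontrivial by blast
  then have "(u, u + l) \<in> {(a, b). edges_between V E a b \<noteq> {}}\<^sup>*"
    using tiling assms V_add by (auto simp: periodic_tiling_def connected_graph_def)
  then obtain w where "edges_between V E u w \<noteq> {}"
    using l by (cases rule: converse_rtranclE) auto
  then show ?thesis using nbrs_iff by blast
qed

lemma degree_pos:
  assumes "u \<in> V" shows "vertex_degree E u > 0"
proof -
  obtain w where w: "w \<in> nbrs u" using nbrs_nonempty[OF assms] by blast
  then have "card (edges_between V E u w) > 0"
    by (simp add: nbrs_def card_gt_0_iff finite_edges_between)
  also have "\<dots> \<le> vertex_degree E u"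
    unfolding degree_eq_sum[OF assms] by (rule member_le_sum) (use w assms in auto)
  finally show ?thesis .
qed

lemma P_nonneg [simp]: "P u w \<ge> 0" by (simp add: srw_kernel_def)

lemma P_pos: "u \<in> V \<Longrightarrow> w \<in> nbrs u \<Longrightarrow> P u w > 0"
  using degree_pos by (auto simp: srw_kernel_def nbrs_def card_gt_0_iff finite_edges_between)

lemma sum_P: "u \<in> V \<Longrightarrow> (\<Sum>w\<in>nbrs u. P u w) = 1"
proof -
  assume u: "u \<in> V"
  have "(\<Sum>w\<in>nbrs u. P u w) = real (\<Sum>w\<in>nbrs u. card (edges_between V E u w)) / real (vertex_degree E u)"
    by (simp add: srw_kernel_def sum_divide_distrib)
  then show ?thesis using degree_pos[OF u] by (simp add: degree_eq_sum[OF u, symmetric])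
qed

lemma degree_translate:
  assumes "u \<in> V" "l \<in> \<Lambda>" shows "vertex_degree E (u + l) = vertex_degree E u"
proof -
  have "{e \<in> E. u + l \<in> e} = (\<lambda>e. (\<lambda>x. l + x) ` e) ` {e \<in> E. u \<in> e}"
  proof (intro equalityI subsetI)
    fix e assume e: "e \<in> {e \<in> E. u + l \<in> e}"
    then obtain e' where "e' \<in> E" "e = (\<lambda>x. l + x) ` e'" using translate(2)[OF assms(2)] by blast
    then show "e \<in> (\<lambda>e. (\<lambda>x. l + x) ` e) ` {e \<in> E. u \<in> e}"
      using e by (auto simp: add.commute)
  next
    fix e assume "e \<in> (\<lambda>e. (\<lambda>x. l + x) ` e) ` {e \<in> E. u \<in> e}"
    then show "e \<in> {e \<in> E. u + l \<in> e}"
      using translate(2)[OF assms(2)] by (auto simp: add.commute)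
  qed
  then show ?thesis by (simp add: vertex_degree_def card_image image_add_inj)
qed

lemma P_translate: "u \<in> V \<Longrightarrow> l \<in> \<Lambda> \<Longrightarrow> P (u + l) (w + l) = P u w"
  by (simp add: srw_kernel_def card_edges_translate degree_translate)

lemma nbrs_translate: "l \<in> \<Lambda> \<Longrightarrow> nbrs (u + l) = (\<lambda>w. w + l) ` nbrs u"
proof (intro equalityI subsetI)
  fix w assume l: "l \<in> \<Lambda>" and w: "w \<in> nbrs (u + l)"
  then have "w - l \<in> nbrs u"
    using edges_nonempty_translate[OF l, of u "w - l"] V_add_iff[OF l, of "w - l"] by (simp add: nbrs_def)
  then show "w \<in> (\<lambda>w. w + l) ` nbrs u" by (auto intro!: image_eqI[of w _ "w - l"])
next
  fix w assume l: "l \<in> \<Lambda>" and "w \<in> (\<lambda>w. w + l) ` nbrs u"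
  then show "w \<in> nbrs (u + l)"
    using edges_nonempty_translate[OF l] V_add_iff[OF l] by (auto simp: nbrs_def)
qed

section \<open>Killed transition operators\<close>

text \<open>One step of the walk that is killed when it enters \<open>A\<close>; the two cases of interest are the free walk
  \<open>A = {}\<close> and the excursions from the lattice \<open>A = \<Lambda>\<close>.  The values lie in an arbitrary vector space
  because real probabilities and complex phases are both propagated.\<close>

definition walk_op :: "(real ^ 'n) set \<Rightarrow> (real ^ 'n \<Rightarrow> 'b::real_vector) \<Rightarrow> real ^ 'n \<Rightarrow> 'b" where
  "walk_op A f u = (\<Sum>w\<in>nbrs u - A. P u w *\<^sub>R f w)"

abbreviation iter :: "(real ^ 'n) set \<Rightarrow> nat \<Rightarrow> (real ^ 'n \<Rightarrow> 'b::real_vector) \<Rightarrow> real ^ 'n \<Rightarrow> 'b" where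
  "iter A n \<equiv> walk_op A ^^ n"

definition delta :: "real ^ 'n \<Rightarrow> real ^ 'n \<Rightarrow> real" where
  "delta w y = (if y = w then 1 else 0)"

lemma iter_Suc: "iter A (Suc n) f u = (\<Sum>w\<in>nbrs u - A. P u w *\<^sub>R iter A n f w)"
  by (simp add: walk_op_def)

lemma iter_add: "iter A (k + n) f = iter A k (iter A n f)"
  by (simp add: funpow_add)

abbreviation walk_prob :: "nat \<Rightarrow> real ^ 'n \<Rightarrow> real ^ 'n \<Rightarrow> real" where
  "walk_prob n u w \<equiv> iter {} n (delta w) u"

lemma srw_power_iter: "srw_power V E n u w = walk_prob n u w"
  by (induction n arbitrary: u) (simp_all add: delta_def walk_op_def nbrs_def)

lemma iter_cong:
  assumes "\<And>u. u \<in> V \<Longrightarrow> f u = g u" "u \<in> V"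
  shows "iter A n f u = iter A n g u"
  using assms(2) by (induction n arbitrary: u) (auto simp: walk_op_def assms(1) nbrs_sub intro!: sum.cong)

lemma iter_plus: "iter A n (\<lambda>u. f u + g u) u = iter A n f u + iter A n g u"
  by (induction n arbitrary: u) (simp_all add: walk_op_def scaleR_add_right sum.distrib)

lemma iter_scaleR: "iter A n (\<lambda>u. f u *\<^sub>R c) u = iter A n f u *\<^sub>R c"
  by (induction n arbitrary: u) (simp_all add: walk_op_def scaleR_sum_left)

lemma iter_mult_right: "iter A n (\<lambda>u. f u * c) u = iter A n f u * c" for c :: "'b::real_algebra"
  by (induction n arbitrary: u) (simp_all add: walk_op_def sum_distrib_right)

lemma norm_iter_le:
  fixes f :: "real ^ 'n \<Rightarrow> 'b::real_normed_vector"
  assumes "\<And>u. u \<in> V \<Longrightarrow> norm (f u) \<le> g u" "u \<in> V"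
  shows "norm (iter A n f u) \<le> iter A n g u"
  using assms(2)
proof (induction n arbitrary: u)
  case (Suc n)
  have "norm (iter A (Suc n) f u) \<le> (\<Sum>w\<in>nbrs u - A. norm (P u w *\<^sub>R iter A n f w))"
    unfolding iter_Suc by (rule norm_sum)
  also have "\<dots> \<le> (\<Sum>w\<in>nbrs u - A. P u w *\<^sub>R iter A n g w)"
    using Suc.IH by (intro sum_mono) (auto simp: nbrs_sub intro!: mult_left_mono)
  finally show ?case unfolding iter_Suc .
qed (use assms in auto)

lemma iter_mono:
  fixes f g :: "real ^ 'n \<Rightarrow> real"
  assumes "\<And>u. u \<in> V \<Longrightarrow> f u \<le> g u" "u \<in> V"
  shows "iter A n f u \<le> iter A n g u"
  using assms(2)
proof (induction n arbitrary: u)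
  case (Suc n)
  then show ?case unfolding iter_Suc
    by (intro sum_mono) (auto simp: nbrs_sub intro!: mult_left_mono)
qed (use assms in auto)

lemma iter_nonneg:
  fixes f :: "real ^ 'n \<Rightarrow> real"
  assumes "\<And>u. u \<in> V \<Longrightarrow> 0 \<le> f u" "u \<in> V"
  shows "0 \<le> iter A n f u"
  using assms(2)
proof (induction n arbitrary: u)
  case (Suc n)
  then show ?case unfolding iter_Suc by (intro sum_nonneg) (auto simp: nbrs_sub)
qed (use assms in auto)

lemma iter_1_le: "u \<in> V \<Longrightarrow> iter A n (\<lambda>_. 1 :: real) u \<le> 1"
proof (induction n arbitrary: u)
  case (Suc n)
  have "iter A (Suc n) (\<lambda>_. 1 :: real) u \<le> (\<Sum>w\<in>nbrs u - A. P u w)"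
    unfolding iter_Suc using Suc by (intro sum_mono) (auto simp: nbrs_sub intro!: mult_left_le)
  also have "\<dots> \<le> (\<Sum>w\<in>nbrs u. P u w)" using Suc.prems by (intro sum_mono2) auto
  finally show ?case using sum_P[OF Suc.prems] by simp
qed simp

lemma delta_nonneg [simp]: "0 \<le> delta w y" by (simp add: delta_def)

lemma iter_delta_nonneg [simp]: "u \<in> V \<Longrightarrow> 0 \<le> iter A n (delta w) u"
  by (rule iter_nonneg) auto

lemma iter_Suc_pos:
  fixes f :: "real ^ 'n \<Rightarrow> real"
  assumes f: "\<And>u. u \<in> V \<Longrightarrow> 0 \<le> f u" and u: "u \<in> V"
  shows "iter A (Suc n) f u > 0 \<longleftrightarrow> (\<exists>w\<in>nbrs u - A. iter A n f w > 0)"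
proof
  assume "iter A (Suc n) f u > 0"
  then obtain w where "w \<in> nbrs u - A" "P u w *\<^sub>R iter A n f w > 0"
    unfolding iter_Suc by (meson not_le sum_nonpos)
  then show "\<exists>w\<in>nbrs u - A. iter A n f w > 0"
    using P_nonneg[of u w] by (auto simp: zero_less_mult_iff)
next
  assume "\<exists>w\<in>nbrs u - A. iter A n f w > 0"
  then obtain w where w: "w \<in> nbrs u - A" "iter A n f w > 0" by blast
  show "iter A (Suc n) f u > 0"
    unfolding iter_Suc
  proof (rule sum_pos2[OF _ w(1)])
    show "0 < P u w *\<^sub>R iter A n f w" using w P_pos[OF u] by simp
    show "0 \<le> P u w *\<^sub>R iter A n f w" if "w \<in> nbrs u - A" for w
    proof -
      have "0 \<le> iter A n f w" using that by (intro iter_nonneg f) (auto simp: nbrs_sub)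
      then show ?thesis by simp
    qed
  qed (use u in auto)
qed

lemma path_compose:
  assumes "u \<in> V" "w \<in> V" "iter A k (delta w) u > 0" "iter A n (delta y) w > 0"
  shows "iter A (k + n) (delta y) u > 0"
proof -
  have "iter A k (delta w) u * iter A n (delta y) w = iter A k (\<lambda>z. delta w z * iter A n (delta y) w) u"
    by (rule iter_mult_right[symmetric])
  also have "\<dots> \<le> iter A k (iter A n (delta y)) u"
    using assms(1) by (intro iter_mono) (auto simp: delta_def)
  also have "\<dots> = iter A (k + n) (delta y) u" by (simp only: iter_add)
  finally show ?thesis by (rule less_le_trans[OF mult_pos_pos[OF assms(3,4)]])
qed

lemma path_step: "u \<in> V \<Longrightarrow> w \<in> nbrs u \<Longrightarrow> walk_prob 1 u w > 0"
  using iter_Suc_pos[of "delta w" u 0 "{}"] by (auto simp: delta_def)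

lemma path_exists:
  assumes "u \<in> V" "w \<in> V"
  shows "\<exists>n. walk_prob n u w > 0"
proof -
  have "(u, w) \<in> {(a, b). edges_between V E a b \<noteq> {}}\<^sup>*"
    using tiling assms by (auto simp: periodic_tiling_def connected_graph_def)
  then show ?thesis using assms(1)
  proof (induction rule: converse_rtrancl_induct)
    case base
    show ?case by (intro exI[of _ 0]) (simp add: delta_def)
  next
    case (step y z)
    then have z: "z \<in> nbrs y" using edges_between_mem by (auto simp: nbrs_def)
    then obtain n where "walk_prob n z w > 0" using step nbrs_sub by blast
    then have "walk_prob (Suc n) y w > 0"
      using z step.prems by (subst iter_Suc_pos) auto
    then show ?case by blast
  qed
qed

text \<open>Edges can be traversed in both directions, although the kernel itself is not symmetric unless all
  degrees agree.\<close>

lemma path_sym: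
  "u \<in> V \<Longrightarrow> w \<in> V \<Longrightarrow> walk_prob n u w > 0 \<Longrightarrow> walk_prob n w u > 0"
proof (induction n arbitrary: u)
  case 0
  then show ?case by (auto simp: delta_def split: if_splits)
next
  case (Suc n)
  then obtain x where x: "x \<in> nbrs u" "walk_prob n x w > 0"
    by (subst (asm) iter_Suc_pos) auto
  then have "walk_prob n w x > 0" using Suc nbrs_sub by blast
  moreover have "walk_prob 1 x u > 0"
    using path_step nbrs_sym[OF x(1)] nbrs_sub[OF x(1)] by blast
  ultimately have "walk_prob (n + 1) w u > 0"
    using Suc.prems x nbrs_sub by (intro path_compose[where w = x]) auto
  then show ?case by simp
qed

lemma iter_translate:
  assumes A: "A = {} \<or> A = \<Lambda>" and l: "l \<in> \<Lambda>" and u: "u \<in> V"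
  shows "iter A n f (u + l) = iter A n (\<lambda>w. f (w + l)) u"
  using u
proof (induction n arbitrary: u)
  case (Suc n)
  have inj: "inj_on (\<lambda>w. w + l) S" for S by (auto simp: inj_on_def)
  have "nbrs (u + l) - A = (\<lambda>w. w + l) ` (nbrs u - A)"
    using A lattice_add_iff[OF l] by (auto simp: nbrs_translate[OF l])
  then have "iter A (Suc n) f (u + l) = (\<Sum>w\<in>nbrs u - A. P (u + l) (w + l) *\<^sub>R iter A n f (w + l))"
    unfolding iter_Suc by (simp add: sum.reindex[OF inj])
  also have "\<dots> = iter A (Suc n) (\<lambda>w. f (w + l)) u"
    unfolding iter_Suc using Suc
    by (intro sum.cong) (auto simp: P_translate l nbrs_sub)
  finally show ?case .
qed simp

lemma iter_delta_translate:
  assumes "A = {} \<or> A = \<Lambda>" "l \<in> \<Lambda>" "u \<in> V"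
  shows "iter A n (delta (w + l)) (u + l) = iter A n (delta w) u"
  unfolding iter_translate[OF assms] by (simp add: delta_def[abs_def])

end

section \<open>Contraction on quasi-periodic functions\<close>

lemma summable_power_div:
  fixes \<theta> :: real
  assumes "0 \<le> \<theta>" "\<theta> < 1" "K > 0"
  shows "summable (\<lambda>n. \<theta> ^ (n div K))"
proof (rule summableI_nonneg_bounded)
  fix N
  have "(\<Sum>n<N. \<theta> ^ (n div K)) \<le> (\<Sum>n<N * K. \<theta> ^ (n div K))"
    using assms by (intro sum_mono2) auto
  also have "\<dots> = (\<Sum>j<N. \<Sum>n\<in>{j * K..<j * K + K}. \<theta> ^ (n div K))"
    by (rule sum.nat_group[symmetric])
  also have "\<dots> = (\<Sum>j<N. \<Sum>n\<in>{j * K..<j * K + K}. \<theta> ^ j)"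
  proof (intro sum.cong refl)
    fix j n assume "n \<in> {j * K..<j * K + K}"
    then have "n div K = j" by (intro div_nat_eqI) (auto simp: mult.commute)
    then show "\<theta> ^ (n div K) = \<theta> ^ j" by simp
  qed
  also have "\<dots> = real K * (\<Sum>j<N. \<theta> ^ j)" by (simp add: sum_distrib_left)
  also have "\<dots> \<le> real K * (\<Sum>j. \<theta> ^ j)"
    using assms by (intro mult_left_mono sum_le_suminf summable_geometric) auto
  finally show "(\<Sum>n<N. \<theta> ^ (n div K)) \<le> real K * (\<Sum>j. \<theta> ^ j)" .
qed (use assms in simp)

context periodic_walk
begin

text \<open>Lattice translations act by the character of frequency \<open>x\<close>.\<close>

definition quasi_periodic :: "real ^ 'n \<Rightarrow> (real ^ 'n \<Rightarrow> complex) \<Rightarrow> bool" where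
  "quasi_periodic x f \<longleftrightarrow> (\<forall>u\<in>V. \<forall>l\<in>\<Lambda>. f (u + l) = torus_char (L l) x * f u)"

lemma rep_V: "i \<le> m \<Longrightarrow> v i \<in> V" and rep_0: "v 0 = 0"
  using reps by (auto simp: orbit_representatives_def)

lemma rep_exists:
  assumes "u \<in> V"
  obtains i where "i \<le> m" "u - v i \<in> \<Lambda>" "u = v i + (u - v i)"
  using reps assms by (auto simp: orbit_representatives_def)

lemma quasi_periodic_norm_le:
  assumes "quasi_periodic x f" "\<And>i. i \<le> m \<Longrightarrow> norm (f (v i)) \<le> c" "u \<in> V"
  shows "norm (f u) \<le> c"
proof -
  obtain i where i: "i \<le> m" "u - v i \<in> \<Lambda>" using rep_exists[OF assms(3)] by blast
  then have "f (v i + (u - v i)) = torus_char (L (u - v i)) x * f (v i)"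
    using assms(1) rep_V by (simp only: quasi_periodic_def)
  then show ?thesis using assms(2)[OF i(1)] by (simp add: norm_mult)
qed

lemma iter_mult_left: "iter A n (\<lambda>u. c * f u) u = c * iter A n f u" for c :: complex
  using iter_mult_right[of n A f c u] by (simp add: mult.commute)

lemma quasi_periodic_iter:
  assumes A: "A = {} \<or> A = \<Lambda>" and f: "quasi_periodic x f"
  shows "quasi_periodic x (iter A n f)"
  unfolding quasi_periodic_def
proof (intro ballI)
  fix u l assume u: "u \<in> V" and l: "l \<in> \<Lambda>"
  have "iter A n f (u + l) = iter A n (\<lambda>w. f (w + l)) u" by (rule iter_translate[OF A l u])
  also have "\<dots> = iter A n (\<lambda>w. torus_char (L l) x * f w) u"
    using f l by (intro iter_cong u) (simp add: quasi_periodic_def)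
  finally show "iter A n f (u + l) = torus_char (L l) x * iter A n f u"
    by (simp add: iter_mult_left)
qed

lemma norm_iter_le_const:
  fixes f :: "real ^ 'n \<Rightarrow> 'b::real_normed_vector"
  assumes "\<And>u. u \<in> V \<Longrightarrow> norm (f u) \<le> c" "u \<in> V"
  shows "norm (iter A n f u) \<le> c * iter A n (\<lambda>_. 1) u" "norm (iter A n f u) \<le> c"
proof -
  have c: "c \<ge> 0" using assms order_trans[OF norm_ge_zero] by blast
  have "norm (iter A n f u) \<le> iter A n (\<lambda>_. 1 * c) u"
    by (rule norm_iter_le) (use assms in auto)
  also have "\<dots> = c * iter A n (\<lambda>_. 1) u"
    using iter_mult_right[of n A "\<lambda>_. 1" c u] by (simp only: mult.commute)
  finally show "norm (iter A n f u) \<le> c * iter A n (\<lambda>_. 1) u" .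
  also have "\<dots> \<le> c" using c iter_1_le[OF assms(2)] by (simp add: mult_left_le)
  finally show "norm (iter A n f u) \<le> c" .
qed

text \<open>By quasi-periodicity it suffices to gain a factor below one at each of the finitely many
  representatives, at times that may depend on the representative.\<close>

lemma quasi_periodic_contraction:
  assumes A: "A = {} \<or> A = \<Lambda>"
    and loc: "\<And>i. i \<le> m \<Longrightarrow> \<exists>K \<theta>. \<theta> < 1 \<and> (\<forall>f c. quasi_periodic x f \<longrightarrow> (\<forall>u\<in>V. norm (f u) \<le> c) \<longrightarrow>
        norm (iter A K f (v i)) \<le> \<theta> * c)"
  obtains K \<theta> where "K > 0" "0 \<le> \<theta>" "\<theta> < 1"
    "\<And>f c n u. quasi_periodic x f \<Longrightarrow> (\<And>u. u \<in> V \<Longrightarrow> norm (f u) \<le> c) \<Longrightarrow> u \<in> V \<Longrightarrow>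
      norm (iter A n f u) \<le> \<theta> ^ (n div K) * c"
proof -
  obtain k \<theta>' where k\<theta>: "\<And>i. i \<le> m \<Longrightarrow> \<theta>' i < 1"
    "\<And>i f c. i \<le> m \<Longrightarrow> quasi_periodic x f \<Longrightarrow> (\<And>u. u \<in> V \<Longrightarrow> norm (f u) \<le> c) \<Longrightarrow>
        norm (iter A (k i) f (v i)) \<le> \<theta>' i * c"
    using loc by metis
  define K where "K = Suc (\<Sum>i\<le>m. k i)"
  define \<theta> where "\<theta> = Max (insert 0 (\<theta>' ` {..m}))"
  have \<theta>: "0 \<le> \<theta>" "\<theta> < 1" using k\<theta>(1) by (auto simp: \<theta>_def)
  have step: "norm (iter A K f u) \<le> \<theta> * c"
    if f: "quasi_periodic x f" "\<And>u. u \<in> V \<Longrightarrow> norm (f u) \<le> c" and u: "u \<in> V" for f c u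
  proof (rule quasi_periodic_norm_le[OF quasi_periodic_iter[OF A f(1)] _ u])
    fix i assume i: "i \<le> m"
    have c: "c \<ge> 0" using f(2)[OF u] order_trans[OF norm_ge_zero] by blast
    have "k i \<le> (\<Sum>i\<le>m. k i)" using i by (intro member_le_sum) auto
    then have "K = k i + (K - k i)" by (simp add: K_def)
    then have "iter A K f (v i) = iter A (k i) (iter A (K - k i) f) (v i)"
      by (metis iter_add)
    also have "norm \<dots> \<le> \<theta>' i * c"
      by (rule k\<theta>(2)[OF i quasi_periodic_iter[OF A f(1)] norm_iter_le_const(2)[OF f(2)]])
    also have "\<dots> \<le> \<theta> * c"
      unfolding \<theta>_def using i c by (intro mult_right_mono Max_ge) auto
    finally show "norm (iter A K f (v i)) \<le> \<theta> * c" .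
  qed
  have pow: "norm (iter A (q * K + r) f u) \<le> \<theta> ^ q * c"
    if f: "quasi_periodic x f" "\<And>u. u \<in> V \<Longrightarrow> norm (f u) \<le> c" and u: "u \<in> V" for f c u q r
    using u
  proof (induction q arbitrary: u)
    case 0
    then show ?case using norm_iter_le_const(2)[OF f(2)] by simp
  next
    case (Suc q)
    have "iter A (Suc q * K + r) f = iter A K (iter A (q * K + r) f)"
      by (simp only: iter_add[symmetric] mult_Suc add.assoc)
    then have "norm (iter A (Suc q * K + r) f u) \<le> \<theta> * (\<theta> ^ q * c)"
      using step[OF quasi_periodic_iter[OF A f(1)] Suc.IH Suc.prems] by simp
    then show ?case by (simp add: mult.assoc)
  qed
  have "norm (iter A n f u) \<le> \<theta> ^ (n div K) * c"
    if "quasi_periodic x f" "\<And>u. u \<in> V \<Longrightarrow> norm (f u) \<le> c" "u \<in> V" for f c n u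
    using pow[OF that, of "n div K" "n mod K"] by simp
  then show ?thesis using that[of K \<theta>] \<theta> by (simp add: K_def)
qed

lemma iter_of_real: "iter A n (\<lambda>_. 1 :: complex) u = of_real (iter A n (\<lambda>_. 1) u)"
  using iter_scaleR[of n A "\<lambda>_. 1" "1 :: complex" u] by (simp add: scaleR_conv_of_real)

abbreviation killed_mass :: "nat \<Rightarrow> real ^ 'n \<Rightarrow> real" where
  "killed_mass n u \<equiv> iter \<Lambda> n (\<lambda>_. 1) u"

text \<open>A path to the lattice carries mass that is removed at the first positive time at which the path
  meets the lattice.\<close>

lemma killed_mass_less_1:
  assumes "l \<in> \<Lambda>" "u \<in> V" "walk_prob (Suc n) u l > 0"
  shows "killed_mass (Suc n) u < 1"
  using assms(2,3)
proof (induction n arbitrary: u)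
  case (0 u)
  from 0(2) have l: "l \<in> nbrs u"
    by (subst (asm) iter_Suc_pos) (use 0(1) in \<open>auto simp: delta_def split: if_splits\<close>)
  have "killed_mass (Suc 0) u = (\<Sum>w\<in>nbrs u - \<Lambda>. P u w)" by (simp add: walk_op_def)
  also have "\<dots> < (\<Sum>w\<in>nbrs u. P u w)"
    by (rule sum_strict_mono2[of _ _ l]) (use l 0 assms(1) P_pos in auto)
  finally show ?case using sum_P[OF 0(1)] by simp
next
  case (Suc n u)
  then obtain w where w: "w \<in> nbrs u" "walk_prob (Suc n) w l > 0"
    by (subst (asm) iter_Suc_pos) auto
  note wV = nbrs_sub[OF w(1)]
  have le: "P u w * killed_mass (Suc n) w \<le> P u w" if "w \<in> V" for w
    by (rule mult_left_le[OF iter_1_le[OF that] P_nonneg])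
  have "killed_mass (Suc (Suc n)) u = (\<Sum>w\<in>nbrs u - \<Lambda>. P u w * iter \<Lambda> (Suc n) (\<lambda>_. 1) w)"
    unfolding iter_Suc[of "Suc n" \<Lambda>] by simp
  also have "\<dots> < (\<Sum>w\<in>nbrs u. P u w)"
  proof (cases "w \<in> \<Lambda>")
    case True
    have "(\<Sum>w\<in>nbrs u - \<Lambda>. P u w * iter \<Lambda> (Suc n) (\<lambda>_. 1) w) \<le> (\<Sum>w\<in>nbrs u - \<Lambda>. P u w)"
      using le by (intro sum_mono) (auto simp: nbrs_sub)
    also have "\<dots> < (\<Sum>w\<in>nbrs u. P u w)"
      by (rule sum_strict_mono2[of _ _ w]) (use w True Suc.prems P_pos in auto)
    finally show ?thesis .
  next
    case False
    have "P u w * iter \<Lambda> (Suc n) (\<lambda>_. 1) w < P u w"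
      using Suc.IH[OF wV w(2)] P_pos[OF Suc.prems(1) w(1)] by simp
    then have "(\<Sum>w\<in>nbrs u - \<Lambda>. P u w * iter \<Lambda> (Suc n) (\<lambda>_. 1) w) < (\<Sum>w\<in>nbrs u - \<Lambda>. P u w)"
      using le w False Suc.prems by (intro sum_strict_mono_ex1) (auto simp: nbrs_sub)
    also have "\<dots> \<le> (\<Sum>w\<in>nbrs u. P u w)"
      using Suc.prems by (intro sum_mono2) auto
    finally show ?thesis .
  qed
  finally show ?case using sum_P[OF Suc.prems(1)] by simp
qed

text \<open>The probability of avoiding the lattice for a long time decays geometrically, uniformly in the
  starting vertex.\<close>

lemma killed_mass_summable:
  obtains d :: "nat \<Rightarrow> real" where "summable d" "\<And>n. 0 \<le> d n"
    "\<And>n u. u \<in> V \<Longrightarrow> killed_mass n u \<le> d n"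
proof -
  have one: "quasi_periodic 0 (\<lambda>_. 1)" by (simp add: quasi_periodic_def)
  have loc: "\<exists>K \<theta>. \<theta> < 1 \<and> (\<forall>f c. quasi_periodic 0 f \<longrightarrow> (\<forall>u\<in>V. norm (f u) \<le> c) \<longrightarrow>
      norm (iter \<Lambda> K f (v i)) \<le> \<theta> * c)" if i: "i \<le> m" for i
  proof -
    obtain w where w: "w \<in> nbrs (v i)" using nbrs_nonempty[OF rep_V[OF i]] by blast
    obtain n where n: "walk_prob n w 0 > 0"
      using path_exists[OF nbrs_sub[OF w] origin] by blast
    have "walk_prob (Suc n) (v i) 0 > 0"
      using w n rep_V[OF i] by (subst iter_Suc_pos) auto
    then have "killed_mass (Suc n) (v i) < 1"
      by (intro killed_mass_less_1[of 0] rep_V i) auto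
    moreover have "norm (iter \<Lambda> (Suc n) f (v i)) \<le> iter \<Lambda> (Suc n) (\<lambda>_. 1) (v i) * c"
      if "\<forall>u\<in>V. norm (f u) \<le> c" for f :: "real ^ 'n \<Rightarrow> complex" and c
      using norm_iter_le_const(1)[of f c "v i" "Suc n" \<Lambda>] that rep_V[OF i] by (simp add: mult.commute)
    ultimately show ?thesis by blast
  qed
  obtain K \<theta> where K: "K > 0" "0 \<le> \<theta>" "\<theta> < 1"
    and bd: "\<And>f c n u. quasi_periodic 0 f \<Longrightarrow> (\<And>u. u \<in> V \<Longrightarrow> norm (f u) \<le> c) \<Longrightarrow> u \<in> V \<Longrightarrow>
      norm (iter \<Lambda> n f u) \<le> \<theta> ^ (n div K) * c"
    using quasi_periodic_contraction[of \<Lambda> 0, OF _ loc] by blast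
  have "killed_mass n u \<le> \<theta> ^ (n div K)" if "u \<in> V" for n u
    using bd[OF one, of 1 u n] that by (simp add: iter_of_real)
  then show ?thesis
    using that[of "\<lambda>n. \<theta> ^ (n div K)"] summable_power_div[OF K(2,3,1)] K by simp
qed

text \<open>Some \<open>\<chi>(2l)\<close> differs from one when \<open>2x\<close> is not an integer vector.  A path from \<open>0\<close> to \<open>l\<close> can be
  continued back to \<open>0\<close> or on to \<open>2l\<close> in the same number of steps, and the contributions of these two
  end points partly cancel.  A comparison of \<open>0\<close> with \<open>l\<close> itself would fail in a bipartite tiling,
  where these points may never be reached at the same time.\<close>

lemma free_walk_decay:
  assumes x: "2 *\<^sub>R x \<notin> integer_vectors" and f: "quasi_periodic x f" and u: "u \<in> V"
  shows "(\<lambda>n. iter {} n f u) \<longlonglongrightarrow> 0"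
proof -
  obtain i where i: "2 * x $ i \<notin> \<int>" using x by (auto simp: integer_vectors_def)
  obtain l where l: "l \<in> \<Lambda>" "L l = axis i 1"
    using L_image integer_vectors_simps(2)[of i] by (metis imageE)
  have l2: "l + l \<in> \<Lambda>" using l lattice_add by blast
  have \<chi>: "torus_char (L (l + l)) x \<noteq> 1"
  proof
    assume "torus_char (L (l + l)) x = 1"
    then have "torus_char (axis i 1) x * torus_char (axis i 1) x = 1"
      by (simp only: L_add l torus_char_add)
    then have "cis (- (2 * pi * (2 * x $ i))) = 1"
      by (simp add: torus_char_cis inner_axis cis_mult algebra_simps)
    then have "cos (2 * pi * (2 * x $ i)) = 1" by (auto simp: complex_eq_iff)
    then obtain n :: int where "2 * pi * (2 * x $ i) = of_int n * 2 * pi"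
      by (auto simp: cos_one_2pi_int)
    then have "2 * x $ i = of_int n" by simp
    then show False using i by simp
  qed
  define \<chi>2 where "\<chi>2 = torus_char (L (l + l)) x"
  have n\<chi>: "norm \<chi>2 = 1" by (simp add: \<chi>2_def)
  have lV: "l \<in> V" "l + l \<in> V" using l l2 lattice_sub by auto
  obtain k where k: "walk_prob k 0 l > 0" using path_exists[OF origin lV(1)] by blast
  have k1: "walk_prob k l 0 > 0" by (rule path_sym[OF origin lV(1) k])
  have k2: "walk_prob k l (l + l) > 0"
    using iter_delta_translate[of "{}" l 0 k l] k l origin by simp
  have loc: "\<exists>K \<theta>. \<theta> < 1 \<and> (\<forall>f c. quasi_periodic x f \<longrightarrow> (\<forall>u\<in>V. norm (f u) \<le> c) \<longrightarrow>
      norm (iter {} K f (v i)) \<le> \<theta> * c)" if i: "i \<le> m" for i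
  proof -
    have vi: "v i \<in> V" by (rule rep_V[OF i])
    obtain n where n: "walk_prob n (v i) 0 > 0" using path_exists[OF vi origin] by blast
    \<comment> \<open>both \<open>0\<close> and \<open>2l\<close> are reached from the representative in exactly \<open>K\<close> steps\<close>
    define K where "K = n + (k + k)"
    define p p' where "p = walk_prob K (v i) 0" and "p' = walk_prob K (v i) (l + l)"
    have p: "p > 0" "p' > 0"
      unfolding p_def p'_def K_def
      using path_compose[OF vi origin n] path_compose[OF origin lV(1) k] k1 k2 by blast+
    define \<theta> where "\<theta> = 1 - p - p' + norm (p + p' * \<chi>2)"
    have "norm (complex_of_real p + of_real p' * \<chi>2) < p + p'"
    proof -
      have "norm (complex_of_real p + of_real p' * \<chi>2) \<noteq> p + p'"
      proof
        assume eq: "norm (complex_of_real p + of_real p' * \<chi>2) = p + p'"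
        then have "(norm (complex_of_real p + of_real p' * \<chi>2))\<^sup>2 = (p + p')\<^sup>2" by simp
        then have "(p + p' * Re \<chi>2)\<^sup>2 + (p' * Im \<chi>2)\<^sup>2 = (p + p')\<^sup>2"
          by (simp add: cmod_power2)
        moreover have "(Re \<chi>2)\<^sup>2 + (Im \<chi>2)\<^sup>2 = 1" using n\<chi> by (simp add: cmod_power2[symmetric])
        moreover have "(p + p' * Re \<chi>2)\<^sup>2 + (p' * Im \<chi>2)\<^sup>2 =
            p\<^sup>2 + 2 * p * p' * Re \<chi>2 + p'\<^sup>2 * ((Re \<chi>2)\<^sup>2 + (Im \<chi>2)\<^sup>2)"
          by (simp add: power2_eq_square algebra_simps)
        ultimately have "2 * p * p' * Re \<chi>2 = 2 * p * p' * 1"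
          by (simp add: power2_eq_square algebra_simps)
        then have "Re \<chi>2 = 1" using p by simp
        moreover from this have "Im \<chi>2 = 0" using \<open>(Re \<chi>2)\<^sup>2 + (Im \<chi>2)\<^sup>2 = 1\<close> by simp
        ultimately have "\<chi>2 = 1" by (simp add: complex_eq_iff)
        then show False using \<chi> by (simp add: \<chi>2_def)
      qed
      moreover have "norm (complex_of_real p + of_real p' * \<chi>2) \<le> p + p'"
        using p norm_triangle_ineq[of "complex_of_real p" "of_real p' * \<chi>2"] by (simp add: norm_mult n\<chi>)
      ultimately show ?thesis by simp
    qed
    then have \<theta>: "\<theta> < 1" by (simp add: \<theta>_def)
    have "norm (iter {} K f (v i)) \<le> \<theta> * c"
      if f: "quasi_periodic x f" and c: "\<forall>u\<in>V. norm (f u) \<le> c" for f c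
    proof -
      have c0: "c \<ge> 0" using c origin order_trans[OF norm_ge_zero] by blast
      have ne: "l + l \<noteq> 0" using \<chi> by auto
      \<comment> \<open>separate the two interfering end points from the rest\<close>
      define g where "g = (\<lambda>u. if u = 0 \<or> u = l + l then 0 else f u)"
      define g' where "g' = (\<lambda>u. delta 0 u *\<^sub>R f 0 + delta (l + l) u *\<^sub>R f (l + l))"
      have fg: "f = (\<lambda>u. g u + g' u)"
        using ne by (auto simp: g_def g'_def delta_def fun_eq_iff)
      have "iter {} K f (v i) = iter {} K g (v i) + (p *\<^sub>R f 0 + p' *\<^sub>R f (l + l))"
        by (subst fg) (simp only: iter_plus iter_scaleR g'_def p_def p'_def)
      also have "f (l + l) = \<chi>2 * f 0"
        using f l2 origin unfolding quasi_periodic_def \<chi>2_def by (metis add_0)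
      also have "p *\<^sub>R f 0 + p' *\<^sub>R (\<chi>2 * f 0) = (p + p' * \<chi>2) * f 0"
        by (simp add: scaleR_conv_of_real algebra_simps)
      finally have "norm (iter {} K f (v i)) \<le> norm (iter {} K g (v i)) + norm (p + p' * \<chi>2) * norm (f 0)"
        by (metis norm_triangle_ineq norm_mult)
      moreover have "norm (p + p' * \<chi>2) * norm (f 0) \<le> norm (p + p' * \<chi>2) * c"
        using c origin by (intro mult_left_mono) auto
      moreover have "norm (iter {} K g (v i)) \<le> (1 - p - p') * c"
      proof -
        have "norm (iter {} K g (v i)) \<le> iter {} K (\<lambda>u. (1 + (delta 0 u * (-1) + delta (l + l) u * (-1))) * c) (v i)"
          by (rule norm_iter_le[OF _ vi]) (use c c0 ne in \<open>auto simp: g_def delta_def\<close>)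
        also have "\<dots> = (iter {} K (\<lambda>_. 1) (v i) - p - p') * c"
          by (simp only: iter_mult_right iter_plus p_def p'_def) simp
        also have "\<dots> \<le> (1 - p - p') * c"
          using iter_1_le[OF vi, of K "{}"] c0 by (intro mult_right_mono) auto
        finally show ?thesis .
      qed
      ultimately show ?thesis by (simp add: \<theta>_def algebra_simps)
    qed
    then show ?thesis using \<theta> by blast
  qed
  obtain K \<theta> where K: "K > 0" "0 \<le> \<theta>" "\<theta> < 1"
    and bd: "\<And>f c n u. quasi_periodic x f \<Longrightarrow> (\<And>u. u \<in> V \<Longrightarrow> norm (f u) \<le> c) \<Longrightarrow> u \<in> V \<Longrightarrow>
      norm (iter {} n f u) \<le> \<theta> ^ (n div K) * c"
    using quasi_periodic_contraction[of "{}" x, OF _ loc] by blast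
  define c where "c = (\<Sum>i\<le>m. norm (f (v i)))"
  have c: "norm (f u) \<le> c" if "u \<in> V" for u
    by (rule quasi_periodic_norm_le[OF f _ that]) (auto simp: c_def intro!: member_le_sum)
  have "(\<lambda>n. \<theta> ^ (n div K) * c) \<longlonglongrightarrow> 0 * c"
    by (intro tendsto_mult_right summable_LIMSEQ_zero summable_power_div K)
  then have "(\<lambda>n. \<theta> ^ (n div K) * c) \<longlonglongrightarrow> 0" by simp
  then show ?thesis
    by (rule Lim_null_comparison[OF always_eventually, rotated]) (use bd[OF f c u] in auto)
qed

end

lemma has_sum_finite_sum:
  fixes f :: "'i \<Rightarrow> 'a \<Rightarrow> 'b::topological_comm_monoid_add"
  assumes "finite I" "\<And>i. i \<in> I \<Longrightarrow> (f i has_sum s i) A"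
  shows "((\<lambda>x. \<Sum>i\<in>I. f i x) has_sum (\<Sum>i\<in>I. s i)) A"
  using assms by (induction I rule: finite_induct) (auto intro: has_sum_add)

context periodic_walk
begin

section \<open>First returns to the lattice\<close>

abbreviation lchar :: "real ^ 'n \<Rightarrow> real ^ 'n \<Rightarrow> complex" where
  "lchar x l \<equiv> torus_char (L l) x"

definition hit_op :: "(real ^ 'n \<Rightarrow> 'b::real_vector) \<Rightarrow> real ^ 'n \<Rightarrow> 'b" where
  "hit_op f u = (\<Sum>w\<in>nbrs u \<inter> \<Lambda>. P u w *\<^sub>R f w)"

text \<open>The first return takes place at time \<open>n + 1\<close>: after \<open>n\<close> steps off the lattice one more step enters it.\<close>

definition return_prob :: "nat \<Rightarrow> real ^ 'n \<Rightarrow> real ^ 'n \<Rightarrow> real" where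
  "return_prob n u l = iter \<Lambda> n (hit_op (delta l)) u"

text \<open>The contribution of returns at time \<open>n + 1\<close> to the expected phase at the first return.\<close>

definition return_phase :: "real ^ 'n \<Rightarrow> nat \<Rightarrow> real ^ 'n \<Rightarrow> complex" where
  "return_phase x n = iter \<Lambda> n (hit_op (lchar x))"

lemma lchar_add: "lchar x (k + l) = lchar x k * lchar x l"
  by (simp add: L_add torus_char_add)

lemma op_split: "u \<in> V \<Longrightarrow> walk_op {} f u = hit_op f u + walk_op \<Lambda> f u"
  by (simp add: walk_op_def hit_op_def sum.Int_Diff[of "nbrs u" _ \<Lambda>])

abbreviation hit_mass :: "nat \<Rightarrow> real ^ 'n \<Rightarrow> real" where
  "hit_mass n u \<equiv> iter \<Lambda> n (hit_op (\<lambda>_. 1)) u"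

text \<open>The mass that enters the lattice in a step is the mass that the killed walk loses.\<close>

lemma hit_mass_eq:
  assumes u: "u \<in> V"
  shows "hit_mass n u = iter \<Lambda> n (\<lambda>_. 1) u - iter \<Lambda> (Suc n) (\<lambda>_. 1) u"
proof -
  have "hit_op (\<lambda>_. 1 :: real) w = 1 + walk_op \<Lambda> (\<lambda>_. 1) w * (- 1)" if "w \<in> V" for w
    using op_split[OF that, of "\<lambda>_. 1 :: real"] sum_P[OF that] by (simp add: walk_op_def[of "{}"])
  then have "iter \<Lambda> n (hit_op (\<lambda>_. 1 :: real)) u = iter \<Lambda> n (\<lambda>w. 1 + walk_op \<Lambda> (\<lambda>_. 1) w * (- 1)) u"
    by (rule iter_cong[OF _ u])
  also have "\<dots> = iter \<Lambda> n (\<lambda>_. 1) u + iter \<Lambda> n (iter \<Lambda> 1 (\<lambda>_. 1)) u * (- 1)"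
    by (simp only: iter_plus iter_mult_right) simp
  also have "iter \<Lambda> n (iter \<Lambda> 1 (\<lambda>_. 1 :: real)) = iter \<Lambda> (Suc n) (\<lambda>_. 1)"
    using iter_add[where k = n and n = 1 and A = \<Lambda> and f = "\<lambda>_. 1 :: real"] by simp
  finally show ?thesis by simp
qed

lemma hit_mass_sum:
  assumes "u \<in> V"
  shows "(\<Sum>n<N. hit_mass n u) = 1 - iter \<Lambda> N (\<lambda>_. 1) u"
  unfolding hit_mass_eq[OF assms]
  using sum_lessThan_telescope'[of "\<lambda>n. killed_mass n u" N] by simp

lemma hit_mass_le:
  assumes "u \<in> V"
  shows "hit_mass n u \<le> iter \<Lambda> n (\<lambda>_. 1) u"
    and "0 \<le> hit_mass n u"
  using hit_mass_eq[OF assms, of n] iter_nonneg[OF _ assms, of "\<lambda>_. 1 :: real" "Suc n" \<Lambda>]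
    iter_nonneg[OF _ assms, of "hit_op (\<lambda>_. 1 :: real)" n \<Lambda>]
  by (simp_all add: hit_op_def sum_nonneg)

lemma norm_return_phase_le: "u \<in> V \<Longrightarrow> norm (return_phase x n u) \<le> hit_mass n u"
  unfolding return_phase_def
proof (rule norm_iter_le)
  fix w show "norm (hit_op (lchar x) w) \<le> hit_op (\<lambda>_. 1) w"
    unfolding hit_op_def by (rule order_trans[OF norm_sum]) simp
qed

lemma return_phase_summable:
  assumes "u \<in> V"
  shows "summable (\<lambda>n. norm (return_phase x n u))"
    and "summable (\<lambda>n. hit_mass n u)"
proof -
  obtain d :: "nat \<Rightarrow> real" where d: "summable d" "\<And>n. 0 \<le> d n"
    "\<And>n u. u \<in> V \<Longrightarrow> killed_mass n u \<le> d n"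
    using killed_mass_summable by blast
  have "hit_mass n u \<le> d n" for n
    using hit_mass_le(1)[OF assms] d(3)[OF assms] by (rule order_trans)
  then have "norm (hit_mass n u) \<le> d n" for n
    using hit_mass_le(2)[OF assms, of n] by (simp only: real_norm_def abs_of_nonneg)
  then show sm: "summable (\<lambda>n. hit_mass n u)"
    by (rule summable_comparison_test'[OF d(1)])
  have "norm (norm (return_phase x n u)) \<le> hit_mass n u" for n
    using norm_return_phase_le[OF assms, of x n] by simp
  then show "summable (\<lambda>n. norm (return_phase x n u))"
    by (rule summable_comparison_test'[OF sm])
qed

lemma hit_mass_suminf_le_1:
  assumes "u \<in> V"
  shows "(\<Sum>n. hit_mass n u) \<le> 1"
  using return_phase_summable(2)[OF assms]
proof (rule suminf_le_const)
  show "(\<Sum>n<N. hit_mass n u) \<le> 1" for N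
    using hit_mass_sum[OF assms, of N] iter_nonneg[OF _ assms, of "\<lambda>_. 1 :: real" N \<Lambda>] by simp
qed

definition return_transform :: "real ^ 'n \<Rightarrow> real ^ 'n \<Rightarrow> complex" where
  "return_transform x u = (\<Sum>n. return_phase x n u)"

lemma norm_return_transform_le_1:
  assumes "u \<in> V" shows "norm (return_transform x u) \<le> 1"
proof -
  have "norm (return_transform x u) \<le> (\<Sum>n. norm (return_phase x n u))"
    unfolding return_transform_def by (rule summable_norm[OF return_phase_summable(1)[OF assms]])
  also have "\<dots> \<le> (\<Sum>n. hit_mass n u)"
    by (intro suminf_le norm_return_phase_le assms return_phase_summable)
  finally show ?thesis using hit_mass_suminf_le_1[OF assms] by linarith
qed

lemma hit_op_translate:
  assumes l: "l \<in> \<Lambda>" and u: "u \<in> V"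
  shows "hit_op f (u + l) = hit_op (\<lambda>w. f (w + l)) u"
proof -
  have inj: "inj_on (\<lambda>w. w + l) S" for S by (auto simp: inj_on_def)
  have "nbrs (u + l) \<inter> \<Lambda> = (\<lambda>w. w + l) ` (nbrs u \<inter> \<Lambda>)"
    using lattice_add_iff[OF l] by (auto simp: nbrs_translate[OF l])
  then show ?thesis
    unfolding hit_op_def by (simp add: sum.reindex[OF inj] P_translate[OF u l])
qed

lemma quasi_periodic_return_phase: "quasi_periodic x (return_phase x n)"
proof -
  have "quasi_periodic x (hit_op (lchar x))"
    unfolding quasi_periodic_def
  proof (intro ballI)
    fix u l assume "u \<in> V" "l \<in> \<Lambda>"
    then show "hit_op (lchar x) (u + l) = lchar x l * hit_op (lchar x) u"
      by (simp add: hit_op_translate lchar_add) (simp add: hit_op_def sum_distrib_left mult_ac)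
  qed
  then show ?thesis unfolding return_phase_def by (intro quasi_periodic_iter) auto
qed

lemma quasi_periodic_return_transform: "quasi_periodic x (return_transform x)"
  using quasi_periodic_return_phase[of x] suminf_mult[OF summable_norm_cancel[OF return_phase_summable(1)]]
  by (simp add: quasi_periodic_def return_transform_def)

lemma return_prob_nonneg [simp]: "u \<in> V \<Longrightarrow> 0 \<le> return_prob n u l"
  unfolding return_prob_def by (rule iter_nonneg) (auto simp: hit_op_def intro!: sum_nonneg)

lemma return_prob_Suc: "return_prob (Suc n) u l = (\<Sum>w\<in>nbrs u - \<Lambda>. P u w * return_prob n w l)"
  by (simp add: return_prob_def walk_op_def)

lemma return_prob_0: "u \<in> V \<Longrightarrow> l \<in> \<Lambda> \<Longrightarrow> return_prob 0 u l = (if l \<in> nbrs u then P u l else 0)"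
proof -
  assume u: "u \<in> V" and l: "l \<in> \<Lambda>"
  have "return_prob 0 u l = (\<Sum>w\<in>nbrs u \<inter> \<Lambda>. if w = l then P u w else 0)"
    by (simp add: return_prob_def hit_op_def delta_def if_distrib cong: if_cong)
  then show ?thesis using u l by (simp add: sum.delta)
qed

lemma return_prob_le: "u \<in> V \<Longrightarrow> return_prob n u l \<le> hit_mass n u"
  unfolding return_prob_def
  by (rule iter_mono) (auto simp: hit_op_def delta_def intro!: sum_mono)

lemma return_prob_translate:
  assumes "u \<in> V" "k \<in> \<Lambda>"
  shows "return_prob n (u + k) (l + k) = return_prob n u l"
proof -
  have "return_prob n (u + k) (l + k) = iter \<Lambda> n (\<lambda>w. hit_op (delta (l + k)) (w + k)) u"
    unfolding return_prob_def using assms by (intro iter_translate) auto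
  also have "\<dots> = iter \<Lambda> n (hit_op (delta l)) u"
  proof (rule iter_cong[OF _ assms(1)])
    have "(\<lambda>w. delta (l + k) (w + k)) = delta l" by (simp add: delta_def fun_eq_iff)
    then show "hit_op (delta (l + k)) (w + k) = hit_op (delta l) w" if "w \<in> V" for w
      by (simp only: hit_op_translate[OF assms(2) that])
  qed
  finally show ?thesis by (simp only: return_prob_def)
qed

lemma return_prob_has_sum:
  "u \<in> V \<Longrightarrow> ((\<lambda>l. of_real (return_prob n u l) * lchar x l) has_sum return_phase x n u) \<Lambda>"
proof (induction n arbitrary: u)
  case (0 u)
  have "((\<lambda>l. of_real (return_prob 0 u l) * lchar x l) has_sum return_phase x 0 u) \<Lambda> \<longleftrightarrow>
      ((\<lambda>l. of_real (P u l) * lchar x l) has_sum return_phase x 0 u) (nbrs u \<inter> \<Lambda>)"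
    using 0 by (intro has_sum_cong_neutral) (auto simp: return_prob_0)
  also have "\<dots>"
    using 0 by (intro has_sum_finiteI) (simp_all add: return_phase_def hit_op_def scaleR_conv_of_real)
  finally show ?case .
next
  case (Suc n u)
  have "((\<lambda>l. \<Sum>w\<in>nbrs u - \<Lambda>. of_real (P u w) * (of_real (return_prob n w l) * lchar x l)) has_sum
      (\<Sum>w\<in>nbrs u - \<Lambda>. of_real (P u w) * return_phase x n w)) \<Lambda>"
    using Suc by (intro has_sum_finite_sum has_sum_cmult_right) (auto simp: nbrs_sub)
  moreover have "(\<Sum>w\<in>nbrs u - \<Lambda>. of_real (P u w) * (of_real (return_prob n w l) * lchar x l)) =
      of_real (return_prob (Suc n) u l) * lchar x l" for l
    by (simp add: return_prob_Suc sum_distrib_right mult.assoc)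
  moreover have "(\<Sum>w\<in>nbrs u - \<Lambda>. of_real (P u w) * return_phase x n w) = return_phase x (Suc n) u"
    by (simp add: return_phase_def walk_op_def scaleR_conv_of_real)
  ultimately show ?case by simp
qed

definition rho :: "real ^ 'n \<Rightarrow> real" where
  "rho l = (\<Sum>n. return_prob n 0 l)"

lemma return_prob_summable: "summable (\<lambda>n. return_prob n 0 l)"
proof (rule summable_comparison_test'[OF return_phase_summable(2)[OF origin]])
  show "norm (return_prob n 0 l) \<le> hit_mass n 0" for n
    using return_prob_le[OF origin, of n l] return_prob_nonneg[OF origin, of n l] by (simp only: real_norm_def abs_of_nonneg)
qed

lemma rho_nonneg: "0 \<le> rho l"
  unfolding rho_def using origin by (intro suminf_nonneg return_prob_summable) auto

lemma return_prob_le_rho: "return_prob n 0 l \<le> rho l"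
  unfolding rho_def using origin sum_le_suminf[OF return_prob_summable, of "{n}"] by simp

abbreviation rhohat :: "real ^ 'n \<Rightarrow> complex" where
  "rhohat x \<equiv> return_transform x 0"

text \<open>The left hand side sums over times first and the transform over positions first; absolute
  summability permits the exchange.\<close>

lemma rho_has_sum: "((\<lambda>l. of_real (rho l) * lchar x l) has_sum rhohat x) \<Lambda>"
proof -
  define F where "F = (\<lambda>(n, l). complex_of_real (return_prob n 0 l) * lchar x l)"
  have "(\<lambda>(n, l). return_prob n 0 l) summable_on (UNIV \<times> \<Lambda>)"
  proof (rule summable_on_SigmaI)
    fix n
    show "((\<lambda>l. case (n, l) of (n, l) \<Rightarrow> return_prob n 0 l) has_sum Re (return_phase 0 n 0)) \<Lambda>"
      using has_sum_Re[OF return_prob_has_sum[OF origin, of n 0]] by simp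
  next
    have "summable (\<lambda>n. norm (Re (return_phase 0 n 0)))"
      by (rule summable_comparison_test'[OF return_phase_summable(1)[OF origin, of 0]])
        (simp add: abs_Re_le_cmod)
    then show "(\<lambda>n. Re (return_phase 0 n 0)) summable_on UNIV"
      by (rule norm_summable_imp_summable_on)
  qed (use origin in auto)
  also have "(\<lambda>(n, l). return_prob n 0 l) = (\<lambda>p. norm (F p))"
    using origin by (auto simp: F_def norm_mult fun_eq_iff)
  finally have F: "F summable_on (UNIV \<times> \<Lambda>)" by (rule abs_summable_summable)
  have "(F has_sum rhohat x) (UNIV \<times> \<Lambda>)"
  proof (rule has_sum_SigmaI[OF _ _ F])
    show "((\<lambda>l. F (n, l)) has_sum return_phase x n 0) \<Lambda>" for n
      using return_prob_has_sum[OF origin] by (simp add: F_def)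
    show "((\<lambda>n. return_phase x n 0) has_sum rhohat x) UNIV"
      unfolding return_transform_def
      by (rule norm_summable_imp_has_sum[OF return_phase_summable(1)[OF origin]
            summable_sums[OF summable_norm_cancel[OF return_phase_summable(1)[OF origin]]]])
  qed
  then have "((F \<circ> prod.swap) has_sum rhohat x) (\<Lambda> \<times> UNIV)"
    by (subst has_sum_reindex[symmetric]) (auto simp: product_swap)
  then have "((\<lambda>(l, n). complex_of_real (return_prob n 0 l) * lchar x l) has_sum rhohat x) (\<Lambda> \<times> UNIV)"
    by (simp add: F_def o_def case_prod_unfold)
  then show ?thesis
  proof (rule has_sum_SigmaD)
    fix l
    have "((\<lambda>n. return_prob n 0 l) has_sum rho l) UNIV"
      unfolding rho_def using origin by (intro sums_nonneg_imp_has_sum summable_sums return_prob_summable) auto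
    then have "((\<lambda>n. complex_of_real (return_prob n 0 l)) has_sum of_real (rho l)) UNIV"
      by (rule has_sum_of_real)
    then show "((\<lambda>n. case (l, n) of (l, n) \<Rightarrow> complex_of_real (return_prob n 0 l) * lchar x l) has_sum
        of_real (rho l) * lchar x l) UNIV"
      by (simp add: has_sum_cmult_left)
  qed
qed

section \<open>The renewal identity\<close>

text \<open>The expected phase at the first visit to the lattice, where a visit at time zero counts.\<close>

definition hit_phase :: "real ^ 'n \<Rightarrow> real ^ 'n \<Rightarrow> complex" where
  "hit_phase x u = (if u \<in> \<Lambda> then lchar x u else return_transform x u)"

definition lattice_phase :: "real ^ 'n \<Rightarrow> real ^ 'n \<Rightarrow> complex" where
  "lattice_phase x u = (if u \<in> \<Lambda> then lchar x u else 0)"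

lemma quasi_periodic_hit_phase: "quasi_periodic x (hit_phase x)"
  using quasi_periodic_return_transform[of x] lattice_add_iff by (auto simp: quasi_periodic_def hit_phase_def lchar_add)

lemma norm_hit_phase_le_1: "u \<in> V \<Longrightarrow> norm (hit_phase x u) \<le> 1"
  using norm_return_transform_le_1 by (simp add: hit_phase_def)

lemma op_hit_phase:
  assumes u: "u \<in> V"
  shows "walk_op {} (hit_phase x) u = return_transform x u"
proof -
  have sm: "summable (\<lambda>n. return_phase x n w)" if "w \<in> V" for w
    by (rule summable_norm_cancel[OF return_phase_summable(1)[OF that]])
  have "hit_op (hit_phase x) u = return_phase x 0 u"
    by (simp add: hit_op_def hit_phase_def return_phase_def)
  moreover have "walk_op \<Lambda> (hit_phase x) u = (\<Sum>w\<in>nbrs u - \<Lambda>. \<Sum>n. P u w *\<^sub>R return_phase x n w)"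
    unfolding walk_op_def
    by (intro sum.cong refl) (auto simp: hit_phase_def return_transform_def nbrs_sub intro!: suminf_scaleR_right sm)
  moreover have "\<dots> = (\<Sum>n. \<Sum>w\<in>nbrs u - \<Lambda>. P u w *\<^sub>R return_phase x n w)"
    by (rule suminf_sum[symmetric]) (auto intro!: summable_scaleR_right sm nbrs_sub)
  moreover have "\<dots> = (\<Sum>n. return_phase x (Suc n) u)"
    by (simp add: return_phase_def walk_op_def)
  moreover have "return_transform x u = (\<Sum>n. return_phase x (Suc n) u) + return_phase x 0 u"
    unfolding return_transform_def by (subst suminf_split_head[OF sm[OF u]]) simp
  ultimately show ?thesis using op_split[OF u, of "hit_phase x"] by simp
qed

text \<open>Averaging the hitting phase over one step reproduces it off the lattice and multiplies it by the
  return symbol on the lattice.\<close>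

lemma op_hit_phase_renewal:
  assumes u: "u \<in> V"
  shows "walk_op {} (hit_phase x) u = hit_phase x u + (rhohat x - 1) * lattice_phase x u"
proof (cases "u \<in> \<Lambda>")
  case True
  then have "return_transform x (0 + u) = lchar x u * return_transform x 0"
    using quasi_periodic_return_transform origin unfolding quasi_periodic_def by blast
  then show ?thesis using True by (simp add: op_hit_phase[OF u] hit_phase_def lattice_phase_def algebra_simps)
qed (simp add: op_hit_phase[OF u] hit_phase_def lattice_phase_def)

definition green_partial :: "real ^ 'n \<Rightarrow> nat \<Rightarrow> complex" where
  "green_partial x N = (\<Sum>n<N. iter {} n (lattice_phase x) 0)"

text \<open>Every further step produces one more term of the Green function, multiplied by the deficit
  \<open>1 - \<rho>\<close>.\<close>

lemma renewal:
  "iter {} N (hit_phase x) 0 = 1 - (1 - rhohat x) * green_partial x N"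
proof (induction N)
  case 0
  then show ?case by (simp add: hit_phase_def green_partial_def)
next
  case (Suc N)
  have "iter {} (Suc N) (hit_phase x) 0 = iter {} N (walk_op {} (hit_phase x)) 0"
    using iter_add[where k = N and n = 1 and A = "{}" and f = "hit_phase x"] by simp
  also have "\<dots> = iter {} N (\<lambda>u. hit_phase x u + (rhohat x - 1) * lattice_phase x u) 0"
    by (rule iter_cong[OF op_hit_phase_renewal origin])
  also have "\<dots> = iter {} N (hit_phase x) 0 + (rhohat x - 1) * iter {} N (lattice_phase x) 0"
    by (simp only: iter_plus iter_mult_left)
  finally show ?case using Suc by (simp add: green_partial_def algebra_simps)
qed

text \<open>The hitting phase has modulus at most one.  This gives the dominating function for all truncations at
  once, in particular when the series for the Green function does not converge absolutely.\<close>

lemma green_partial_bound: "norm (1 - rhohat x) * norm (green_partial x N) \<le> 2"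
proof -
  have "(1 - rhohat x) * green_partial x N = 1 - iter {} N (hit_phase x) 0"
    using renewal[of N x] by simp
  then have "norm ((1 - rhohat x) * green_partial x N) \<le> 1 + norm (iter {} N (hit_phase x) 0)"
    using norm_triangle_ineq4[of 1 "iter {} N (hit_phase x) 0"] by simp
  also have "norm (iter {} N (hit_phase x) 0) \<le> 1"
    by (rule norm_iter_le_const(2)[OF norm_hit_phase_le_1 origin])
  finally show ?thesis by (simp add: norm_mult)
qed

lemma green_partial_tendsto:
  assumes "2 *\<^sub>R x \<notin> integer_vectors" "1 - rhohat x \<noteq> 0"
  shows "green_partial x \<longlonglongrightarrow> 1 / (1 - rhohat x)"
proof -
  have "(\<lambda>N. (1 - iter {} N (hit_phase x) 0) / (1 - rhohat x)) \<longlonglongrightarrow> (1 - 0) / (1 - rhohat x)"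
    by (intro tendsto_intros free_walk_decay[OF assms(1) quasi_periodic_hit_phase origin] assms(2))
  then show ?thesis using assms(2) by (simp add: renewal)
qed

section \<open>The return symbol away from the integer points\<close>

text \<open>The return distribution has mass at most one, so the deficit is at least the sum of the nonnegative
  terms on the left, of which one is kept.\<close>

lemma Re_return_deficit:
  assumes l: "l \<in> \<Lambda>"
  shows "rho l * (1 - Re (lchar x l)) \<le> Re (1 - rhohat x)"
proof -
  have one: "((\<lambda>l. rho l) has_sum Re (rhohat 0)) \<Lambda>"
    using has_sum_Re[OF rho_has_sum[of 0]] by simp
  have "((\<lambda>l. rho l + (- 1) * Re (of_real (rho l) * lchar x l)) has_sum
      (Re (rhohat 0) + (- 1) * Re (rhohat x))) \<Lambda>"
    by (intro has_sum_add one has_sum_cmult_right has_sum_Re rho_has_sum)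
  then have "((\<lambda>l. rho l * (1 - Re (lchar x l))) has_sum (Re (rhohat 0) - Re (rhohat x))) \<Lambda>"
    by (simp add: algebra_simps)
  moreover have "Re (lchar x l) \<le> 1" for l
    using complex_Re_le_cmod[of "lchar x l"] by simp
  then have "0 \<le> rho l * (1 - Re (lchar x l))" for l
    by (simp add: rho_nonneg)
  ultimately have "sum (\<lambda>l. rho l * (1 - Re (lchar x l))) {l} \<le> Re (rhohat 0) - Re (rhohat x)"
    using l by (intro finite_sum_le_has_sum) auto
  moreover have "Re (rhohat 0) \<le> 1"
    using norm_return_transform_le_1[OF origin, of 0] complex_Re_le_cmod[of "rhohat 0"] by linarith
  ultimately show ?thesis by simp
qed

text \<open>The deficit of the return symbol controls the deviation of the character at \<open>l\<close> from one, uniformly in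
  the frequency.  Possible returns are detected, and the triangle inequality makes the detected
  vectors a semigroup.\<close>

definition detected :: "real ^ 'n \<Rightarrow> bool" where
  "detected l \<longleftrightarrow> (\<exists>c>0. \<forall>x. c * (norm (lchar x l - 1))\<^sup>2 \<le> Re (1 - rhohat x))"

lemma Re_deficit_nonneg: "0 \<le> Re (1 - rhohat x)"
  using norm_return_transform_le_1[OF origin, of x] complex_Re_le_cmod[of "rhohat x"] by simp

lemma norm_unit_minus_1: "norm z = 1 \<Longrightarrow> (norm (z - 1))\<^sup>2 = 2 * (1 - Re z)" for z :: complex
proof -
  assume "norm z = 1"
  then have "(Re z)\<^sup>2 + (Im z)\<^sup>2 = 1" by (simp add: cmod_power2[symmetric])
  moreover have "(norm (z - 1))\<^sup>2 = (Re z - 1)\<^sup>2 + (Im z)\<^sup>2" by (simp add: cmod_power2)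
  ultimately show ?thesis by (simp add: power2_eq_square algebra_simps)
qed

lemma detected_return:
  assumes l: "l \<in> \<Lambda>" and pos: "return_prob n 0 l > 0"
  shows "detected l"
  unfolding detected_def
proof (intro exI conjI allI)
  show "rho l / 2 > 0" using pos return_prob_le_rho[of n l] by simp
  show "rho l / 2 * (norm (lchar x l - 1))\<^sup>2 \<le> Re (1 - rhohat x)" for x
    using Re_return_deficit[OF l, of x] unfolding norm_unit_minus_1[OF norm_torus_char]
    by (simp add: algebra_simps)
qed

lemma detected_zero: "detected 0"
  unfolding detected_def using Re_deficit_nonneg by (intro exI[of _ 1]) auto

lemma detected_add:
  assumes "detected k" "detected l"
  shows "detected (k + l)"
proof -
  obtain a b where a: "a > 0" "\<And>x. a * (norm (lchar x k - 1))\<^sup>2 \<le> Re (1 - rhohat x)"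
    and b: "b > 0" "\<And>x. b * (norm (lchar x l - 1))\<^sup>2 \<le> Re (1 - rhohat x)"
    using assms unfolding detected_def by blast
  define c where "c = min a b / 4"
  have "c * (norm (lchar x (k + l) - 1))\<^sup>2 \<le> Re (1 - rhohat x)" for x
  proof -
    define p q where "p = norm (lchar x k - 1)" and "q = norm (lchar x l - 1)"
    have eq: "lchar x (k + l) - 1 = lchar x k * (lchar x l - 1) + (lchar x k - 1)"
      by (simp add: lchar_add algebra_simps)
    have "norm (lchar x (k + l) - 1) \<le> norm (lchar x k * (lchar x l - 1)) + norm (lchar x k - 1)"
      unfolding eq by (rule norm_triangle_ineq)
    then have "norm (lchar x (k + l) - 1) \<le> q + p"
      by (simp add: norm_mult p_def q_def)
    then have "(norm (lchar x (k + l) - 1))\<^sup>2 \<le> (q + p)\<^sup>2" by (rule power_mono) simp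
    also have "\<dots> \<le> 2 * p\<^sup>2 + 2 * q\<^sup>2"
      using zero_le_power2[of "p - q"] by (simp add: power2_eq_square algebra_simps)
    finally have "c * (norm (lchar x (k + l) - 1))\<^sup>2 \<le> c * (2 * p\<^sup>2 + 2 * q\<^sup>2)"
      using a(1) b(1) by (intro mult_left_mono) (auto simp: c_def)
    also have "\<dots> = (min a b * p\<^sup>2 + min a b * q\<^sup>2) / 2" by (simp add: c_def algebra_simps)
    also have "\<dots> \<le> (a * p\<^sup>2 + b * q\<^sup>2) / 2"
      by (intro divide_right_mono add_mono mult_right_mono) auto
    also have "\<dots> \<le> Re (1 - rhohat x)" using a(2)[of x] b(2)[of x] by (simp add: p_def q_def)
    finally show ?thesis .
  qed
  moreover have "c > 0" using a b by (simp add: c_def)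
  ultimately show ?thesis unfolding detected_def by blast
qed

text \<open>Cut the path at its first visit to the lattice at a positive time.\<close>

lemma first_return_split:
  assumes "u \<in> V" "l \<in> \<Lambda>" "walk_prob (Suc n) u l > 0"
  shows "\<exists>k\<le>n. \<exists>l'\<in>\<Lambda>. return_prob k u l' > 0 \<and> walk_prob (n - k) l' l > 0"
  using assms(1,3)
proof (induction n arbitrary: u)
  case (0 u)
  from 0(2) have "l \<in> nbrs u"
    by (subst (asm) iter_Suc_pos) (use 0(1) in \<open>auto simp: delta_def split: if_splits\<close>)
  then show ?case
    using assms(2) P_pos[OF 0(1)] 0(1) by (intro exI[of _ 0]) (auto simp: return_prob_0 delta_def intro!: bexI[of _ l])
next
  case (Suc n u)
  from Suc.prems obtain w where w: "w \<in> nbrs u" "walk_prob (Suc n) w l > 0"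
    by (subst (asm) iter_Suc_pos) auto
  show ?case
  proof (cases "w \<in> \<Lambda>")
    case True
    then show ?thesis
      using w P_pos[OF Suc.prems(1) w(1)] Suc.prems(1)
      by (intro exI[of _ 0]) (auto simp: return_prob_0 simp del: funpow.simps intro!: bexI[of _ w])
  next
    case False
    obtain k l' where k: "k \<le> n" "l' \<in> \<Lambda>" "return_prob k w l' > 0" "walk_prob (n - k) l' l > 0"
      using Suc.IH[OF nbrs_sub[OF w(1)] w(2)] by blast
    have "0 < P u w * return_prob k w l'" using P_pos[OF Suc.prems(1) w(1)] k by simp
    then have "return_prob (Suc k) u l' > 0"
      unfolding return_prob_Suc using w False Suc.prems(1) by (intro sum_pos2[of _ w]) (auto simp: nbrs_sub)
    then show ?thesis using k by (intro exI[of _ "Suc k"]) auto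
  qed
qed

lemma detected_path:
  "l0 \<in> \<Lambda> \<Longrightarrow> l \<in> \<Lambda> \<Longrightarrow> walk_prob n l0 l > 0 \<Longrightarrow> detected (l - l0)"
proof (induction n arbitrary: l0 rule: less_induct)
  case (less n l0)
  show ?case
  proof (cases n)
    case 0
    then show ?thesis using less.prems detected_zero by (auto simp: delta_def split: if_splits)
  next
    case (Suc n')
    have "l0 \<in> V" using less.prems lattice_sub by blast
    then obtain k l' where k: "k \<le> n'" "l' \<in> \<Lambda>" "return_prob k l0 l' > 0" "walk_prob (n' - k) l' l > 0"
      using first_return_split[of l0 l n'] less.prems Suc by blast
    have "return_prob k 0 (l' - l0) > 0"
      using return_prob_translate[OF origin less.prems(1), of k "l' - l0"] k by simp
    then have "detected (l' - l0)" using detected_return lattice_diff less.prems k by blast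
    moreover have "detected (l - l')"
      using less.IH[of "n' - k" l'] k less.prems Suc by simp
    ultimately show ?thesis using detected_add by fastforce
  qed
qed

lemma detected_all: "l \<in> \<Lambda> \<Longrightarrow> detected l"
  using path_exists[OF origin, of l] detected_path[of 0 l] lattice_sub by auto

text \<open>Every lattice vector is a sum of possible returns by connectedness, hence detected; this is applied to
  the vectors of the lattice that correspond to the coordinate axes.\<close>

lemma return_symbol_lower_bound:
  obtains c where "c > 0" "\<And>x. c * (torus_norm x)\<^sup>2 \<le> norm (1 - rhohat x)"
proof -
  have "\<exists>c>0. \<forall>x. c * (sin (pi * x $ i))\<^sup>2 \<le> Re (1 - rhohat x)" for i
  proof -
    obtain l where l: "l \<in> \<Lambda>" "L l = axis i 1"
      using L_image integer_vectors_simps(2)[of i] by (metis imageE)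
    obtain c where c: "c > 0" "\<And>x. c * (norm (lchar x l - 1))\<^sup>2 \<le> Re (1 - rhohat x)"
      using detected_all[OF l(1)] unfolding detected_def by blast
    have "(norm (lchar x l - 1))\<^sup>2 = 4 * (sin (pi * x $ i))\<^sup>2" for x
      unfolding l(2) norm_torus_char_axis_minus_1 by (simp add: power_mult_distrib)
    then show ?thesis using c by (intro exI[of _ "c * 4"]) (simp add: mult.assoc)
  qed
  then obtain c where c: "\<And>i. c i > 0" "\<And>i x. c i * (sin (pi * x $ i))\<^sup>2 \<le> Re (1 - rhohat x)"
    by metis
  define c0 where "c0 = Min (range c)"
  have c0: "c0 > 0" "c0 \<le> c i" for i using c(1) by (auto simp: c0_def)
  let ?d = "real CARD('n)"
  have "c0 / ?d\<^sup>2 * (torus_norm x)\<^sup>2 \<le> norm (1 - rhohat x)" for x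
  proof -
    have "(torus_norm x)\<^sup>2 \<le> ?d * (\<Sum>i\<in>UNIV. (sin (pi * x $ i))\<^sup>2)"
      using sum_squared_le_sum_of_squares[of "\<lambda>i. \<bar>sin (pi * x $ i)\<bar>" UNIV] unfolding torus_norm_def
      by (simp add: mult.commute)
    then have "c0 * (torus_norm x)\<^sup>2 \<le> c0 * (?d * (\<Sum>i\<in>UNIV. (sin (pi * x $ i))\<^sup>2))"
      using c0(1) by (intro mult_left_mono) auto
    also have "\<dots> = ?d * (\<Sum>i\<in>UNIV. c0 * (sin (pi * x $ i))\<^sup>2)"
      by (simp add: sum_distrib_left mult_ac)
    also have "\<dots> \<le> ?d * (\<Sum>i\<in>(UNIV :: 'n set). Re (1 - rhohat x))"
    proof (intro mult_left_mono sum_mono)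
      fix i
      have "c0 * (sin (pi * x $ i))\<^sup>2 \<le> c i * (sin (pi * x $ i))\<^sup>2"
        by (intro mult_right_mono c0) auto
      then show "c0 * (sin (pi * x $ i))\<^sup>2 \<le> Re (1 - rhohat x)" using c(2)[of i x] by linarith
    qed auto
    also have "\<dots> = ?d\<^sup>2 * Re (1 - rhohat x)" by (simp add: power2_eq_square)
    also have "\<dots> \<le> ?d\<^sup>2 * norm (1 - rhohat x)"
      by (intro mult_left_mono complex_Re_le_cmod) auto
    finally show ?thesis by (simp add: field_simps)
  qed
  moreover have "c0 / ?d\<^sup>2 > 0" using c0(1) by simp
  ultimately show ?thesis using that by blast
qed

section \<open>The matrix of the walk acts on quasi-periodic functions\<close>

text \<open>The monomial of the cube that contains \<open>u\<close>.  The weight of an edge is the quotient of the phases at its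
  end points, so that weights telescope along paths.\<close>

definition phase :: "real ^ 'n \<Rightarrow> real ^ 'n \<Rightarrow> complex" where
  "phase x u = (\<Prod>i\<in>UNIV. unit_phases x i powi \<lfloor>L u $ i\<rfloor>)"

abbreviation walk_matrix :: "real ^ 'n \<Rightarrow> complex mat" where
  "walk_matrix x \<equiv> quotient_matrix \<Lambda> L V E m v (unit_phases x)"

lemma unit_phases_nonzero: "unit_phases x i \<noteq> 0"
  by (simp add: unit_phases_def)

lemma phase_nonzero: "phase x u \<noteq> 0"
  by (simp add: phase_def unit_phases_nonzero power_int_eq_0_iff)

lemma edge_weight_phase: "edge_weight L (unit_phases x) u w = phase x w / phase x u"
  by (simp add: edge_weight_def phase_def prod_dividef[symmetric] power_int_diff unit_phases_nonzero)

lemma unit_phases_prod: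
  fixes n :: "'n \<Rightarrow> int"
  shows "(\<Prod>i\<in>UNIV. unit_phases x i powi n i) = torus_char (\<chi> i. of_int (n i)) x"
proof -
  have "unit_phases x i = cis (- (2 * pi * x $ i))" for i
    by (simp add: unit_phases_def cis_conv_exp mult_ac)
  then show ?thesis by (simp add: torus_char_prod cis_power_int mult_ac)
qed

lemma quasi_periodic_phase: "quasi_periodic x (phase x)"
  unfolding quasi_periodic_def
proof (intro ballI)
  fix u l assume l: "l \<in> \<Lambda>"
  have Ll: "L l $ i = of_int \<lfloor>L l $ i\<rfloor>" for i
    using l by (simp add: lattice_mem_iff floor_integer_vector)
  have "\<lfloor>L (u + l) $ i\<rfloor> = \<lfloor>L u $ i\<rfloor> + \<lfloor>L l $ i\<rfloor>" for i
    by (subst L_add, simp, subst Ll, simp)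
  then have "phase x (u + l) = phase x u * (\<Prod>i\<in>UNIV. unit_phases x i powi \<lfloor>L l $ i\<rfloor>)"
    by (simp add: phase_def power_int_add unit_phases_nonzero prod.distrib)
  also have "(\<chi> i. of_int \<lfloor>L l $ i\<rfloor>) = L l"
    using Ll by (simp add: Finite_Cartesian_Product.vec_eq_iff)
  then have "(\<Prod>i\<in>UNIV. unit_phases x i powi \<lfloor>L l $ i\<rfloor>) = lchar x l"
    by (simp add: unit_phases_prod)
  finally show "phase x (u + l) = lchar x l * phase x u" by simp
qed

lemma walk_matrix_carrier: "walk_matrix x \<in> carrier_mat (m + 1) (m + 1)"
  by (simp add: quotient_matrix_def)

lemma walk_matrix_index:
  assumes "i \<le> m" "j \<le> m"
  shows "walk_matrix x $$ (i, j) = (\<Sum>w\<in>{w \<in> nbrs (v i). w - v j \<in> \<Lambda>}. of_real (P (v i) w) * (phase x w / phase x (v i)))"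
proof -
  let ?S = "{w \<in> nbrs (v i). w - v j \<in> \<Lambda>}"
  let ?g = "\<lambda>w. edge_weight L (unit_phases x) (v i) w / of_nat (vertex_degree E (v i))"
  have S: "{(e, w). e \<in> edges_between V E (v i) w \<and> w - v j \<in> \<Lambda>} =
      prod.swap ` (SIGMA w:?S. edges_between V E (v i) w)"
    using nbrs_iff by (force simp: image_iff)
  have "walk_matrix x $$ (i, j) = (\<Sum>(e, w)\<in>{(e, w). e \<in> edges_between V E (v i) w \<and> w - v j \<in> \<Lambda>}. ?g w)"
    using assms by (simp add: quotient_matrix_def)
  also have "\<dots> = (\<Sum>(w, e)\<in>(SIGMA w:?S. edges_between V E (v i) w). ?g w)"
    unfolding S by (subst sum.reindex) (auto simp: case_prod_unfold)
  also have "\<dots> = (\<Sum>w\<in>?S. \<Sum>e\<in>edges_between V E (v i) w. ?g w)"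
    by (rule sum.Sigma[symmetric]) (auto simp: rep_V assms finite_edges_between)
  also have "\<dots> = (\<Sum>w\<in>?S. of_real (P (v i) w) * (phase x w / phase x (v i)))"
    by (intro sum.cong refl) (simp add: edge_weight_phase srw_kernel_def)
  finally show ?thesis .
qed

lemma rep_unique:
  assumes "u \<in> V" "i \<le> m" "u - v i \<in> \<Lambda>" "j \<le> m" "u - v j \<in> \<Lambda>"
  shows "i = j"
  using reps assms unfolding orbit_representatives_def by blast

text \<open>Division by the phase makes a quasi-periodic function constant on congruence classes, which is how
  the sum over neighbours becomes a sum over representatives.\<close>

lemma walk_matrix_action:
  assumes f: "quasi_periodic x f" and i: "i \<le> m" and J: "J \<subseteq> {..m}"
  shows "(\<Sum>w\<in>{w \<in> nbrs (v i). \<exists>j\<in>J. w - v j \<in> \<Lambda>}. P (v i) w *\<^sub>R f w) =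
    phase x (v i) * (\<Sum>j\<in>J. walk_matrix x $$ (i, j) * (f (v j) / phase x (v j)))"
proof -
  have fin: "finite J" using J finite_subset by blast
  have "{w \<in> nbrs (v i). \<exists>j\<in>J. w - v j \<in> \<Lambda>} = (\<Union>j\<in>J. {w \<in> nbrs (v i). w - v j \<in> \<Lambda>})" by blast
  also have "(\<Sum>w\<in>\<dots>. P (v i) w *\<^sub>R f w) = (\<Sum>j\<in>J. \<Sum>w\<in>{w \<in> nbrs (v i). w - v j \<in> \<Lambda>}. P (v i) w *\<^sub>R f w)"
  proof (rule sum.UNION_disjoint[OF fin])
    show "\<forall>j\<in>J. finite {w \<in> nbrs (v i). w - v j \<in> \<Lambda>}" using rep_V[OF i] by simp
    show "\<forall>j\<in>J. \<forall>j'\<in>J. j \<noteq> j' \<longrightarrow>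
        {w \<in> nbrs (v i). w - v j \<in> \<Lambda>} \<inter> {w \<in> nbrs (v i). w - v j' \<in> \<Lambda>} = {}"
      using J rep_unique nbrs_sub by blast
  qed
  also have "\<dots> = (\<Sum>j\<in>J. phase x (v i) * (walk_matrix x $$ (i, j) * (f (v j) / phase x (v j))))"
  proof (rule sum.cong[OF refl])
    fix j assume "j \<in> J"
    then have j: "j \<le> m" using J by blast
    have fw: "f w = phase x w * (f (v j) / phase x (v j))" if "w - v j \<in> \<Lambda>" for w
    proof -
      have "f (v j + (w - v j)) = lchar x (w - v j) * f (v j)"
        "phase x (v j + (w - v j)) = lchar x (w - v j) * phase x (v j)"
        using f quasi_periodic_phase that rep_V[OF j] unfolding quasi_periodic_def by blast+
      then show ?thesis using phase_nonzero[of x "v j"] by simp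
    qed
    have "(\<Sum>w\<in>{w \<in> nbrs (v i). w - v j \<in> \<Lambda>}. P (v i) w *\<^sub>R f w) =
        (\<Sum>w\<in>{w \<in> nbrs (v i). w - v j \<in> \<Lambda>}. of_real (P (v i) w) * (phase x w * (f (v j) / phase x (v j))))"
      by (intro sum.cong refl) (subst fw, simp, simp add: scaleR_conv_of_real)
    also have "\<dots> = phase x (v i) * (walk_matrix x $$ (i, j) * (f (v j) / phase x (v j)))"
      unfolding walk_matrix_index[OF i j] sum_distrib_left sum_distrib_right
      by (intro sum.cong refl) (simp add: phase_nonzero)
    finally show "(\<Sum>w\<in>{w \<in> nbrs (v i). w - v j \<in> \<Lambda>}. P (v i) w *\<^sub>R f w) =
        phase x (v i) * (walk_matrix x $$ (i, j) * (f (v j) / phase x (v j)))" .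
  qed
  finally show ?thesis by (simp add: sum_distrib_left)
qed

lemma rep_lattice_iff:
  assumes j: "j \<le> m" shows "v j \<in> \<Lambda> \<longleftrightarrow> j = 0"
proof
  assume "v j \<in> \<Lambda>"
  then show "j = 0"
    by (intro rep_unique[OF rep_V[OF j] j]) (simp_all add: rep_0)
qed (simp add: rep_0)

lemma op_killed_QM:
  assumes f: "quasi_periodic x f" and i: "i \<le> m"
  shows "walk_op \<Lambda> f (v i) = phase x (v i) * (\<Sum>j\<in>{1..m}. walk_matrix x $$ (i, j) * (f (v j) / phase x (v j)))"
proof -
  have "nbrs (v i) - \<Lambda> = {w \<in> nbrs (v i). \<exists>j\<in>{1..m}. w - v j \<in> \<Lambda>}"
  proof (intro equalityI subsetI)
    fix w assume w: "w \<in> nbrs (v i) - \<Lambda>"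
    then obtain j where j: "j \<le> m" "w - v j \<in> \<Lambda>" using rep_exists nbrs_sub by (metis DiffD1)
    then have "j \<noteq> 0" using w by (auto simp: rep_0 intro!: Nat.gr0I)
    then show "w \<in> {w \<in> nbrs (v i). \<exists>j\<in>{1..m}. w - v j \<in> \<Lambda>}" using w j by (auto intro!: bexI[of _ j])
  next
    fix w assume "w \<in> {w \<in> nbrs (v i). \<exists>j\<in>{1..m}. w - v j \<in> \<Lambda>}"
    then obtain j where j: "w \<in> nbrs (v i)" "j \<in> {1..m}" "w - v j \<in> \<Lambda>" by blast
    have "w \<notin> \<Lambda>" using rep_unique[of w j 0] j nbrs_sub by (auto simp: rep_0)
    then show "w \<in> nbrs (v i) - \<Lambda>" using j by blast
  qed
  then show ?thesis unfolding walk_op_def using walk_matrix_action[OF f i, of "{1..m}"] by simp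
qed

lemma op_free_QM:
  assumes f: "quasi_periodic x f" and i: "i \<le> m"
  shows "walk_op {} f (v i) = phase x (v i) * (walk_matrix x $$ (i, 0) * f 0 / phase x 0) + walk_op \<Lambda> f (v i)"
proof -
  have "nbrs (v i) \<inter> \<Lambda> = {w \<in> nbrs (v i). \<exists>j\<in>{0}. w - v j \<in> \<Lambda>}" by (auto simp: rep_0)
  then have "hit_op f (v i) = phase x (v i) * (walk_matrix x $$ (i, 0) * f 0 / phase x 0)"
    unfolding hit_op_def using walk_matrix_action[OF f i, of "{0}"] by (simp add: rep_0)
  then show ?thesis using op_split[OF rep_V[OF i], of f] by simp
qed

text \<open>A solution of the homogeneous system lifts to a bounded function that vanishes on the lattice
  and is fixed by the killed walk, hence is zero.\<close>

lemma killed_system_injective: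
  assumes f: "\<And>i. i \<in> {1..m} \<Longrightarrow> f i = (\<Sum>j\<in>{1..m}. walk_matrix x $$ (i, j) * f j)" and i: "i \<in> {1..m}"
  shows "f i = 0"
proof -
  define idx where "idx = (\<lambda>u. THE i. i \<le> m \<and> u - v i \<in> \<Lambda>)"
  have idx: "idx u = i" if "u \<in> V" "i \<le> m" "u - v i \<in> \<Lambda>" for u i
    unfolding idx_def using that rep_unique by blast
  define F where "F = (\<lambda>u. if u \<in> \<Lambda> then 0 else phase x u * f (idx u))"
  have qF: "quasi_periodic x F"
    unfolding quasi_periodic_def
  proof (intro ballI)
    fix u l assume u: "u \<in> V" and l: "l \<in> \<Lambda>"
    obtain i where i: "i \<le> m" "u - v i \<in> \<Lambda>" using rep_exists[OF u] by blast
    have "u + l - v i \<in> \<Lambda>" using lattice_add[OF i(2) l] by (simp add: algebra_simps)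
    then have "idx (u + l) = idx u" using idx[OF u i] idx[OF V_add[OF u l] i(1)] by simp
    then show "F (u + l) = lchar x l * F u"
      using quasi_periodic_phase u l lattice_add_iff[OF l] by (simp add: F_def quasi_periodic_def)
  qed
  have Fv: "F (v j) = phase x (v j) * f j" if "j \<in> {1..m}" for j
  proof -
    have "j \<le> m" "v j \<notin> \<Lambda>" using that rep_lattice_iff[of j] by auto
    moreover from this have "idx (v j) = j" by (intro idx rep_V) auto
    ultimately show ?thesis by (simp add: F_def)
  qed
  have fix_rep: "walk_op \<Lambda> F (v j) = F (v j)" if "j \<in> {1..m}" for j
  proof -
    have "walk_op \<Lambda> F (v j) = phase x (v j) * (\<Sum>k\<in>{1..m}. walk_matrix x $$ (j, k) * (F (v k) / phase x (v k)))"
      using that by (intro op_killed_QM qF) auto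
    also have "(\<Sum>k\<in>{1..m}. walk_matrix x $$ (j, k) * (F (v k) / phase x (v k))) = f j"
      unfolding f[OF that] by (intro sum.cong refl) (simp add: Fv phase_nonzero)
    finally show ?thesis using Fv[OF that] by simp
  qed
  have fixF: "walk_op \<Lambda> F u = F u" if u: "u \<in> V - \<Lambda>" for u
  proof -
    obtain j where j: "j \<le> m" "u - v j \<in> \<Lambda>" using rep_exists u by blast
    have "j \<in> {1..m}" using j u by (cases "j = 0") (auto simp: rep_0)
    moreover have "quasi_periodic x (walk_op \<Lambda> F)" using quasi_periodic_iter[OF _ qF, of \<Lambda> 1] by simp
    then have "walk_op \<Lambda> F (v j + (u - v j)) = lchar x (u - v j) * walk_op \<Lambda> F (v j)"
      using j rep_V unfolding quasi_periodic_def by blast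
    moreover have "F (v j + (u - v j)) = lchar x (u - v j) * F (v j)"
      using qF j rep_V unfolding quasi_periodic_def by blast
    ultimately show ?thesis using fix_rep by simp
  qed
  have iterF: "iter \<Lambda> n F u = F u" if "u \<in> V - \<Lambda>" for n u
    using that
  proof (induction n arbitrary: u)
    case (Suc n)
    have "iter \<Lambda> (Suc n) F u = walk_op \<Lambda> F u"
      unfolding iter_Suc walk_op_def[of \<Lambda> F] using Suc.IH by (intro sum.cong refl) (auto simp: nbrs_sub)
    then show ?case using fixF[OF Suc.prems] by simp
  qed simp
  define c where "c = (\<Sum>i\<le>m. norm (F (v i)))"
  have c: "norm (F u) \<le> c" if "u \<in> V" for u
    by (rule quasi_periodic_norm_le[OF qF _ that]) (auto simp: c_def intro!: member_le_sum)
  have c0: "c \<ge> 0" by (simp add: c_def sum_nonneg)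
  obtain d :: "nat \<Rightarrow> real" where d: "summable d" "\<And>n. 0 \<le> d n"
    "\<And>n u. u \<in> V \<Longrightarrow> killed_mass n u \<le> d n"
    using killed_mass_summable by blast
  have vi: "v i \<in> V - \<Lambda>" using i rep_V rep_lattice_iff[of i] by auto
  have "norm (F (v i)) \<le> c * d n" for n
  proof -
    have "norm (F (v i)) = norm (iter \<Lambda> n F (v i))" by (simp only: iterF[OF vi])
    also have "\<dots> \<le> c * iter \<Lambda> n (\<lambda>_. 1) (v i)"
      using c vi by (intro norm_iter_le_const(1)) auto
    also have "\<dots> \<le> c * d n" using d(3) vi c0 by (intro mult_left_mono) auto
    finally show ?thesis .
  qed
  moreover have "(\<lambda>n. c * d n) \<longlonglongrightarrow> c * 0"
    by (intro tendsto_mult_left summable_LIMSEQ_zero d)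
  ultimately have "norm (F (v i)) \<le> c * 0" by (intro LIMSEQ_le_const[of "\<lambda>n. c * d n"]) auto
  then show ?thesis using Fv[OF i] phase_nonzero[of x "v i"] by simp
qed

text \<open>The hitting phase at the representatives, divided by the phase, solves the system, and its average
  over one step from the origin is the transform of the return distribution.\<close>

theorem return_symbol_eq_rhohat:
  "invertible_mat (resolvent_base (walk_matrix x))" "return_symbol (walk_matrix x) = rhohat x"
proof -
  define w where "w = (\<lambda>j. hit_phase x (v j) / phase x (v j))"
  have p0: "phase x 0 = 1" by (simp add: phase_def)
  have h0: "hit_phase x 0 = 1" by (simp add: hit_phase_def)
  have key: "return_transform x (v i) / phase x (v i) = walk_matrix x $$ (i, 0) + (\<Sum>j\<in>{1..m}. walk_matrix x $$ (i, j) * w j)" if "i \<le> m" for i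
  proof -
    have "return_transform x (v i) = walk_op {} (hit_phase x) (v i)"
      using op_hit_phase[OF rep_V[OF that]] by simp
    also have "\<dots> = phase x (v i) * (walk_matrix x $$ (i, 0) + (\<Sum>j\<in>{1..m}. walk_matrix x $$ (i, j) * w j))"
      unfolding op_free_QM[OF quasi_periodic_hit_phase that] op_killed_QM[OF quasi_periodic_hit_phase that]
      by (simp add: p0 h0 w_def algebra_simps)
    finally show ?thesis using phase_nonzero[of x "v i"] by simp
  qed
  have sol: "w i = walk_matrix x $$ (i, 0) + (\<Sum>j\<in>{1..m}. walk_matrix x $$ (i, j) * w j)" if "i \<in> {1..m}" for i
    using key[of i] that rep_lattice_iff[of i] by (simp add: w_def hit_phase_def)
  show "invertible_mat (resolvent_base (walk_matrix x))"
  proof (rule return_symbol_eq_solution(1)[where w = w, OF walk_matrix_carrier])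
    show "f i = 0" if "\<And>i. i \<in> {1..m} \<Longrightarrow> f i = (\<Sum>j\<in>{1..m}. walk_matrix x $$ (i, j) * f j)" "i \<in> {1..m}" for f i
      using that by (rule killed_system_injective)
  qed (rule sol)
  have "return_symbol (walk_matrix x) = walk_matrix x $$ (0, 0) + (\<Sum>j\<in>{1..m}. walk_matrix x $$ (0, j) * w j)"
  proof (rule return_symbol_eq_solution(2)[where w = w, OF walk_matrix_carrier])
    show "f i = 0" if "\<And>i. i \<in> {1..m} \<Longrightarrow> f i = (\<Sum>j\<in>{1..m}. walk_matrix x $$ (i, j) * f j)" "i \<in> {1..m}" for f i
      using that by (rule killed_system_injective)
  qed (rule sol)
  then show "return_symbol (walk_matrix x) = rhohat x" using key[of 0] by (simp add: rep_0 p0)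
qed

section \<open>The return distribution of the process\<close>

primrec path_prob :: "(real ^ 'n) list \<Rightarrow> real ^ 'n \<Rightarrow> real" where
  "path_prob [] u = 1"
| "path_prob (w # ws) u = P u w * path_prob ws w"

primrec walks :: "nat \<Rightarrow> real ^ 'n \<Rightarrow> (real ^ 'n) list set" where
  "walks 0 u = {[]}"
| "walks (Suc n) u = (\<Union>w\<in>nbrs u. (#) w ` walks n w)"

lemma finite_walks: "u \<in> V \<Longrightarrow> finite (walks n u)"
  by (induction n arbitrary: u) (auto simp: nbrs_sub)

lemma length_walks: "ws \<in> walks n u \<Longrightarrow> length ws = n"
  by (induction n arbitrary: u ws) auto

lemma sum_walks_Suc:
  fixes F :: "(real ^ 'n) list \<Rightarrow> real"
  assumes "u \<in> V"
  shows "(\<Sum>ws\<in>walks (Suc n) u. F ws) = (\<Sum>w\<in>nbrs u. \<Sum>ws\<in>walks n w. F (w # ws))"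
proof -
  have "(\<Sum>ws\<in>walks (Suc n) u. F ws) = (\<Sum>w\<in>nbrs u. \<Sum>ws\<in>(#) w ` walks n w. F ws)"
    unfolding walks.simps
    by (rule sum.UNION_disjoint) (auto simp: assms finite_walks nbrs_sub)
  also have "\<dots> = (\<Sum>w\<in>nbrs u. \<Sum>ws\<in>walks n w. F (w # ws))"
    by (rule sum.cong[OF refl]) (simp add: sum.reindex inj_on_def)
  finally show ?thesis .
qed

lemma sum_path_prob: "u \<in> V \<Longrightarrow> (\<Sum>ws\<in>walks n u. path_prob ws u) = 1"
proof (induction n arbitrary: u)
  case (Suc n)
  then show ?case
    by (simp add: sum_walks_Suc sum_distrib_left[symmetric] nbrs_sub sum_P del: walks.simps(2))
qed simp

definition first_return_at :: "nat \<Rightarrow> real ^ 'n \<Rightarrow> (real ^ 'n) list \<Rightarrow> bool" where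
  "first_return_at n l ws \<longleftrightarrow> (\<forall>k<n. ws ! k \<notin> \<Lambda>) \<and> ws ! n = l"

lemma return_prob_eq_sum_walks:
  assumes l: "l \<in> \<Lambda>" and u: "u \<in> V"
  shows "return_prob n u l = (\<Sum>ws\<in>walks (Suc n) u. if first_return_at n l ws then path_prob ws u else 0)"
  using u
proof (induction n arbitrary: u)
  case (0 u)
  have "(\<Sum>ws\<in>walks (Suc 0) u. if first_return_at 0 l ws then path_prob ws u else 0) =
      (\<Sum>w\<in>nbrs u. if w = l then P u w else 0)"
    unfolding sum_walks_Suc[OF 0] by (rule sum.cong[OF refl]) (simp add: first_return_at_def)
  then show ?case using 0 l by (simp add: return_prob_0 sum.delta)
next
  case (Suc n u)
  have "(\<Sum>ws\<in>walks (Suc (Suc n)) u. if first_return_at (Suc n) l ws then path_prob ws u else 0) =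
      (\<Sum>w\<in>nbrs u. \<Sum>ws\<in>walks (Suc n) w. if w \<notin> \<Lambda> \<and> first_return_at n l ws then P u w * path_prob ws w else 0)"
    unfolding sum_walks_Suc[OF Suc.prems]
    by (simp add: first_return_at_def All_less_Suc2 del: walks.simps(2) cong: if_cong)
  also have "\<dots> = (\<Sum>w\<in>nbrs u. if w \<notin> \<Lambda> then P u w * return_prob n w l else 0)"
  proof (intro sum.cong refl)
    fix w assume w: "w \<in> nbrs u"
    have "(\<Sum>ws\<in>walks (Suc n) w. if first_return_at n l ws then P u w * path_prob ws w else 0) =
        P u w * (\<Sum>ws\<in>walks (Suc n) w. if first_return_at n l ws then path_prob ws w else 0)"
      unfolding sum_distrib_left by (intro sum.cong refl) auto
    then show "(\<Sum>ws\<in>walks (Suc n) w. if w \<notin> \<Lambda> \<and> first_return_at n l ws then P u w * path_prob ws w else 0) =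
        (if w \<notin> \<Lambda> then P u w * return_prob n w l else 0)"
      using Suc.IH[OF nbrs_sub[OF w]] by (simp del: walks.simps(2))
  qed
  also have "\<dots> = (\<Sum>w\<in>nbrs u - \<Lambda>. P u w * return_prob n w l)"
    using Suc.prems by (intro sum.mono_neutral_cong_right) auto
  finally show ?case by (simp only: return_prob_Suc)
qed

lemma path_prob_eq_prod: "path_prob ws u = (\<Prod>k<length ws. P ((u # ws) ! k) ((u # ws) ! Suc k))"
  by (induction ws arbitrary: u) (simp_all add: prod.lessThan_Suc_shift del: prod.lessThan_Suc)

lemma closed_lattice: "closed \<Lambda>"
proof -
  have "closed ((\<lambda>y. L y $ i) -` \<int>)" for i
  proof (rule closed_vimage[OF closed_Ints])
    show "continuous_on UNIV (\<lambda>y. L y $ i)"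
      using linear_continuous_on[of L UNIV] L_linear
      by (intro continuous_intros) (simp add: linear_conv_bounded_linear)
  qed
  then have "closed {y. \<forall>i. L y $ i \<in> \<int>}"
    by (intro closed_Collect_all) (simp add: vimage_def)
  moreover have "{y. \<forall>i. L y $ i \<in> \<int>} = \<Lambda>"
    using lattice_mem_iff by (auto simp: integer_vectors_def)
  ultimately show ?thesis by simp
qed

text \<open>Almost surely the process follows one of the finitely many walks of each length, so up to a null set
  the event of a first return at a given time is a finite disjoint union of cylinders.\<close>

lemma first_return_dist_eq_rho:
  fixes M :: "'w measure" and X :: "nat \<Rightarrow> 'w \<Rightarrow> real ^ 'n"
  assumes srw: "simple_random_walk V E 0 M X" and l: "l \<in> \<Lambda>"
  shows "first_return_dist \<Lambda> M X l = rho l"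
proof -
  interpret prob_space M using srw by (simp add: simple_random_walk_def)
  have X [measurable]: "X n \<in> borel_measurable M" for n
    using srw by (simp add: simple_random_walk_def)
  have fdd: "measure M {\<omega> \<in> space M. \<forall>k\<le>n. X k \<omega> = x k} =
      (if x 0 = 0 then \<Prod>k<n. P (x k) (x (Suc k)) else 0)" for n x
    using srw by (simp add: simple_random_walk_def)
  have Xset: "{\<omega> \<in> space M. X k \<omega> \<in> S} \<in> sets M" if "closed S" for k S
    using measurable_sets[OF X borel_closed[OF that], of k] by (simp add: vimage_def Int_def conj_commute)
  define cyl where "cyl = (\<lambda>ws. {\<omega> \<in> space M. \<forall>k\<le>length ws. X k \<omega> = (0 # ws) ! k})"
  have cyl_sets: "cyl ws \<in> sets M" for ws
  proof -
    have "cyl ws = (\<Inter>k\<in>{..length ws}. {\<omega> \<in> space M. X k \<omega> \<in> {(0 # ws) ! k}})"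
      by (auto simp: cyl_def)
    also have "\<dots> \<in> sets M" by (intro sets.finite_INT Xset) auto
    finally show ?thesis .
  qed
  have cyl_prob: "measure M (cyl ws) = path_prob ws 0" for ws
    unfolding cyl_def fdd by (simp add: path_prob_eq_prod)
  have cyl_eq: "ws = ws'" if "\<omega> \<in> cyl ws" "\<omega> \<in> cyl ws'" "length ws = length ws'" for ws ws' \<omega>
  proof (rule nth_equalityI[OF that(3)])
    fix k assume k: "k < length ws"
    have "X j \<omega> = (0 # ws) ! j" if "j \<le> length ws" for j
      using \<open>\<omega> \<in> cyl ws\<close> that unfolding cyl_def by blast
    moreover have "X j \<omega> = (0 # ws') ! j" if "j \<le> length ws'" for j
      using \<open>\<omega> \<in> cyl ws'\<close> that unfolding cyl_def by blast
    ultimately have "(0 # ws) ! Suc k = (0 # ws') ! Suc k"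
      using k that(3) by (metis Suc_leI)
    then show "ws ! k = ws' ! k" by simp
  qed
  have prob_Union: "measure M (\<Union>ws\<in>S. cyl ws) = (\<Sum>ws\<in>S. path_prob ws 0)" if "S \<subseteq> walks n 0" for S n
  proof -
    have "disjoint_family_on cyl S"
      unfolding disjoint_family_on_def
    proof (intro ballI impI)
      fix ws ws' assume "ws \<in> S" "ws' \<in> S" "ws \<noteq> ws'"
      moreover from this have "length ws = length ws'" using that length_walks by blast
      ultimately show "cyl ws \<inter> cyl ws' = {}" using cyl_eq by blast
    qed
    then show ?thesis
      using finite_subset[OF that finite_walks[OF origin]] cyl_sets
      by (subst finite_measure_finite_Union) (auto simp: cyl_prob)
  qed
  have AE_walk: "AE \<omega> in M. \<omega> \<in> (\<Union>ws\<in>walks n 0. cyl ws)" for n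
  proof (rule AE_prob_1)
    show "prob (\<Union>ws\<in>walks n 0. cyl ws) = 1"
      using prob_Union[OF order_refl] sum_path_prob[OF origin] by simp
  qed
  define A where "A = (\<lambda>n. {\<omega> \<in> space M. X (Suc n) \<omega> \<in> \<Lambda> \<and>
      (\<forall>k. 0 < k \<and> k < Suc n \<longrightarrow> X k \<omega> \<notin> \<Lambda>) \<and> X (Suc n) \<omega> = l})"
  have A_sets: "A n \<in> sets M" for n
  proof -
    have "A n = {\<omega> \<in> space M. X (Suc n) \<omega> \<in> {l}} \<inter> (\<Inter>k\<in>{..n}. space M - (if k = 0 then {} else {\<omega> \<in> space M. X k \<omega> \<in> \<Lambda>}))"
      using l by (auto simp: A_def less_Suc_eq_le split: if_splits)
    also have "\<dots> \<in> sets M"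
      by (intro sets.Int sets.finite_INT sets.Diff) (auto intro!: Xset closed_lattice)
    finally show ?thesis .
  qed
  have A_prob: "measure M (A n) = return_prob n 0 l" for n
  proof -
    define S where "S = {ws \<in> walks (Suc n) 0. first_return_at n l ws}"
    have "measure M (A n) = measure M (\<Union>ws\<in>S. cyl ws)"
    proof (rule finite_measure_eq_AE)
      show "AE \<omega> in M. (\<omega> \<in> A n) = (\<omega> \<in> (\<Union>ws\<in>S. cyl ws))"
        using AE_walk[of "Suc n"]
      proof eventually_elim
        case (elim \<omega>)
        then obtain ws where ws: "ws \<in> walks (Suc n) 0" "\<omega> \<in> cyl ws" by blast
        have len: "length ws = Suc n" using ws length_walks by blast
        have Xk: "X (Suc k) \<omega> = ws ! k" if "k \<le> n" for k
          using ws(2) that len by (auto simp: cyl_def)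
        have sp: "\<omega> \<in> space M" using ws(2) by (simp add: cyl_def)
        have "\<omega> \<in> A n \<longleftrightarrow> (\<forall>k<n. X (Suc k) \<omega> \<notin> \<Lambda>) \<and> X (Suc n) \<omega> = l"
        proof -
          have "(\<forall>k. 0 < k \<and> k < Suc n \<longrightarrow> X k \<omega> \<notin> \<Lambda>) \<longleftrightarrow> (\<forall>k<n. X (Suc k) \<omega> \<notin> \<Lambda>)"
            by (metis Suc_less_eq gr0_conv_Suc zero_less_Suc)
          then show ?thesis using sp l by (auto simp: A_def)
        qed
        also have "\<dots> \<longleftrightarrow> first_return_at n l ws" using Xk by (auto simp: first_return_at_def)
        also have "\<dots> \<longleftrightarrow> \<omega> \<in> (\<Union>ws\<in>S. cyl ws)"
        proof
          assume "\<omega> \<in> (\<Union>ws\<in>S. cyl ws)"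
          then obtain ws' where ws': "ws' \<in> S" "\<omega> \<in> cyl ws'" by blast
          moreover from this have "ws' \<in> walks (Suc n) 0" unfolding S_def by blast
          then have "length ws = length ws'" using len length_walks by metis
          ultimately have "ws = ws'" using cyl_eq ws by blast
          then show "first_return_at n l ws" using ws' by (simp add: S_def)
        qed (use ws in \<open>auto simp: S_def\<close>)
        finally show ?case .
      qed
      show "(\<Union>ws\<in>S. cyl ws) \<in> sets M"
      proof (rule sets.finite_UN)
        show "finite S"
          by (rule finite_subset[OF _ finite_walks[OF origin, of "Suc n"]]) (unfold S_def, blast)
      qed (rule cyl_sets)
    qed (rule A_sets)
    also have "\<dots> = (\<Sum>ws\<in>S. path_prob ws 0)" by (rule prob_Union[of _ "Suc n"]) (auto simp: S_def)
    also have "\<dots> = return_prob n 0 l"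
      unfolding return_prob_eq_sum_walks[OF l origin] S_def
      by (rule sum.inter_filter) (rule finite_walks[OF origin])
    finally show ?thesis .
  qed
  have disj: "disjoint_family A"
    unfolding disjoint_family_on_def
  proof (intro ballI impI)
    fix i j :: nat assume "i \<noteq> j"
    then consider "i < j" | "j < i" by linarith
    then show "A i \<inter> A j = {}"
      by cases (auto simp: A_def)
  qed
  have "(\<lambda>n. measure M (A n)) sums measure M (\<Union>n. A n)"
    using A_sets disj by (intro finite_measure_UNION) auto
  then have "measure M (\<Union>n. A n) = rho l"
    unfolding A_prob rho_def by (rule sums_unique)
  moreover have "(\<Union>n. A n) = {\<omega> \<in> space M. \<exists>n>0. X n \<omega> \<in> \<Lambda> \<and> (\<forall>k. 0 < k \<and> k < n \<longrightarrow> X k \<omega> \<notin> \<Lambda>) \<and> X n \<omega> = l}"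
    unfolding A_def by (auto simp: gr0_conv_Suc)
  ultimately show ?thesis by (simp add: first_return_dist_def)
qed

end

section \<open>Dominated convergence on the cube\<close>

lemma countable_integer_vectors: "countable (integer_vectors :: (real ^ 'n) set)"
proof (rule countable_subset)
  show "integer_vectors \<subseteq> range (\<lambda>f :: 'n \<Rightarrow> int. \<chi> i. real_of_int (f i))"
  proof
    fix k :: "real ^ 'n" assume k: "k \<in> integer_vectors"
    have "k = (\<chi> i. real_of_int \<lfloor>k $ i\<rfloor>)"
      unfolding Finite_Cartesian_Product.vec_eq_iff vec_lambda_beta
      by (auto simp only: floor_integer_vector[OF k])
    then show "k \<in> range (\<lambda>f :: 'n \<Rightarrow> int. \<chi> i. real_of_int (f i))"
      by (intro image_eqI[where x = "\<lambda>i. \<lfloor>k $ i\<rfloor>"]) auto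
  qed
qed auto

abbreviation off_half_integers :: "real ^ 'n \<Rightarrow> bool" where
  "off_half_integers y \<equiv> 2 *\<^sub>R y \<notin> integer_vectors"

lemma AE_not_half_integer: "AE y :: real ^ 'n in lborel. off_half_integers y"
proof -
  have "{y :: real ^ 'n. 2 *\<^sub>R y \<in> integer_vectors} \<subseteq> (\<lambda>k. (1 / 2) *\<^sub>R k) ` integer_vectors"
    by (auto intro!: image_eqI[where x = "2 *\<^sub>R _"])
  then have "countable {y :: real ^ 'n. 2 *\<^sub>R y \<in> integer_vectors}"
    using countable_integer_vectors countable_image countable_subset by blast
  then have "{y :: real ^ 'n. 2 *\<^sub>R y \<in> integer_vectors} \<in> null_sets lborel"
    by (rule countable_imp_null_set_lborel)
  from AE_not_in[OF this] show ?thesis by simp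
qed

lemma torus_norm_pos:
  assumes "y \<notin> integer_vectors" shows "torus_norm y > 0"
proof (rule ccontr)
  assume "\<not> torus_norm y > 0"
  then have z: "\<bar>sin (pi * y $ i)\<bar> \<le> 0" for i
    using abs_sin_le_torus_norm[of y i] by linarith
  have "y $ i \<in> \<int>" for i
  proof -
    have "sin (pi * y $ i) = 0" using z[of i] by simp
    then obtain n where "pi * y $ i = of_int n * pi" by (auto simp: sin_zero_iff_int2)
    then show ?thesis by simp
  qed
  then show False using assms by (simp add: integer_vectors_def)
qed

lemma half_integer_of_integer: "y \<in> integer_vectors \<Longrightarrow> 2 *\<^sub>R y \<in> integer_vectors"
  by (simp add: integer_vectors_def)

text \<open>The half integers form a null set, and the free walk need not contract at them; the bound and the
  convergence are therefore required elsewhere only.\<close>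

lemma cube_dominated_convergence:
  fixes f :: "nat \<Rightarrow> real ^ 'n \<Rightarrow> complex"
  assumes p: "0 < p" "p < CARD('n)" and f: "\<And>n. continuous_on UNIV (f n)" and g: "g \<in> borel_measurable borel"
    and bd: "\<And>n y. off_half_integers y \<Longrightarrow> y \<in> cbox 0 1 \<Longrightarrow> norm (f n y) \<le> K * (1 / torus_norm y ^ p)"
    and lim: "\<And>y. off_half_integers y \<Longrightarrow> (\<lambda>n. f n y) \<longlonglongrightarrow> g y"
  shows "set_integrable lborel (cbox 0 1) g"
    "(\<lambda>n. LINT y:cbox 0 1|lborel. f n y) \<longlonglongrightarrow> (LINT y:cbox 0 1|lborel. g y)"
    "norm (LINT y:cbox 0 1|lborel. f n y) \<le> K * (LINT y:cbox 0 (1 :: real ^ 'n)|lborel. 1 / torus_norm y ^ p)"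
proof -
  let ?C = "cbox 0 1 :: (real ^ 'n) set"
  let ?w = "\<lambda>y :: real ^ 'n. indicator ?C y *\<^sub>R (K * (1 / torus_norm y ^ p))"
  have w0: "integrable lborel (\<lambda>y :: real ^ 'n. indicator ?C y *\<^sub>R (1 / torus_norm y ^ p))"
    using torus_norm_power_integrable[OF p] by (simp add: set_integrable_def)
  then have w: "integrable lborel ?w"
    using integrable_mult_right[OF w0, of K] by (simp add: mult_ac)
  have fm: "(\<lambda>y. indicator ?C y *\<^sub>R f n y) \<in> borel_measurable lborel" for n
    using borel_measurable_continuous_onI[OF f[of n]] by measurable
  have gm: "(\<lambda>y. indicator ?C y *\<^sub>R g y) \<in> borel_measurable lborel"
    using g by measurable
  have L: "AE y in lborel. (\<lambda>n. indicator ?C y *\<^sub>R f n y) \<longlonglongrightarrow> indicator ?C y *\<^sub>R g y"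
    using AE_not_half_integer by eventually_elim (intro tendsto_scaleR tendsto_const lim)
  have B: "AE y in lborel. norm (indicator ?C y *\<^sub>R f n y) \<le> ?w y" for n
    using AE_not_half_integer by eventually_elim (use bd in \<open>auto simp: indicator_def\<close>)
  show "set_integrable lborel ?C g"
    unfolding set_integrable_def by (rule integrable_dominated_convergence[OF gm fm w L B])
  show "(\<lambda>n. LINT y:?C|lborel. f n y) \<longlonglongrightarrow> (LINT y:?C|lborel. g y)"
    unfolding set_lebesgue_integral_def by (rule integral_dominated_convergence[OF gm fm w L B])
  have fi: "integrable lborel (\<lambda>y. indicator ?C y *\<^sub>R f n y)"
    using set_integrable_continuous_cube[OF f[of n]] by (simp add: set_integrable_def)
  have "norm (LINT y:?C|lborel. f n y) \<le> integral\<^sup>L lborel (\<lambda>y. norm (indicator ?C y *\<^sub>R f n y))"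
    unfolding set_lebesgue_integral_def by (rule integral_norm_bound)
  also have "\<dots> \<le> integral\<^sup>L lborel ?w"
    by (rule integral_mono_AE[OF integrable_norm[OF fi] w B])
  also have "\<dots> = K * (LINT y:?C|lborel. 1 / torus_norm y ^ p)"
  proof -
    have "?w = (\<lambda>y. K * (indicator ?C y *\<^sub>R (1 / torus_norm y ^ p)))" by (simp add: fun_eq_iff)
    then show ?thesis unfolding set_lebesgue_integral_def by (simp only: integral_mult_right_zero)
  qed
  finally show "norm (LINT y:?C|lborel. f n y) \<le> K * (LINT y:?C|lborel. 1 / torus_norm y ^ p)" .
qed

lemma norm_torus_char_minus_1_le_weight:
  assumes "k \<in> integer_vectors"
  shows "norm (torus_char k y - 1) \<le> 2 * lattice_weight k * torus_norm y"
proof -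
  have "norm (torus_char k y - 1) \<le> (\<Sum>i\<in>UNIV. \<bar>k $ i\<bar> * (2 * \<bar>sin (pi * y $ i)\<bar>))"
    by (rule norm_torus_char_minus_1[OF assms])
  also have "\<dots> \<le> (\<Sum>i\<in>UNIV. lattice_weight k * (2 * \<bar>sin (pi * y $ i)\<bar>))"
    by (intro sum_mono mult_right_mono abs_nth_le_lattice_weight) auto
  also have "\<dots> = 2 * lattice_weight k * torus_norm y"
    by (simp add: torus_norm_def sum_distrib_left mult_ac)
  finally show ?thesis .
qed

context periodic_walk
begin

section \<open>The Green's function\<close>

definition green_trunc :: "nat \<Rightarrow> real ^ 'n \<Rightarrow> real" where
  "green_trunc N l = (\<Sum>n<N. walk_prob n 0 l)"

definition green_supp :: "nat \<Rightarrow> (real ^ 'n) set" where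
  "green_supp N = {l \<in> \<Lambda>. \<exists>n<N. walk_prob n 0 l \<noteq> 0}"

lemma finite_reach: "u \<in> V \<Longrightarrow> finite {w. walk_prob n u w \<noteq> 0}"
proof (induction n arbitrary: u)
  case 0
  then show ?case by (simp add: delta_def)
next
  case (Suc n)
  have sub: "{w. walk_prob (Suc n) u w \<noteq> 0} \<subseteq> (\<Union>x\<in>nbrs u. {w. walk_prob n x w \<noteq> 0})"
  proof
    fix w assume "w \<in> {w. walk_prob (Suc n) u w \<noteq> 0}"
    then have "(\<Sum>x\<in>nbrs u. P u x *\<^sub>R walk_prob n x w) \<noteq> 0" by (simp add: walk_op_def)
    then obtain x where "x \<in> nbrs u" "P u x *\<^sub>R walk_prob n x w \<noteq> 0"
      by (meson sum.neutral)
    then show "w \<in> (\<Union>x\<in>nbrs u. {w. walk_prob n x w \<noteq> 0})" by auto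
  qed
  show ?case by (rule finite_subset[OF sub]) (use Suc in \<open>auto simp: nbrs_sub\<close>)
qed

lemma finite_green_supp: "finite (green_supp N)"
proof -
  have sub: "green_supp N \<subseteq> (\<Union>n<N. {w. walk_prob n 0 w \<noteq> 0})" by (auto simp: green_supp_def)
  show ?thesis by (rule finite_subset[OF sub]) (use finite_reach[OF origin] in auto)
qed

lemma lattice_phase_has_sum:
  "u \<in> V \<Longrightarrow> ((\<lambda>l. of_real (walk_prob n u l) * lchar x l) has_sum iter {} n (lattice_phase x) u) \<Lambda>"
proof (induction n arbitrary: u)
  case (0 u)
  have "((\<lambda>l. of_real (walk_prob 0 u l) * lchar x l) has_sum iter {} 0 (lattice_phase x) u) \<Lambda> \<longleftrightarrow>
      ((\<lambda>l. of_real (walk_prob 0 u l) * lchar x l) has_sum iter {} 0 (lattice_phase x) u) ({u} \<inter> \<Lambda>)"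
    by (intro has_sum_cong_neutral) (auto simp: delta_def)
  also have "\<dots>"
    by (intro has_sum_finiteI) (auto simp: lattice_phase_def delta_def)
  finally show ?case .
next
  case (Suc n u)
  have "((\<lambda>l. \<Sum>w\<in>nbrs u. of_real (P u w) * (of_real (walk_prob n w l) * lchar x l)) has_sum
      (\<Sum>w\<in>nbrs u. of_real (P u w) * iter {} n (lattice_phase x) w)) \<Lambda>"
    using Suc by (intro has_sum_finite_sum has_sum_cmult_right) (auto simp: nbrs_sub)
  moreover have "(\<Sum>w\<in>nbrs u. of_real (P u w) * (of_real (walk_prob n w l) * lchar x l)) =
      of_real (walk_prob (Suc n) u l) * lchar x l" for l
    by (simp add: walk_op_def sum_distrib_right mult.assoc)
  moreover have "(\<Sum>w\<in>nbrs u. of_real (P u w) * iter {} n (lattice_phase x) w) = iter {} (Suc n) (lattice_phase x) u"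
    by (simp add: walk_op_def scaleR_conv_of_real)
  ultimately show ?case by simp
qed

lemma green_partial_has_sum:
  "((\<lambda>l. of_real (green_trunc N l) * lchar x l) has_sum green_partial x N) \<Lambda>"
proof -
  have "((\<lambda>l. \<Sum>n<N. of_real (walk_prob n 0 l) * lchar x l) has_sum (\<Sum>n<N. iter {} n (lattice_phase x) 0)) \<Lambda>"
    by (intro has_sum_finite_sum lattice_phase_has_sum origin) auto
  then show ?thesis by (simp add: green_trunc_def green_partial_def sum_distrib_right)
qed

lemma green_trunc_eq_0: "l \<in> \<Lambda> \<Longrightarrow> l \<notin> green_supp N \<Longrightarrow> green_trunc N l = 0"
  by (simp add: green_trunc_def green_supp_def)

lemma green_partial_eq_sum:
  "green_partial x N = (\<Sum>l\<in>green_supp N. of_real (green_trunc N l) * lchar x l)"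
proof -
  have "((\<lambda>l. of_real (green_trunc N l) * lchar x l) has_sum green_partial x N) (green_supp N)"
    using green_partial_has_sum
    by (rule has_sum_cong_neutral[THEN iffD1, rotated -1]) (auto simp: green_trunc_eq_0 green_supp_def)
  from has_sum_unique[OF this has_sum_finite[OF finite_green_supp]] show ?thesis .
qed

lemma continuous_green_partial: "continuous_on S (\<lambda>x. green_partial x N)"
  unfolding green_partial_eq_sum by (intro continuous_intros)

lemma green_partial_cube_integral:
  assumes "continuous_on UNIV \<phi>"
  shows "(LINT y:cbox 0 1|lborel. green_partial y N * \<phi> y) =
    (\<Sum>l\<in>green_supp N. of_real (green_trunc N l) * fourier_coeff \<phi> (L l))"
proof -
  have "(LINT y:cbox 0 1|lborel. green_partial y N * \<phi> y) =
      integral (cbox 0 1) (\<lambda>y. green_partial y N * \<phi> y)"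
    by (intro cube_integral_eq_HK continuous_intros continuous_green_partial assms)
  also have "\<dots> = integral (cbox 0 1) (\<lambda>y. \<Sum>l\<in>green_supp N. of_real (green_trunc N l) * (lchar y l * \<phi> y))"
    by (simp add: green_partial_eq_sum sum_distrib_right mult.assoc)
  also have "\<dots> = (\<Sum>l\<in>green_supp N. integral (cbox 0 1) (\<lambda>y. of_real (green_trunc N l) * (lchar y l * \<phi> y)))"
    by (intro integral_sum finite_green_supp integrable_continuous continuous_intros
        continuous_on_subset[OF assms]) auto
  also have "\<dots> = (\<Sum>l\<in>green_supp N. of_real (green_trunc N l) * fourier_coeff \<phi> (L l))"
    by (simp add: fourier_coeff_eq_HK[OF assms])
  finally show ?thesis .
qed

lemma green_trunc_integral:
  assumes l: "l \<in> \<Lambda>"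
  shows "(LINT y:cbox 0 1|lborel. green_partial y N * cnj (lchar y l)) = of_real (green_trunc N l)"
proof -
  have "(LINT y:cbox 0 1|lborel. green_partial y N * torus_char (- L l) y) =
      (\<Sum>k\<in>green_supp N. of_real (green_trunc N k) * fourier_coeff (torus_char (- L l)) (L k))"
    by (rule green_partial_cube_integral) (rule continuous_on_torus_char)
  also have "\<dots> = (\<Sum>k\<in>green_supp N. if k = l then of_real (green_trunc N k) else 0)"
  proof (rule sum.cong[OF refl])
    fix k assume "k \<in> green_supp N"
    then have k: "k \<in> \<Lambda>" by (simp add: green_supp_def)
    have "L k = L l \<longleftrightarrow> k = l" using bij_is_inj[OF L_bij] by (auto dest: injD)
    then show "complex_of_real (green_trunc N k) * fourier_coeff (torus_char (- L l)) (L k) =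
        (if k = l then of_real (green_trunc N k) else 0)"
      using k l by (simp add: fourier_coeff_torus_char lattice_mem_iff integer_vectors_minus)
  qed
  also have "\<dots> = of_real (green_trunc N l)"
    using green_trunc_eq_0[OF l] finite_green_supp by (auto simp: sum.delta)
  finally show ?thesis by (simp add: torus_char_minus)
qed

lemma rhohat_measurable: "rhohat \<in> borel_measurable borel"
proof -
  have "continuous_on UNIV (\<lambda>x. return_phase x n u)" for n u
    unfolding return_phase_def
  proof (induction n arbitrary: u)
    case 0
    then show ?case by (simp add: hit_op_def) (intro continuous_intros)
  next
    case (Suc n)
    then show ?case unfolding iter_Suc by (intro continuous_intros)
  qed
  then show ?thesis
    unfolding return_transform_def by (intro borel_measurable_suminf borel_measurable_continuous_onI)
qed

lemma return_symbol_neq_1: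
  assumes "x \<notin> integer_vectors" shows "1 - rhohat x \<noteq> 0"
proof
  obtain c where c: "c > 0" "\<And>x. c * (torus_norm x)\<^sup>2 \<le> norm (1 - rhohat x)"
    using return_symbol_lower_bound by blast
  assume "1 - rhohat x = 0"
  then have "c * (torus_norm x)\<^sup>2 \<le> 0" using c(2)[of x] by simp
  moreover have "c * (torus_norm x)\<^sup>2 > 0" using c(1) torus_norm_pos[OF assms] by simp
  ultimately show False by simp
qed

text \<open>In dimension two the value of the truncated Green function at the origin is subtracted, in higher
  dimensions it is not.\<close>

definition renorm :: real where "renorm = (if CARD('n) = 2 then 1 else 0)"

text \<open>The order of the singularity at the integer points after a factor that vanishes there to first
  order has been used in dimension two.\<close>

definition sing_order :: nat where "sing_order = (if CARD('n) = 2 then 1 else 2)"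

lemma green_partial_singularity:
  obtains C where "C \<ge> 0" "\<And>x N. norm (green_partial x N) * (torus_norm x)\<^sup>2 \<le> C"
proof -
  obtain c where c: "c > 0" "\<And>x. c * (torus_norm x)\<^sup>2 \<le> norm (1 - rhohat x)"
    using return_symbol_lower_bound by blast
  have "norm (green_partial x N) * (torus_norm x)\<^sup>2 \<le> 2 / c" for x N
  proof -
    have "c * (torus_norm x)\<^sup>2 * norm (green_partial x N) \<le> norm (1 - rhohat x) * norm (green_partial x N)"
      by (intro mult_right_mono c) auto
    also have "\<dots> \<le> 2" by (rule green_partial_bound)
    finally show ?thesis using c(1) by (simp add: field_simps)
  qed
  then show ?thesis using that[of "2 / c"] c(1) by simp
qed

text \<open>In dimension two \<open>z\<close> has to vanish to first order at the integer points; it will be a character minus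
  one, or a test function that vanishes at the origin.\<close>

lemma green_times_vanishing_bound:
  obtains C where "C \<ge> 0"
    "\<And>x N b z. off_half_integers x \<Longrightarrow> b \<ge> 0 \<Longrightarrow> norm z \<le> b * torus_norm x ^ (2 - sing_order) \<Longrightarrow>
       norm (green_partial x N * z) \<le> C * b * (1 / torus_norm x ^ sing_order)"
proof -
  obtain C where C: "C \<ge> 0" "\<And>x N. norm (green_partial x N) * (torus_norm x)\<^sup>2 \<le> C"
    using green_partial_singularity by blast
  have "norm (green_partial x N * z) \<le> C * b * (1 / torus_norm x ^ sing_order)"
    if x: "off_half_integers x" and b: "b \<ge> 0" and z: "norm z \<le> b * torus_norm x ^ (2 - sing_order)" for x N b z
  proof -
    have t: "torus_norm x > 0" using x half_integer_of_integer torus_norm_pos by blast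
    have "norm (green_partial x N * z) * torus_norm x ^ sing_order \<le>
        norm (green_partial x N) * (b * torus_norm x ^ (2 - sing_order)) * torus_norm x ^ sing_order"
      unfolding norm_mult using z t by (intro mult_right_mono mult_left_mono) auto
    also have "\<dots> = norm (green_partial x N) * (torus_norm x)\<^sup>2 * b"
      by (simp add: sing_order_def power2_eq_square)
    also have "\<dots> \<le> C * b" using C(2) b by (rule mult_right_mono)
    finally show ?thesis using t by (simp add: field_simps)
  qed
  then show ?thesis using that C(1) by blast
qed

lemma sing_order_less: "0 < sing_order" "2 \<le> CARD('n) \<Longrightarrow> sing_order < CARD('n)"
  by (simp_all add: sing_order_def)

definition green_renorm :: "nat \<Rightarrow> real ^ 'n \<Rightarrow> real" where
  "green_renorm N l = green_trunc N l - renorm * green_trunc N 0"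

lemma integral_green_renorm:
  assumes l: "l \<in> \<Lambda>"
  shows "(LINT y:cbox 0 1|lborel. green_partial y N * (cnj (lchar y l) - of_real renorm)) =
    of_real (green_renorm N l)"
proof -
  have int: "set_integrable lborel (cbox 0 1) (\<lambda>y. green_partial y N * cnj (lchar y k))" for k
    by (intro set_integrable_continuous_cube continuous_intros continuous_green_partial continuous_on_torus_char)
  have "(LINT y:cbox 0 1|lborel. green_partial y N * (cnj (lchar y l) - of_real renorm)) =
      (LINT y:cbox 0 1|lborel. green_partial y N * cnj (lchar y l) - of_real renorm * (green_partial y N * cnj (lchar y 0)))"
    by (simp add: algebra_simps)
  also have "\<dots> = (LINT y:cbox 0 1|lborel. green_partial y N * cnj (lchar y l)) -
      (LINT y:cbox 0 1|lborel. of_real renorm * (green_partial y N * cnj (lchar y 0)))"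
    by (intro set_integral_diff int) (intro set_integrable_mult_right int)
  finally show ?thesis
    by (simp only: green_renorm_def set_integral_mult_right green_trunc_integral[OF l] green_trunc_integral[OF zero_lattice] of_real_diff of_real_mult)
qed

text \<open>The truncated Green function is a Fourier coefficient of its symbol, so dominated convergence
  gives the limit together with a bound that is uniform in the truncation.\<close>

lemma green_renorm_convergence:
  assumes d: "2 \<le> CARD('n)"
  obtains C where "C \<ge> 0"
    "\<And>N l. l \<in> \<Lambda> \<Longrightarrow> \<bar>green_renorm N l\<bar> \<le> C * lattice_weight (L l)"
    "\<And>l. l \<in> \<Lambda> \<Longrightarrow> (\<lambda>N. green_renorm N l) \<longlonglongrightarrow>
       real (vertex_degree E 0) * green_function V E l"
proof -
  obtain C where C: "C \<ge> 0" "\<And>x N b z. off_half_integers x \<Longrightarrow> b \<ge> 0 \<Longrightarrow>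
       norm z \<le> b * torus_norm x ^ (2 - sing_order) \<Longrightarrow>
       norm (green_partial x N * z) \<le> C * b * (1 / torus_norm x ^ sing_order)"
    using green_times_vanishing_bound by blast
  define I where "I = (LINT y:cbox 0 (1 :: real ^ 'n)|lborel. 1 / torus_norm y ^ sing_order)"
  have I0: "I \<ge> 0" unfolding I_def set_lebesgue_integral_def
    by (intro integral_nonneg_AE) (auto simp: indicator_def)
  have ne: "1 - rhohat y \<noteq> 0" if "off_half_integers y" for y
    using that half_integer_of_integer return_symbol_neq_1 by blast
  have w1: "lattice_weight k \<ge> 0" for k :: "real ^ 'n" using lattice_weight_ge_1[of k] by linarith
  have fact: "(\<lambda>N. complex_of_real (green_renorm N l)) \<longlonglongrightarrow>
        (LINT y:cbox 0 1|lborel. 1 / (1 - rhohat y) * (cnj (lchar y l) - of_real renorm))"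
      "norm (complex_of_real (green_renorm N l)) \<le> C * (2 * lattice_weight (L l)) * I"
    if l: "l \<in> \<Lambda>" for l N
  proof -
    have cont: "continuous_on UNIV (\<lambda>y. green_partial y N * (cnj (lchar y l) - of_real renorm))" for N
      by (intro continuous_intros continuous_green_partial continuous_on_torus_char)
    have meas: "(\<lambda>y. 1 / (1 - rhohat y) * (cnj (lchar y l) - of_real renorm)) \<in> borel_measurable borel"
    proof -
      have m1: "(\<lambda>y. cnj (lchar y l) - of_real renorm) \<in> borel_measurable borel"
        by (intro borel_measurable_continuous_onI continuous_intros continuous_on_torus_char)
      show ?thesis
        by (rule borel_measurable_times[OF _ m1])
          (intro borel_measurable_divide borel_measurable_diff borel_measurable_const rhohat_measurable)
    qed
    have bd: "norm (green_partial y N * (cnj (lchar y l) - of_real renorm)) \<le>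
        C * (2 * lattice_weight (L l)) * (1 / torus_norm y ^ sing_order)"
      if "off_half_integers y" "y \<in> cbox 0 1" for N y
    proof (rule C(2)[OF that(1)])
      show "norm (cnj (lchar y l) - of_real renorm) \<le> 2 * lattice_weight (L l) * torus_norm y ^ (2 - sing_order)"
      proof (cases "CARD('n) = 2")
        case True
        have "norm (cnj (lchar y l) - 1) = norm (lchar y l - 1)"
          by (metis complex_cnj_diff complex_cnj_one complex_mod_cnj)
        then show ?thesis
          using norm_torus_char_minus_1_le_weight[of "L l" y] l True
          by (simp add: renorm_def sing_order_def lattice_mem_iff)
      next
        case False
        then show ?thesis using lattice_weight_ge_1[of "L l"] by (simp add: renorm_def sing_order_def)
      qed
    qed (use w1 in simp)
    have lim: "(\<lambda>N. green_partial y N * (cnj (lchar y l) - of_real renorm)) \<longlonglongrightarrow>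
        1 / (1 - rhohat y) * (cnj (lchar y l) - of_real renorm)" if "off_half_integers y" for y
      by (intro tendsto_mult tendsto_const green_partial_tendsto that ne)
    note dct = cube_dominated_convergence[OF sing_order_less(1) sing_order_less(2)[OF d] cont meas,
        where K = "C * (2 * lattice_weight (L l))"]
    have conv: "(\<lambda>N. LINT y:cbox 0 1|lborel. green_partial y N * (cnj (lchar y l) - of_real renorm)) \<longlonglongrightarrow>
        (LINT y:cbox 0 1|lborel. 1 / (1 - rhohat y) * (cnj (lchar y l) - of_real renorm))"
      by (rule dct(2)) (fact bd, fact lim)
    have norm: "norm (LINT y:cbox 0 1|lborel. green_partial y N * (cnj (lchar y l) - of_real renorm)) \<le>
        C * (2 * lattice_weight (L l)) * (LINT y:cbox 0 (1 :: real ^ 'n)|lborel. 1 / torus_norm y ^ sing_order)"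
      by (rule dct(3)) (fact bd, fact lim)
    show "(\<lambda>N. complex_of_real (green_renorm N l)) \<longlonglongrightarrow>
        (LINT y:cbox 0 1|lborel. 1 / (1 - rhohat y) * (cnj (lchar y l) - of_real renorm))"
      using conv by (simp only: integral_green_renorm[OF l])
    show "norm (complex_of_real (green_renorm N l)) \<le> C * (2 * lattice_weight (L l)) * I"
      using norm by (simp only: integral_green_renorm[OF l] I_def)
  qed
  have lim: "(\<lambda>N. green_renorm N l) \<longlonglongrightarrow> real (vertex_degree E 0) * green_function V E l"
    if l: "l \<in> \<Lambda>" for l
  proof -
    define a where "a = Re (LINT y:cbox 0 1|lborel. 1 / (1 - rhohat y) * (cnj (lchar y l) - of_real renorm))"
    have "(\<lambda>N. green_renorm N l) \<longlonglongrightarrow> a"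
      using tendsto_Re[OF fact(1)[OF l]] by (simp add: a_def)
    moreover have "real (vertex_degree E 0) * green_function V E l = a"
    proof -
      let ?D = "real (vertex_degree E 0)"
      have D: "?D > 0" using degree_pos[OF origin] by simp
      have Dl: "vertex_degree E l = vertex_degree E 0" using degree_translate[OF origin l] by simp
      let ?t = "\<lambda>n. srw_power V E n 0 l / ?D - renorm * (srw_power V E n 0 0 / ?D)"
      have "(\<Sum>n<N. ?t n) = green_renorm N l / ?D" for N
        by (simp add: green_renorm_def green_trunc_def srw_power_iter sum_subtractf sum_distrib_left sum_divide_distrib diff_divide_distrib)
      then have "?t sums (a / ?D)"
        unfolding sums_def using tendsto_divide[OF \<open>_ \<longlonglongrightarrow> a\<close> tendsto_const, of ?D] D by simp
      then have "(\<Sum>n. ?t n) = a / ?D" by (rule sums_unique[symmetric])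
      moreover have "green_function V E l = (\<Sum>n. ?t n)"
        by (simp add: green_function_def renorm_def Dl)
      ultimately show ?thesis using D by simp
    qed
    ultimately show ?thesis by simp
  qed
  show ?thesis
  proof (rule that[of "C * 2 * I"])
    show "C * 2 * I \<ge> 0" using C(1) I0 by simp
    show "\<bar>green_renorm N l\<bar> \<le> C * 2 * I * lattice_weight (L l)" if "l \<in> \<Lambda>" for N l
    proof -
      have "\<bar>green_renorm N l\<bar> \<le> C * (2 * lattice_weight (L l)) * I"
        using fact(2)[OF that] by (simp only: norm_of_real)
      then show ?thesis by (simp add: mult_ac)
    qed
  qed (rule lim)
qed

text \<open>Paired with a test function, the truncated Green function is a finite sum of Fourier coefficients and
  equals the integral of its symbol against the test function.  Dominated convergence applies to
  both sides.  The term subtracted in dimension two contributes a multiple of the sum of all Fourier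
  coefficients of the test function, which vanishes.\<close>

theorem green_fourier_transform:
  assumes d: "2 \<le> CARD('n)"
  shows "has_fourier_transform_off (if CARD('n) = 2 then {0} else {}) \<Lambda> L
    (\<lambda>l. of_nat (vertex_degree E 0) * of_real (green_function V E l)) (\<lambda>x. 1 / (1 - rhohat x))"
  unfolding has_fourier_transform_off_def
proof (intro allI impI, elim conjE)
  fix \<phi> :: "real ^ 'n \<Rightarrow> complex"
  assume \<phi>: "torus_test_function \<phi>" and Z: "\<forall>y\<in>(if CARD('n) = 2 then {0} else {}). \<phi> y = 0"
  obtain D :: "'n list \<Rightarrow> real ^ 'n \<Rightarrow> complex" where D: "D [] = \<phi>"
    "\<And>is. continuous_on UNIV (D is)" "\<And>is. integer_periodic (D is)"
    "\<And>is i x. ((\<lambda>t. D is (x + t *\<^sub>R axis i 1)) has_vector_derivative D (i # is) x) (at 0)"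
    using torus_test_function_derivatives[OF \<phi>] by blast
  have cont: "continuous_on UNIV \<phi>" and per: "integer_periodic \<phi>" using D(1-3) by metis+
  have fc: "(LINT y:cbox 0 1|lborel. lattice_character L y l * \<phi> y) = fourier_coeff \<phi> (L l)" for l
    by (simp add: fourier_coeff_def lattice_character_eq)
  have "\<exists>b\<ge>0. (\<forall>y\<in>cbox 0 1. norm (\<phi> y) \<le> b * torus_norm y ^ (2 - sing_order))"
  proof (cases "CARD('n) = 2")
    case True
    then have "\<phi> 0 = 0" using Z by simp
    have "\<forall>i. \<exists>B. B > 0 \<and> (\<forall>x. norm (D [i] x) \<le> B)"
      using continuous_integer_periodic_bounded[OF D(2,3)] by metis
    then obtain B where B: "\<And>i. B i > 0" "\<And>i x. norm (D [i] x) \<le> B i" by metis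
    have "norm (D [i] x) \<le> (\<Sum>i\<in>UNIV. B i)" for i x
      using B(2)[of i x] member_le_sum[of i UNIV B] B(1) by (auto intro: less_imp_le order_trans)
    then have "norm (\<phi> y) \<le> (\<Sum>i\<in>UNIV. B i) * torus_norm y" if "y \<in> cbox 0 1" for y
      using D(4)[of "[]"] unfolding D(1)
      by (intro test_function_vanishing_at_0_bound[where \<phi>' = "\<lambda>i. D [i]"] per \<open>\<phi> 0 = 0\<close> that) auto
    moreover have "(\<Sum>i\<in>UNIV. B i) \<ge> 0" using B(1) by (intro sum_nonneg less_imp_le)
    ultimately show ?thesis using True
      by (intro exI[of _ "\<Sum>i\<in>UNIV. B i"]) (simp add: sing_order_def)
  next
    case False
    obtain B where "B > 0" "\<And>x. norm (\<phi> x) \<le> B"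
      using continuous_integer_periodic_bounded[OF cont per] by blast
    then show ?thesis using False by (intro exI[of _ B]) (auto simp: sing_order_def)
  qed
  then obtain b where b: "b \<ge> 0" "\<And>y. y \<in> cbox 0 1 \<Longrightarrow> norm (\<phi> y) \<le> b * torus_norm y ^ (2 - sing_order)"
    by blast
  obtain C where C: "C \<ge> 0" "\<And>x N b z. off_half_integers x \<Longrightarrow> b \<ge> 0 \<Longrightarrow>
       norm z \<le> b * torus_norm x ^ (2 - sing_order) \<Longrightarrow>
       norm (green_partial x N * z) \<le> C * b * (1 / torus_norm x ^ sing_order)"
    using green_times_vanishing_bound by blast
  have cont_n: "continuous_on UNIV (\<lambda>y. green_partial y N * \<phi> y)" for N
    by (intro continuous_intros continuous_green_partial cont)
  have meas: "(\<lambda>y. 1 / (1 - rhohat y) * \<phi> y) \<in> borel_measurable borel"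
    by (intro borel_measurable_times borel_measurable_divide borel_measurable_diff
        borel_measurable_const rhohat_measurable borel_measurable_continuous_onI[OF cont])
  have bd: "norm (green_partial y N * \<phi> y) \<le> C * b * (1 / torus_norm y ^ sing_order)"
    if "off_half_integers y" "y \<in> cbox 0 1" for N y
    by (rule C(2)[OF that(1) b(1) b(2)[OF that(2)]])
  have lim: "(\<lambda>N. green_partial y N * \<phi> y) \<longlonglongrightarrow> 1 / (1 - rhohat y) * \<phi> y"
    if "off_half_integers y" for y
    by (intro tendsto_mult tendsto_const green_partial_tendsto that return_symbol_neq_1)
      (use that half_integer_of_integer in blast)
  note dct = cube_dominated_convergence[OF sing_order_less(1) sing_order_less(2)[OF d] cont_n meas, where K = "C * b"]
  have int: "set_integrable lborel (cbox 0 1) (\<lambda>y. 1 / (1 - rhohat y) * \<phi> y)"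
    by (rule dct(1)) (fact bd, fact lim)
  have conv: "(\<lambda>N. LINT y:cbox 0 1|lborel. green_partial y N * \<phi> y) \<longlonglongrightarrow>
      (LINT y:cbox 0 1|lborel. 1 / (1 - rhohat y) * \<phi> y)"
    by (rule dct(2)) (fact bd, fact lim)
  let ?I = "LINT y:cbox 0 1|lborel. 1 / (1 - rhohat y) * \<phi> y"
  obtain C' where C': "C' \<ge> 0"
    "\<And>N l. l \<in> \<Lambda> \<Longrightarrow> \<bar>green_renorm N l\<bar> \<le> C' * lattice_weight (L l)"
    "\<And>l. l \<in> \<Lambda> \<Longrightarrow> (\<lambda>N. green_renorm N l) \<longlonglongrightarrow>
       real (vertex_degree E 0) * green_function V E l"
    using green_renorm_convergence[OF d] by blast
  let ?fc = "\<lambda>l. fourier_coeff \<phi> (L l)"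
  let ?a = "\<lambda>N l. complex_of_real (green_renorm N l) * ?fc l"
  let ?b = "\<lambda>l. complex_of_real (real (vertex_degree E 0) * green_function V E l) * ?fc l"
  have wsum: "(\<lambda>l. lattice_weight (L l) * norm (?fc l)) summable_on \<Lambda>"
    using weighted_fourier_coeff_summable[OF \<phi>]
    by (subst summable_on_reindex_bij_betw[OF lattice_bij, of "\<lambda>k. lattice_weight k * norm (fourier_coeff \<phi> k)"])
  have fc_le: "norm (fourier_coeff \<phi> k) \<le> lattice_weight k * norm (fourier_coeff \<phi> k)" for k
    using mult_right_mono[OF lattice_weight_ge_1[of k] norm_ge_zero[of "fourier_coeff \<phi> k"]] by simp
  have fsum: "(\<lambda>k. norm (fourier_coeff \<phi> k)) summable_on integer_vectors"
    by (rule summable_on_comparison_test[OF weighted_fourier_coeff_summable[OF \<phi>]]) (use fc_le in auto)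
  have "(fourier_coeff \<phi> has_sum infsum (fourier_coeff \<phi>) integer_vectors) integer_vectors"
    by (rule has_sum_infsum[OF abs_summable_summable[OF fsum]])
  then have fc_sum: "(?fc has_sum infsum (fourier_coeff \<phi>) integer_vectors) \<Lambda>"
    by (subst has_sum_reindex_bij_betw[OF lattice_bij, of "fourier_coeff \<phi>"])
  have renorm_sum: "of_real renorm * infsum (fourier_coeff \<phi>) integer_vectors = 0"
  proof (cases "CARD('n) = 2")
    case True
    then have "infsum (fourier_coeff \<phi>) integer_vectors = 0"
      using b by (intro infsum_fourier_coeff_eq_0[OF cont b(1) _ fsum]) (simp add: sing_order_def)
    then show ?thesis by simp
  qed (simp add: renorm_def)
  have sum_a: "(?a N has_sum (LINT y:cbox 0 1|lborel. green_partial y N * \<phi> y)) \<Lambda>" for N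
  proof -
    let ?S = "\<Sum>l\<in>green_supp N. of_real (green_trunc N l) * ?fc l"
    have "((\<lambda>l. of_real (green_trunc N l) * ?fc l) has_sum ?S) \<Lambda> \<longleftrightarrow>
        ((\<lambda>l. of_real (green_trunc N l) * ?fc l) has_sum ?S) (green_supp N)"
      by (intro has_sum_cong_neutral) (auto simp: green_trunc_eq_0 green_supp_def)
    then have "((\<lambda>l. of_real (green_trunc N l) * ?fc l) has_sum ?S) \<Lambda>"
      using finite_green_supp by simp
    then have hs: "((\<lambda>l. of_real (green_trunc N l) * ?fc l + (- of_real (renorm * green_trunc N 0)) * ?fc l) has_sum
        (?S + (- of_real (renorm * green_trunc N 0)) * infsum (fourier_coeff \<phi>) integer_vectors)) \<Lambda>"
      by (intro has_sum_add has_sum_cmult_right fc_sum)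
    have zero: "(- complex_of_real (renorm * green_trunc N 0)) * infsum (fourier_coeff \<phi>) integer_vectors = 0"
      using renorm_sum by auto
    show ?thesis
      using hs unfolding zero green_partial_cube_integral[OF cont] by (simp add: green_renorm_def algebra_simps)
  qed
  have gsum: "(\<lambda>l. C' * (lattice_weight (L l) * norm (?fc l))) summable_on \<Lambda>"
    by (intro summable_on_cmult_right wsum)
  have abd: "norm (?a N l) \<le> C' * (lattice_weight (L l) * norm (?fc l))" if "l \<in> \<Lambda>" for N l
    using mult_right_mono[OF C'(2)[OF that, of N] norm_ge_zero[of "?fc l"]]
    by (simp add: norm_mult mult.assoc)
  have alim: "(\<lambda>N. ?a N l) \<longlonglongrightarrow> ?b l" if "l \<in> \<Lambda>" for l
    by (intro tendsto_mult tendsto_const tendsto_of_real C'(3)[OF that])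
  have isum: "infsum (?a N) \<Lambda> = (LINT y:cbox 0 1|lborel. green_partial y N * \<phi> y)" for N
    by (rule infsumI[OF sum_a])
  have "(\<lambda>N. infsum (?a N) \<Lambda>) \<longlonglongrightarrow> infsum ?b \<Lambda>"
    by (rule tannery_infsum(2)[OF gsum]) (fact abd, fact alim)
  then have "infsum ?b \<Lambda> = ?I"
    using conv unfolding isum by (rule LIMSEQ_unique)
  moreover have "(?b has_sum infsum ?b \<Lambda>) \<Lambda>"
    by (rule tannery_infsum(1)[OF gsum]) (fact abd, fact alim)
  ultimately have "(?b has_sum ?I) \<Lambda>" by simp
  then show "set_integrable lborel (cbox 0 1) (\<lambda>y. 1 / (1 - rhohat y) * \<phi> y) \<and>
      ((\<lambda>l. of_nat (vertex_degree E 0) * of_real (green_function V E l) *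
         (LINT y:cbox 0 1|lborel. lattice_character L y l * \<phi> y)) has_sum ?I) \<Lambda>"
    using int by (simp add: fc)
qed

end

section \<open>The transforms of the return distribution and of the Green function\<close>

theorem theorem21:
  fixes \<Lambda> V :: "(real ^ 'n) set" and E :: "(real ^ 'n) set set"
    and L :: "real ^ 'n \<Rightarrow> real ^ 'n"
    and m :: nat and v :: "nat \<Rightarrow> real ^ 'n"
    and M :: "'w measure" and X :: "nat \<Rightarrow> 'w \<Rightarrow> real ^ 'n"
    and Q :: "real ^ 'n \<Rightarrow> complex mat"
  assumes "CARD('n) \<ge> 2"
    and "identifies_lattice \<Lambda> L"
    and "periodic_tiling \<Lambda> V E"
    and "0 \<in> V"
    and "orbit_representatives \<Lambda> V m v"
    and "simple_random_walk V E 0 M X"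
    and "\<And>x. Q x = quotient_matrix \<Lambda> L V E m v (unit_phases x)"
  shows "(\<forall>x. invertible_mat (resolvent_base (Q x)) \<and>
            ((\<lambda>l. of_real (first_return_dist \<Lambda> M X l) * lattice_character L x l)
               has_sum return_symbol (Q x)) \<Lambda>) \<and>
         (\<forall>x. x \<notin> integer_vectors \<longrightarrow> 1 - return_symbol (Q x) \<noteq> 0) \<and>
         has_fourier_transform_off (if CARD('n) = 2 then {0} else {}) \<Lambda> L
           (\<lambda>l. of_nat (vertex_degree E 0) * of_real (green_function V E l))
           (\<lambda>x. 1 / (1 - return_symbol (Q x)))"
proof -
  interpret periodic_walk \<Lambda> V E L m v
    using assms(2-5) by unfold_locales
  have Q: "Q x = walk_matrix x" for x by (rule assms(7))
  have symbol: "return_symbol (Q x) = rhohat x" for x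
    unfolding Q by (rule return_symbol_eq_rhohat(2))
  have "((\<lambda>l. of_real (first_return_dist \<Lambda> M X l) * lattice_character L x l) has_sum rhohat x) \<Lambda>" for x
    using rho_has_sum[of x] first_return_dist_eq_rho[OF assms(6)]
    by (subst has_sum_cong[where g = "\<lambda>l. of_real (rho l) * lchar x l"]) (simp_all add: lattice_character_eq)
  moreover have "invertible_mat (resolvent_base (Q x))" for x
    unfolding Q by (rule return_symbol_eq_rhohat(1))
  ultimately show ?thesis
    unfolding symbol using return_symbol_neq_1 green_fourier_transform[OF assms(1)] by blast
qed

end
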